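(* (i) For any $\beta>1$, $\mathscr{E}_\beta=\{t\in[0,1): T_\beta^n(t)\ge t\ \forall n\ge 0\}$. (ii) For any $\beta>1$, $\mathscr{E}_\beta$ is a Lebesgue null set of full Hausdorff dimension (that is, $\dim_H\mathscr{E}_\beta=1$). (iii) For Lebesgue-almost every $\beta\in(1,\infty)$, $\mathscr{E}_\beta$ contains both infinitely many isolated points and infinitely many accumulation points arbitrarily close to zero. (iv) There is an uncountable set $E_L\subseteq(1,\infty)$ of zero Hausdorff dimension such that, for $\beta>1$, $\mathscr{E}_\beta$ contains no isolated points if and only if $\beta\in E_L$.
   Context: For a real number $\beta>1$ let $T_\beta:[0,1)\to[0,1)$, $T_\beta(x)=\beta x-\lfloor\beta x\rfloor$. For $t\in[0,1)$ the survivor set is $K_\beta(t):=\{x\in[0,1): T_\beta^n(x)\ge t\ \forall n\ge 0\}$. The set-valued bifurcation set is $\mathscr{E}_\beta:=\{t\in[0,1): K_\beta(t')\ne K_\beta(t)\ \forall t'>t\}$. *)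

theory Defs
  imports "HOL-Analysis.Analysis"
begin

definition beta_map :: "real \<Rightarrow> real \<Rightarrow> real" where
  "beta_map \<beta> x = \<beta> * x - of_int \<lfloor>\<beta> * x\<rfloor>"

definition survivor_set :: "real \<Rightarrow> real \<Rightarrow> real set" where
  "survivor_set \<beta> t = {x \<in> {0..<1}. \<forall>n::nat. (beta_map \<beta> ^^ n) x \<ge> t}"

(* The survivor set is only considered for thresholds in [0,1), so t' ranges over (t,1). *)
definition bifurcation_set :: "real \<Rightarrow> real set" where
  "bifurcation_set \<beta> =
     {t \<in> {0..<1}. \<forall>t' \<in> {t<..<1}. survivor_set \<beta> t' \<noteq> survivor_set \<beta> t}"

(* (diam U)^s with the usual conventions: the empty set contributes 0, and 0^0 = 1 for
   nonempty sets, so that s = 0 gives counting measure (powr would give 0 powr 0 = 0). *)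
definition diam_pow :: "real \<Rightarrow> 'a::metric_space set \<Rightarrow> ennreal" where
  "diam_pow s U =
     (if U = {} then 0 else if s = 0 then 1 else ennreal (diameter U powr s))"

(* Boundedness is required because diameter is a real number, which is meaningful only
   for bounded sets. Finite covers are included by padding with empty sets. *)
definition hausdorff_premeasure :: "real \<Rightarrow> real \<Rightarrow> 'a::metric_space set \<Rightarrow> ennreal" where
  "hausdorff_premeasure s \<delta> A =
     Inf {(\<Sum>i. diam_pow s (U i)) | U :: nat \<Rightarrow> 'a set.
            (\<forall>i. bounded (U i) \<and> diameter (U i) \<le> \<delta>) \<and> A \<subseteq> (\<Union>i. U i)}"

definition hausdorff_measure :: "real \<Rightarrow> 'a::metric_space set \<Rightarrow> ennreal" where
  "hausdorff_measure s A = (SUP \<delta>\<in>{0<..}. hausdorff_premeasure s \<delta> A)"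

definition hausdorff_dim :: "'a::metric_space set \<Rightarrow> ennreal" where
  "hausdorff_dim A = Inf {ennreal s | s. 0 \<le> s \<and> hausdorff_measure s A = 0}"

end

theory Submission
  imports Defs
begin

text \<open>
  Write \<open>T\<close> for the beta-transformation. Raising the threshold changes the survivor set only when
  it passes a point that is minimal on its own orbit, because \<open>T\<close> is continuous from the right. This
  is \<open>mem_bifurcation_set\<close>, and everything else is about the set \<open>E\<close> of these minimal points.

  \<^emph>\<open>Size of E.\<close> A positive point of \<open>E\<close> has an orbit that avoids a neighbourhood of \<open>0\<close>. Every
  cylinder is mapped onto an interval that starts at \<open>0\<close>, so such orbits miss a fixed fraction of
  every cylinder and form a null set (\<open>null_survivors\<close>). Conversely, if the orbit of \<open>x\<close> stays
  above \<open>\<beta> ^ -N\<close>, then \<open>x / \<beta> ^ N\<close> belongs to \<open>E\<close>. The full cylinders of order \<open>j\<close> number at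
  least \<open>\<beta> ^ (s * j)\<close> for every \<open>s < 1\<close> and suitable large \<open>j\<close> (\<open>many_full_cylinders\<close>), and the
  points that move only through full cylinders away from \<open>0\<close> form a self-similar set of dimension
  at least \<open>s\<close>.

  \<^emph>\<open>Isolated points.\<close> Let \<open>\<tau> n = T ^ n 1\<close>. Lowering the last of the first \<open>n\<close> digits of \<open>1\<close> by
  one gives a periodic orbit, and its least point is isolated in \<open>E\<close> as soon as the orbit lies
  above \<open>\<tau> n\<close> (\<open>isolated_point_of_orbit_of_one\<close>). This happens whenever \<open>\<tau> n\<close> is a record low
  by a fixed factor. For almost every base there are infinitely many such records: in parameter
  space the cylinders have the same structure as before up to bounded distortion, so that, when
  the expansion of \<open>1\<close> first shows \<open>L\<close> zeros in a row, the run continues for \<open>M\<close> further places with a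
  probability bounded below (\<open>null_no_long_first_run\<close>).

  \<^emph>\<open>Bases without isolated points.\<close> If \<open>\<tau>\<close> ever leaves the interval \<open>[1 - 1 / \<beta>, 1]\<close> without
  hitting \<open>0\<close>, the first exit yields an isolated point (\<open>first_exit_of_orbit_of_one\<close>). On this
  interval \<open>T\<close> lifts to a monotone map of degree one, so a confined orbit of \<open>1\<close> is coded like a
  rotation. There are only quadratically many such codes of length \<open>n\<close>
  (\<open>turns_one_eq_ceiling\<close>) while the corresponding sets of bases have diameters that decrease
  exponentially, which gives dimension \<open>0\<close>. For every irrational rotation number in \<open>(0, 1)\<close> there
  is such a base, and there no point of \<open>E\<close> is isolated: \<open>0\<close> is a limit point in any case, other
  points that are not periodic are limits of periodic ones (\<open>islimpt_of_nonperiodic\<close>), and next to a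
  periodic point there is room because the orbit of \<open>1\<close> comes back arbitrarily close to \<open>1\<close>
  (\<open>islimpt_of_periodic\<close>).
\<close>


section \<open>Orbits of the beta-transformation\<close>

definition orb :: "real \<Rightarrow> real \<Rightarrow> nat \<Rightarrow> real" where
  "orb \<beta> x n = (beta_map \<beta> ^^ n) x"

definition digit :: "real \<Rightarrow> real \<Rightarrow> nat \<Rightarrow> int" where
  "digit \<beta> x n = \<lfloor>\<beta> * orb \<beta> x n\<rfloor>"

lemma orb_0 [simp]: "orb \<beta> x 0 = x"
  by (simp add: orb_def)

lemma orb_Suc: "orb \<beta> x (Suc n) = \<beta> * orb \<beta> x n - of_int (digit \<beta> x n)"
  by (simp add: orb_def digit_def beta_map_def)

lemma orb_Suc_beta_map: "orb \<beta> x (Suc n) = beta_map \<beta> (orb \<beta> x n)"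
  by (simp add: orb_def)

lemma orb_add: "orb \<beta> x (m + n) = orb \<beta> (orb \<beta> x m) n"
  by (simp add: orb_def funpow_add add.commute[of m])

lemma digit_add: "digit \<beta> x (m + n) = digit \<beta> (orb \<beta> x m) n"
  by (simp add: digit_def orb_add)

lemma beta_map_bounds: "0 \<le> beta_map \<beta> x" "beta_map \<beta> x < 1"
  unfolding beta_map_def by linarith+

lemma orb_bounds:
  assumes "n > 0 \<or> (0 \<le> x \<and> x < 1)"
  shows "0 \<le> orb \<beta> x n" "orb \<beta> x n < 1"
  using assms beta_map_bounds by (cases n; auto simp: orb_Suc_beta_map)+

lemma orb_nonneg: "0 \<le> x \<Longrightarrow> 0 \<le> orb \<beta> x n"
  using orb_bounds(1)[of n x \<beta>] by (cases n) auto

lemma orb_le_1: "0 \<le> x \<Longrightarrow> x \<le> 1 \<Longrightarrow> orb \<beta> x n \<le> 1"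
  using orb_bounds(2)[of n x \<beta>] by (cases n) auto

lemma digit_unique:
  assumes "\<beta> * orb \<beta> x n = of_int a + v" "0 \<le> v" "v < 1"
  shows "digit \<beta> x n = a" "orb \<beta> x (Suc n) = v"
proof -
  show "digit \<beta> x n = a"
    unfolding digit_def assms(1) using assms(2,3) by linarith
  then show "orb \<beta> x (Suc n) = v"
    by (simp add: orb_Suc assms(1))
qed

text \<open>Two orbits run parallel as long as the affine prediction for the second one stays
  inside the unit interval; the start \<open>x\<close> is allowed to be \<open>1\<close>, which is the orbit that
  governs everything below.\<close>

lemma orb_affine:
  assumes "\<And>i. 1 \<le> i \<Longrightarrow> i \<le> n \<Longrightarrow> 0 \<le> orb \<beta> x i + \<beta> ^ i * (y - x)
                                 \<and> orb \<beta> x i + \<beta> ^ i * (y - x) < 1"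
  shows "orb \<beta> y n = orb \<beta> x n + \<beta> ^ n * (y - x)"
  using assms
proof (induction n)
  case 0
  then show ?case by simp
next
  case (Suc n)
  have IH: "orb \<beta> y n = orb \<beta> x n + \<beta> ^ n * (y - x)"
    using Suc by auto
  show ?case
  proof (rule digit_unique(2))
    show "\<beta> * orb \<beta> y n = of_int (digit \<beta> x n) + (orb \<beta> x (Suc n) + \<beta> ^ Suc n * (y - x))"
      unfolding IH orb_Suc by (simp add: algebra_simps)
  qed (use Suc.prems[of "Suc n"] in auto)
qed

lemma orb_periodic:
  assumes "orb \<beta> x m = x"
  shows "orb \<beta> x (m * k) = x" "orb \<beta> x (m * k + n) = orb \<beta> x n"
proof -
  show *: "orb \<beta> x (m * k) = x"
    by (induction k) (auto simp: orb_add assms)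
  show "orb \<beta> x (m * k + n) = orb \<beta> x n"
    by (simp add: orb_add *)
qed

section \<open>The bifurcation set consists of the points that are minimal on their orbit\<close>

text \<open>If some iterate falls below the starting point \<open>t\<close>, then by right continuity the same
  iterate falls below \<open>t\<close> throughout \<open>[t, t + \<delta>)\<close>. No surviving orbit can then enter
  \<open>[t, t + \<delta>)\<close>, so the survivor set does not change when \<open>t\<close> is raised to \<open>t + \<delta>\<close>.\<close>

lemma mem_bifurcation_set:
  assumes \<beta>: "\<beta> > 1"
  shows "t \<in> bifurcation_set \<beta> \<longleftrightarrow> 0 \<le> t \<and> t < 1 \<and> (\<forall>n. t \<le> orb \<beta> t n)"
proof -
  have K: "survivor_set \<beta> s = {x \<in> {0..<1}. \<forall>n. s \<le> orb \<beta> x n}" for s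
    by (simp add: survivor_set_def orb_def)
  have "t \<notin> bifurcation_set \<beta>"
    if t: "0 \<le> t" "t < 1" and n: "orb \<beta> t n < t" for n
  proof -
    have lim: "((\<lambda>d. orb \<beta> t i + \<beta> ^ i * d) \<longlongrightarrow> orb \<beta> t i) (at_right 0)" for i
      by (rule tendsto_eq_intros refl | simp)+
    have "\<forall>\<^sub>F d in at_right 0. \<forall>i\<in>{..n}. orb \<beta> t i + \<beta> ^ i * d < 1"
      by (rule eventually_ball_finite)
         (auto intro!: order_tendstoD(2)[OF lim] orb_bounds(2) t)
    moreover have "\<forall>\<^sub>F d in at_right 0. orb \<beta> t n + \<beta> ^ n * d < t"
      by (rule order_tendstoD(2)[OF lim n])
    ultimately have ev: "\<forall>\<^sub>F d in at_right 0. d > 0 \<and> (\<forall>i\<in>{..n}. orb \<beta> t i + \<beta> ^ i * d < 1)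
                        \<and> orb \<beta> t n + \<beta> ^ n * d < t"
      by (auto simp: eventually_conj_iff eventually_at_right_less)
    obtain d where d: "d > 0" "\<And>i. i \<le> n \<Longrightarrow> orb \<beta> t i + \<beta> ^ i * d < 1"
      "orb \<beta> t n + \<beta> ^ n * d < t"
      using eventually_happens'[OF trivial_limit_at_right_real ev] by (metis atMost_iff)
    have below: "orb \<beta> x n < t" if x: "t \<le> x" "x < t + d" for x
    proof -
      have mono: "\<beta> ^ i * (x - t) \<le> \<beta> ^ i * d" for i
        using x \<beta> by (intro mult_left_mono) auto
      have "orb \<beta> x n = orb \<beta> t n + \<beta> ^ n * (x - t)"
      proof (rule orb_affine, intro conjI)
        fix i assume i: "1 \<le> i" "i \<le> n"
        show "0 \<le> orb \<beta> t i + \<beta> ^ i * (x - t)"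
          using orb_nonneg[of t \<beta> i] t x \<beta> by simp
        show "orb \<beta> t i + \<beta> ^ i * (x - t) < 1"
          using mono[of i] d(2)[of i] i by simp
      qed
      then show ?thesis
        using mono[of n] d(3) by simp
    qed
    have td: "t + d < 1"
      using d(2)[of 0] by simp
    have "survivor_set \<beta> (t + d) = survivor_set \<beta> t"
    proof
      show "survivor_set \<beta> (t + d) \<subseteq> survivor_set \<beta> t"
        using d(1) unfolding K by (smt (verit) mem_Collect_eq subsetI)
      show "survivor_set \<beta> t \<subseteq> survivor_set \<beta> (t + d)"
      proof
        fix x assume x: "x \<in> survivor_set \<beta> t"
        have "t + d \<le> orb \<beta> x m" for m
        proof (rule ccontr)
          assume "\<not> t + d \<le> orb \<beta> x m"
          then have "orb \<beta> (orb \<beta> x m) n < t"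
            using below[of "orb \<beta> x m"] x unfolding K by auto
          then show False
            using x unfolding K orb_add[symmetric] by (auto simp: not_le[symmetric])
        qed
        then show "x \<in> survivor_set \<beta> (t + d)"
          using x unfolding K by auto
      qed
    qed
    then show ?thesis
      using d(1) td t unfolding bifurcation_set_def by force
  qed
  moreover have "t \<in> bifurcation_set \<beta>"
    if t: "0 \<le> t" "t < 1" and "\<And>n. t \<le> orb \<beta> t n"
  proof -
    have "t \<in> survivor_set \<beta> t" "t \<notin> survivor_set \<beta> t'" if "t' > t" for t'
      using that t \<open>\<And>n. t \<le> orb \<beta> t n\<close>
      unfolding K by (auto simp: not_le intro: exI[of _ 0])
    then show ?thesis
      using t unfolding bifurcation_set_def by force
  qed
  moreover have "t \<in> bifurcation_set \<beta> \<Longrightarrow> 0 \<le> t \<and> t < 1"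
    by (auto simp: bifurcation_set_def)
  ultimately show ?thesis
    by (meson not_le)
qed

lemma periodic_in_bifurcation_set:
  assumes \<beta>: "\<beta> > 1" and t: "0 \<le> t" "t < 1" and m: "m > 0" "orb \<beta> t m = t"
    and min: "\<And>i. i < m \<Longrightarrow> t \<le> orb \<beta> t i"
  shows "t \<in> bifurcation_set \<beta>"
proof -
  have "t \<le> orb \<beta> t n" for n
  proof -
    have "orb \<beta> t n = orb \<beta> t (n mod m)"
      using orb_periodic(2)[OF m(2), of "n div m" "n mod m"] by simp
    then show ?thesis
      using min[of "n mod m"] m(1) by simp
  qed
  then show ?thesis
    using t by (simp add: mem_bifurcation_set[OF \<beta>])
qed

section \<open>Isolated points produced by the orbit of one\<close>

lemma exists_minimum_below:
  fixes f :: "nat \<Rightarrow> real"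
  assumes "n > 0"
  obtains j where "j < n" "\<And>i. i < n \<Longrightarrow> f j \<le> f i"
proof -
  have fin: "finite (f ` {..<n})" and ne: "f ` {..<n} \<noteq> {}"
    using assms by auto
  from Min_in[OF this] obtain j where j: "j < n" "f j = Min (f ` {..<n})"
    by auto
  then have "f j \<le> f i" if "i < n" for i
    using that fin by simp
  with j(1) show ?thesis
    using that by blast
qed

text \<open>Write \<open>\<tau> i\<close> for the orbit of \<open>1\<close> and lower the last of its first \<open>n\<close> digits by one. The
  resulting periodic digit sequence belongs to the starting point \<open>1 - e\<close> with
  \<open>e = \<tau> n / (\<beta> ^ n - 1)\<close>, and its orbit is \<open>\<tau> i - \<beta> ^ i * e\<close>. If this orbit stays above
  \<open>\<tau> n\<close>, then its least point \<open>t\<close> is isolated: a point slightly to the left of \<open>t\<close> falls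
  below itself after one period, because \<open>T ^ n\<close> expands, while a point slightly to the right
  is carried into \<open>(1 - e, 1)\<close>, drifts to the right by a factor \<open>\<beta> ^ n\<close> per period, and
  after overtaking \<open>1\<close> it lands below \<open>\<tau> n \<le> t\<close>.\<close>

lemma isolated_point_of_orbit_of_one:
  fixes \<beta> :: real and n :: nat
  defines "\<tau> \<equiv> orb \<beta> 1" and "e \<equiv> orb \<beta> 1 n / (\<beta> ^ n - 1)"
  assumes \<beta>: "\<beta> > 1" and n: "n > 0" and pos: "\<tau> n > 0"
    and above: "\<And>i. i < n \<Longrightarrow> \<tau> n \<le> \<tau> i - \<beta> ^ i * e"
  shows "\<exists>t. t isolated_in bifurcation_set \<beta> \<and> \<tau> n \<le> t \<and> (\<forall>i<n. t \<le> \<tau> i)"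
proof -
  define v where "v i = \<tau> i - \<beta> ^ i * e" for i
  have \<beta>n: "\<beta> ^ n > 1"
    using \<beta> n by simp
  have e: "e > 0" and e_eq: "\<beta> ^ n * e = \<tau> n + e"
    using \<beta>n pos by (auto simp: e_def \<tau>_def field_simps)
  have \<tau>_lt: "\<tau> i < 1" if "i > 0" for i
    using orb_bounds(2)[of i 1 \<beta>] that by (simp add: \<tau>_def)
  have \<tau>_le: "\<tau> i \<le> 1" for i
    by (simp add: \<tau>_def orb_le_1)
  have v_le: "v i \<le> 1 - e" for i
  proof -
    have "e \<le> \<beta> ^ i * e"
      using e one_le_power[of \<beta> i] \<beta> by simp
    then show ?thesis
      using \<tau>_le[of i] by (simp add: v_def)
  qed
  have v_ge: "\<tau> n \<le> v i" if "i < n" for i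
    using above[OF that] by (simp add: v_def)
  have v0: "v 0 = 1 - e"
    by (simp add: v_def \<tau>_def)
  have last_digit: "\<beta> * \<tau> (n - 1) = of_int (digit \<beta> 1 (n - 1)) + \<tau> n"
    using orb_Suc[of \<beta> 1 "n - 1"] n by (simp add: \<tau>_def)
  have pow_last: "\<beta> * \<beta> ^ (n - 1) = \<beta> ^ n"
    using n by (simp flip: power_Suc)
  have near_one: "orb \<beta> (1 - e + \<eta>) i = \<tau> i - \<beta> ^ i * (e - \<eta>)"
    if "0 \<le> \<eta>" "\<eta> < e" "i < n" for \<eta> i
  proof -
    have "orb \<beta> (1 - e + \<eta>) i = orb \<beta> 1 i + \<beta> ^ i * ((1 - e + \<eta>) - 1)"
    proof (rule orb_affine)
      fix l assume l: "1 \<le> l" "l \<le> i"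
      have "\<beta> ^ l * \<eta> \<ge> 0" "\<beta> ^ l * (e - \<eta>) > 0"
        using that \<beta> by auto
      then show "0 \<le> orb \<beta> 1 l + \<beta> ^ l * ((1 - e + \<eta>) - 1) \<and>
            orb \<beta> 1 l + \<beta> ^ l * ((1 - e + \<eta>) - 1) < 1"
        using v_ge[of l] that l pos \<tau>_lt[of l] by (auto simp: v_def \<tau>_def algebra_simps)
    qed
    then show ?thesis
      by (simp add: \<tau>_def algebra_simps)
  qed
  have one_period: "orb \<beta> (1 - e + \<eta>) n = 1 - e + \<beta> ^ n * \<eta>"
    if "0 \<le> \<eta>" "\<eta> < e" "\<beta> ^ n * \<eta> < e" for \<eta>
  proof -
    have "orb \<beta> (1 - e + \<eta>) (n - 1) = \<tau> (n - 1) - \<beta> ^ (n - 1) * (e - \<eta>)"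
      using near_one[OF that(1,2), of "n - 1"] n by simp
    then have "\<beta> * orb \<beta> (1 - e + \<eta>) (n - 1) = \<beta> * (\<tau> (n - 1) - \<beta> ^ (n - 1) * (e - \<eta>))"
      by (rule arg_cong)
    also have "\<dots> = \<beta> * \<tau> (n - 1) - \<beta> ^ n * (e - \<eta>)"
      unfolding pow_last[symmetric] by (simp add: algebra_simps)
    finally have "\<beta> * orb \<beta> (1 - e + \<eta>) (n - 1) = \<beta> * \<tau> (n - 1) - \<beta> ^ n * (e - \<eta>)" .
    then have 1: "\<beta> * orb \<beta> (1 - e + \<eta>) (n - 1)
            = of_int (digit \<beta> 1 (n - 1) - 1) + (1 - e + \<beta> ^ n * \<eta>)"
      using last_digit e_eq by (simp add: algebra_simps)
    have 2: "0 \<le> 1 - e + \<beta> ^ n * \<eta>"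
      using v_ge[OF n] v0 pos that \<beta> by (simp add: add_nonneg_nonneg)
    have "orb \<beta> (1 - e + \<eta>) (Suc (n - 1)) = 1 - e + \<beta> ^ n * \<eta>"
      by (rule digit_unique(2)[OF 1 2]) (use that(3) in simp)
    then show ?thesis
      using n by simp
  qed
  \<comment> \<open>A point between \<open>1 - e\<close> and \<open>1\<close> overtakes \<open>1\<close> after finitely many periods.\<close>
  have falls: "0 < \<eta> \<Longrightarrow> \<eta> < e \<Longrightarrow> e \<le> (\<beta> ^ n) ^ K * \<eta> \<Longrightarrow> \<exists>m. orb \<beta> (1 - e + \<eta>) m < \<tau> n"
    for K \<eta>
  proof (induction K arbitrary: \<eta>)
    case 0
    then show ?case by simp
  next
    case (Suc K)
    show ?case
    proof (cases "\<beta> ^ n * \<eta> < e")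
      case True
      have "\<exists>m. orb \<beta> (1 - e + \<beta> ^ n * \<eta>) m < \<tau> n"
        using Suc.prems True \<beta> by (intro Suc.IH) (auto simp: algebra_simps)
      then show ?thesis
        using one_period[of \<eta>] True Suc.prems by (metis less_imp_le orb_add)
    next
      case False
      have lt: "\<beta> ^ n * (e - \<eta>) > 0"
        using Suc.prems \<beta> by simp
      have "orb \<beta> (1 - e + \<eta>) n = orb \<beta> 1 n + \<beta> ^ n * ((1 - e + \<eta>) - 1)"
      proof (rule orb_affine)
        fix l assume l: "1 \<le> l" "l \<le> n"
        show "0 \<le> orb \<beta> 1 l + \<beta> ^ l * ((1 - e + \<eta>) - 1) \<and>
              orb \<beta> 1 l + \<beta> ^ l * ((1 - e + \<eta>) - 1) < 1"
        proof (cases "l = n")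
          case True
          then show ?thesis
            using False e_eq lt \<tau>_lt[of n] n by (auto simp: \<tau>_def algebra_simps)
        next
          case False
          then show ?thesis
            using l near_one[of \<eta> l] orb_bounds[of l "1 - e + \<eta>" \<beta>] Suc.prems
            by (auto simp: \<tau>_def algebra_simps)
        qed
      qed
      then have "orb \<beta> (1 - e + \<eta>) n < \<tau> n"
        using lt by (simp add: \<tau>_def algebra_simps)
      then show ?thesis ..
    qed
  qed
  have orb_v0: "orb \<beta> (v 0) i = v i" if "i < n" for i
    unfolding v0 using near_one[of 0 i] that e by (simp add: v_def)
  have per: "orb \<beta> (v 0) n = v 0"
    using one_period[of 0] e by (simp add: v0)
  have orb_v0_mod: "orb \<beta> (v 0) i = v (i mod n)" for i
    using orb_periodic(2)[OF per, of "i div n" "i mod n"] orb_v0[of "i mod n"] n by simp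
  obtain j where j: "j < n" and jmin: "\<And>i. i < n \<Longrightarrow> v j \<le> v i"
    using exists_minimum_below[OF n, of v] by blast
  define t where "t = v j"
  have orb_t: "orb \<beta> t i = v ((j + i) mod n)" for i
    using orb_v0_mod[of "j + i"] orb_add[of \<beta> "v 0" j i] orb_v0[OF j] by (simp add: t_def)
  have t_le: "t \<le> orb \<beta> t i" for i
    using jmin n by (simp add: orb_t) (simp add: t_def)
  have t_n: "orb \<beta> t n = t"
    unfolding orb_t using j by (simp add: t_def)
  have t_pos: "t > 0" "\<tau> n \<le> t" "t < 1"
    using v_ge[OF j] pos v_le[of j] e by (auto simp: t_def)
  have tE: "t \<in> bifurcation_set \<beta>"
    using t_le t_pos by (simp add: mem_bifurcation_set[OF \<beta>])
  define d where "d = min t e / \<beta> ^ n"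
  have d: "d > 0" "\<beta> ^ n * d \<le> t" "\<beta> ^ n * d \<le> e"
    using t_pos e \<beta> by (auto simp: d_def)
  have "s = t" if s: "s \<in> bifurcation_set \<beta>" "\<bar>s - t\<bar> < d" for s
  proof (rule ccontr)
    assume "s \<noteq> t"
    have s_le: "s \<le> orb \<beta> s i" for i
      using s(1) by (simp add: mem_bifurcation_set[OF \<beta>])
    have small: "\<beta> ^ i * \<bar>s - t\<bar> < \<beta> ^ n * d" if "i \<le> n" for i
    proof -
      have "\<beta> ^ i * \<bar>s - t\<bar> \<le> \<beta> ^ n * \<bar>s - t\<bar>"
        using that \<beta> by (intro mult_right_mono power_increasing) auto
      also have "\<dots> < \<beta> ^ n * d"
        using s(2) \<beta> by simp
      finally show ?thesis .
    qed
    show False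
    proof (cases "s < t")
      case True
      have "orb \<beta> s n = orb \<beta> t n + \<beta> ^ n * (s - t)"
      proof (rule orb_affine)
        fix i assume i: "1 \<le> i" "i \<le> n"
        have "\<beta> ^ i * (s - t) < 0" "\<beta> ^ i * (t - s) < t"
          using True \<beta> small[OF i(2)] d(2) by (auto simp: mult_pos_neg)
        then show "0 \<le> orb \<beta> t i + \<beta> ^ i * (s - t) \<and> orb \<beta> t i + \<beta> ^ i * (s - t) < 1"
          using t_le[of i] orb_bounds(2)[of i t \<beta>] i by (simp add: algebra_simps)
      qed
      moreover have "\<beta> ^ n * (s - t) < 1 * (s - t)"
        using True \<beta>n by (intro mult_strict_right_mono_neg) auto
      ultimately show False
        using s_le[of n] t_n by simp
    next
      case False
      then have st: "s > t"
        using \<open>s \<noteq> t\<close> by simp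
      define \<eta> where "\<eta> = \<beta> ^ (n - j) * (s - t)"
      have \<eta>: "0 < \<eta>" "\<eta> < e"
        using st \<beta> small[of "n - j"] d(3) by (auto simp: \<eta>_def)
      have "orb \<beta> s (n - j) = orb \<beta> t (n - j) + \<beta> ^ (n - j) * (s - t)"
      proof (rule orb_affine)
        fix i assume i: "1 \<le> i" "i \<le> n - j"
        then have "\<beta> ^ i * (s - t) < e" "\<beta> ^ i * (s - t) > 0"
          using st \<beta> small[of i] d(3) le_trans[OF i(2) diff_le_self] by auto
        then show "0 \<le> orb \<beta> t i + \<beta> ^ i * (s - t) \<and> orb \<beta> t i + \<beta> ^ i * (s - t) < 1"
          using t_le[of i] t_pos v_le[of "(j + i) mod n"] by (auto simp: orb_t)
      qed
      also have "orb \<beta> t (n - j) = 1 - e"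
        using j by (simp add: orb_t v0)
      finally have s_near: "orb \<beta> s (n - j) = 1 - e + \<eta>"
        by (simp add: \<eta>_def)
      obtain K where "e / \<eta> < (\<beta> ^ n) ^ K"
        using real_arch_pow[OF \<beta>n] by blast
      then have "e \<le> (\<beta> ^ n) ^ K * \<eta>"
        using \<eta> by (simp add: field_simps)
      then obtain m where "orb \<beta> (1 - e + \<eta>) m < \<tau> n"
        using falls[OF \<eta>] by blast
      then show False
        using s_le[of "n - j + m"] st t_pos(2) by (simp add: orb_add s_near)
    qed
  qed
  then have "t isolated_in bifurcation_set \<beta>"
    unfolding isolated_in_dist_Ex_iff using tE d(1)
    by (auto simp: dist_real_def abs_minus_commute)
  moreover have "t \<le> \<tau> i" if "i < n" for i
  proof -
    have "0 \<le> \<beta> ^ i * e"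
      using e \<beta> by simp
    then show ?thesis
      using jmin[OF that] by (simp add: t_def v_def)
  qed
  ultimately show ?thesis
    using t_pos(2) by blast
qed

text \<open>Up to time \<open>n\<close> the periodic orbit stays within \<open>\<tau> n / (\<beta> - 1)\<close> of the orbit of \<open>1\<close>, and this
  gap is outweighed by a record low by the factor \<open>1 - 1 / \<beta>\<close>.\<close>

lemma isolated_point_of_record:
  fixes \<beta> :: real and n :: nat
  assumes \<beta>: "\<beta> > 1" and n: "n > 0" and pos: "orb \<beta> 1 n > 0"
    and low: "\<And>i. i < n \<Longrightarrow> orb \<beta> 1 n \<le> (1 - 1 / \<beta>) * orb \<beta> 1 i"
  shows "\<exists>t. t isolated_in bifurcation_set \<beta> \<and> orb \<beta> 1 n \<le> t \<and> (\<forall>i<n. t \<le> orb \<beta> 1 i)"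
proof (rule isolated_point_of_orbit_of_one[OF \<beta> n pos])
  fix i assume i: "i < n"
  let ?e = "orb \<beta> 1 n / (\<beta> ^ n - 1)"
  have \<beta>n: "\<beta> ^ n > 1"
    using \<beta> n by simp
  have "\<beta> ^ i * (\<beta> - 1) \<le> \<beta> ^ (n - 1) * (\<beta> - 1)"
    using i \<beta> by (intro mult_right_mono power_increasing) auto
  also have "\<dots> = \<beta> ^ n - \<beta> ^ (n - 1)"
    using n power_Suc[of \<beta> "n - 1"] by (simp add: algebra_simps)
  also have "\<dots> \<le> \<beta> ^ n - 1"
    using \<beta> by simp
  finally have "\<beta> ^ i * ?e \<le> orb \<beta> 1 n / (\<beta> - 1)"
    using \<beta> \<beta>n pos mult_right_mono[of "\<beta> ^ i * (\<beta> - 1)" "\<beta> ^ n - 1" "orb \<beta> 1 n"]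
    by (simp add: field_simps)
  then have "orb \<beta> 1 n + \<beta> ^ i * ?e \<le> orb \<beta> 1 n * (\<beta> / (\<beta> - 1))"
    using \<beta> by (simp add: field_simps)
  also have "\<dots> \<le> (1 - 1 / \<beta>) * orb \<beta> 1 i * (\<beta> / (\<beta> - 1))"
    using low[OF i] \<beta> by (intro mult_right_mono) auto
  also have "\<dots> = orb \<beta> 1 i"
    using \<beta> by (simp add: divide_simps)
  finally show "orb \<beta> 1 n \<le> orb \<beta> 1 i - \<beta> ^ i * ?e"
    by simp
qed

lemma orb_small:
  assumes \<beta>: "\<beta> > 1" and x: "0 \<le> x" "\<beta> ^ m * x < 1"
  shows "orb \<beta> x m = \<beta> ^ m * x"
proof -
  have "orb \<beta> x m = orb \<beta> 0 m + \<beta> ^ m * (x - 0)"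
  proof (rule orb_affine)
    fix i assume i: "1 \<le> i" "i \<le> m"
    have "\<beta> ^ i * x \<le> \<beta> ^ m * x"
      using i \<beta> x by (intro mult_right_mono power_increasing) auto
    moreover have "orb \<beta> 0 l = 0" for l
      by (induction l) (auto simp: orb_Suc digit_def)
    ultimately show "0 \<le> orb \<beta> 0 i + \<beta> ^ i * (x - 0) \<and> orb \<beta> 0 i + \<beta> ^ i * (x - 0) < 1"
      using x \<beta> by auto
  qed
  moreover have "orb \<beta> 0 l = 0" for l
    by (induction l) (auto simp: orb_Suc digit_def)
  ultimately show ?thesis by simp
qed

text \<open>The interval \<open>[1 - 1 / \<beta>, 1]\<close> is wrapped exactly once around the circle by the
  beta-transformation. When the orbit of \<open>1\<close> leaves it for the first time, at time \<open>n\<close>, the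
  periodic orbit \<open>v i = \<tau> i - \<beta> ^ i * e\<close> lies above \<open>\<tau> n\<close>. Otherwise some \<open>v j\<close> lies
  below \<open>\<tau> n\<close>, and its successor \<open>u\<close> is compared with \<open>v 1\<close>. If \<open>u > v 1\<close>, then \<open>u\<close> is
  squeezed between \<open>v 1\<close> and \<open>\<tau> 1\<close>, which determines its next \<open>n - 1\<close> iterates, and the
  return to \<open>v j\<close> contradicts expansion. If \<open>u \<le> v 1\<close>, then the digits of \<open>\<tau> j\<close> and of \<open>1\<close>
  have to agree up to time \<open>n - 1\<close>, and both possible next digits are impossible.\<close>

lemma first_exit_of_orbit_of_one:
  fixes \<beta> :: real and n :: nat
  defines "\<tau> \<equiv> orb \<beta> 1" and "e \<equiv> orb \<beta> 1 n / (\<beta> ^ n - 1)"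
  assumes \<beta>: "\<beta> > 1" and n: "n > 0" and pos: "\<tau> n > 0"
    and stay: "\<And>i. i < n \<Longrightarrow> 1 - 1 / \<beta> \<le> \<tau> i" and leave: "\<tau> n < 1 - 1 / \<beta>"
    and i0: "i0 < n"
  shows "\<tau> n \<le> \<tau> i0 - \<beta> ^ i0 * e"
proof (cases "n = 1")
  case True
  then show ?thesis
    using leave \<beta> i0 by (simp add: e_def \<tau>_def field_simps)
next
  case False
  then have n2: "n \<ge> 2"
    using n by simp
  define k where "k = \<lfloor>\<beta>\<rfloor>"
  define v where "v i = \<tau> i - \<beta> ^ i * e" for i
  have \<beta>n: "\<beta> ^ n > 1"
    using \<beta> n by simp
  have e: "e > 0" and e_eq: "\<beta> ^ n * e = \<tau> n + e"
    using \<beta>n pos by (auto simp: e_def \<tau>_def field_simps)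
  have \<tau>_le: "\<tau> i \<le> 1" and \<tau>_ge0: "0 \<le> \<tau> i" for i
    by (simp_all add: \<tau>_def orb_le_1 orb_nonneg)
  have \<tau>_lt: "\<tau> i < 1" if "i > 0" for i
    using orb_bounds(2)[of i 1 \<beta>] that by (simp add: \<tau>_def)
  have \<tau>_Suc: "\<tau> (Suc i) = \<beta> * \<tau> i - of_int (digit \<beta> 1 i)" for i
    by (simp add: \<tau>_def orb_Suc)
  have v_Suc: "v (Suc i) = \<beta> * v i - of_int (digit \<beta> 1 i)" for i
    by (simp add: v_def \<tau>_Suc algebra_simps)
  have v_n: "v n = - e"
    by (simp add: v_def e_eq)
  have v0: "v 0 = 1 - e"
    by (simp add: v_def \<tau>_def)
  have v_less: "v i < 1 - e" if "i > 0" for i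
  proof -
    have "1 * e < \<beta> ^ i * e"
      using e \<beta> that by (intro mult_strict_right_mono) auto
    then show ?thesis
      using \<tau>_le[of i] by (simp add: v_def)
  qed
  have digit0: "digit \<beta> 1 0 = k"
    by (simp add: digit_def k_def)
  have \<tau>1: "\<tau> 1 = \<beta> - of_int k"
    using \<tau>_Suc[of 0] digit0 by (simp add: \<tau>_def)
  have leave': "\<beta> * \<tau> n < \<beta> - 1"
    using leave \<beta> by (simp add: field_simps)
  have stay': "\<beta> - 1 \<le> \<beta> * \<tau> i" if "i < n" for i
    using stay[OF that] \<beta> by (simp add: field_simps)
  have digits: "digit \<beta> 1 i = k - 1 \<or> digit \<beta> 1 i = k" if "i < n" for i
  proof -
    have "\<beta> * \<tau> i \<le> \<beta> * 1"
      using \<tau>_le[of i] \<beta> by (intro mult_left_mono) auto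
    then have "digit \<beta> 1 i \<le> k"
      unfolding digit_def k_def \<tau>_def by (simp add: floor_mono)
    moreover have "k - 1 \<le> digit \<beta> 1 i"
      using floor_mono[OF stay'[OF that]] by (simp add: digit_def k_def \<tau>_def)
    ultimately show ?thesis by linarith
  qed
  have last: "digit \<beta> 1 (n - 1) = k"
  proof (rule ccontr)
    assume "digit \<beta> 1 (n - 1) \<noteq> k"
    then have "\<tau> n = \<beta> * \<tau> (n - 1) - (of_int k - 1)"
      using digits[of "n - 1"] \<tau>_Suc[of "n - 1"] n by auto
    then have "\<tau> 1 \<le> \<tau> n"
      using stay'[of "n - 1"] n \<tau>1 by simp
    then show False
      using stay[of 1] leave n2 by simp
  qed
  have v_last: "\<beta> * v (n - 1) = of_int k - e"
    using v_Suc[of "n - 1"] v_n n last by simp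
  \<comment> \<open>If \<open>\<tau> i\<close> were below \<open>\<beta> ^ -(n - i)\<close>, only zeros would follow, and \<open>\<tau> n\<close> would be at least \<open>\<tau> i\<close>.\<close>
  have v_pos: "v i > 0" if i: "i < n" for i
  proof -
    have "1 \<le> \<beta> ^ (n - i) * \<tau> i"
    proof (rule ccontr)
      assume "\<not> 1 \<le> \<beta> ^ (n - i) * \<tau> i"
      then have "orb \<beta> (\<tau> i) (n - i) = \<beta> ^ (n - i) * \<tau> i"
        using orb_small[OF \<beta> \<tau>_ge0] by simp
      then have "\<tau> n = \<beta> ^ (n - i) * \<tau> i"
        using i by (simp add: \<tau>_def flip: orb_add)
      moreover have "1 * \<tau> i \<le> \<beta> ^ (n - i) * \<tau> i"
        using \<beta> \<tau>_ge0 by (intro mult_right_mono) auto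
      ultimately show False
        using stay[OF i] leave by simp
    qed
    then have "\<beta> ^ i * 1 \<le> \<beta> ^ i * (\<beta> ^ (n - i) * \<tau> i)"
      using \<beta> by (intro mult_left_mono) auto
    also have "\<dots> = \<beta> ^ n * \<tau> i"
      using i by (simp flip: power_add mult.assoc)
    finally have *: "\<beta> ^ i \<le> \<beta> ^ n * \<tau> i"
      by simp
    have "1 / \<beta> ^ n \<le> 1 / \<beta>"
      using \<beta> n self_le_power[of \<beta> n] by (simp add: frac_le)
    then have **: "\<tau> n < 1 - 1 / \<beta> ^ n"
      using leave by simp
    have "\<beta> ^ i * \<tau> n < \<beta> ^ i * (1 - 1 / \<beta> ^ n)"
      using ** \<beta> by (intro mult_strict_left_mono) auto
    also have "\<dots> \<le> (\<beta> ^ n * \<tau> i) * (1 - 1 / \<beta> ^ n)"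
      using * \<beta>n by (intro mult_right_mono) auto
    also have "\<dots> = \<tau> i * (\<beta> ^ n - 1)"
      using \<beta> by (simp add: field_simps)
    finally have "\<beta> ^ i * e < \<tau> i"
      using \<beta>n by (simp add: e_def \<tau>_def field_simps)
    then show ?thesis
      by (simp add: v_def)
  qed
  have orb_v0: "orb \<beta> (v 0) i = v i" if "i < n" for i
    using that
  proof (induction i)
    case 0
    then show ?case by simp
  next
    case (Suc i)
    then show ?case
      using v_pos[of "Suc i"] v_less[of "Suc i"] e v_Suc[of i]
      by (intro digit_unique(2)[where a = "digit \<beta> 1 i"]) auto
  qed
  have per: "orb \<beta> (v 0) n = v 0"
  proof -
    have "orb \<beta> (v 0) (Suc (n - 1)) = 1 - e"
      using orb_v0[of "n - 1"] v_last n v_pos[OF n] v0 e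
      by (intro digit_unique(2)[where a = "k - 1"]) auto
    then show ?thesis
      using n v0 by simp
  qed
  show ?thesis
  proof (rule ccontr)
    assume "\<not> ?thesis"
    then obtain j where j: "j < n" "v j < \<tau> n"
      using i0 by (auto simp: v_def)
    have \<beta>vj: "\<beta> * v j < \<beta> * \<tau> n"
      using j \<beta> by simp
    define u where "u = \<beta> * v j - (of_int k - 1)"
    have dj: "digit \<beta> 1 j = k - 1" if "j < n - 1"
    proof (rule ccontr)
      assume "digit \<beta> 1 j \<noteq> k - 1"
      then have "v (Suc j) = \<beta> * v j - of_int k"
        using digits[OF j(1)] v_Suc[of j] by auto
      moreover have "\<beta> < of_int k + 1"
        unfolding k_def by linarith
      ultimately have "v (Suc j) < 0"
        using leave' \<beta>vj by linarith
      moreover have "Suc j < n"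
        using that by linarith
      ultimately show False
        using v_pos[of "Suc j"] by linarith
    qed
    have u_next: "u = orb \<beta> (v 0) (Suc j)"
    proof (cases "j < n - 1")
      case True
      then show ?thesis
        using orb_v0[of "Suc j"] v_Suc[of j] dj by (simp add: u_def)
    next
      case False
      then have "j = n - 1"
        using j by simp
      then show ?thesis
        using per v_last v0 n by (simp add: u_def)
    qed
    have u_lt: "u < \<tau> 1"
      using \<beta>vj leave' \<tau>1 by (simp add: u_def)
    show False
    proof (cases "u > v 1")
      case True
      have pow: "\<beta> * \<beta> ^ (n - 1) = \<beta> ^ n" "\<beta> * \<beta> ^ (n - 2) = \<beta> ^ (n - 1)"
        using n2 by (simp_all flip: power_Suc) (simp add: Suc_diff_Suc numeral_2_eq_2)
      have u_ret: "orb \<beta> u (n - 1) = v j"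
      proof -
        have "orb \<beta> u (n - 1) = orb \<beta> (v 0) (n + j)"
          using n unfolding u_next by (simp flip: orb_add add: add.commute)
        then show ?thesis
          using orb_add[of \<beta> "v 0" n j] per orb_v0[OF j(1)] by simp
      qed
      \<comment> \<open>The point \<open>u\<close> lies between \<open>v 1\<close> and \<open>\<tau> 1\<close> and follows them for \<open>n - 2\<close> steps.\<close>
      have below_v: "\<beta> ^ i * (\<tau> 1 - u) < \<beta> ^ i * (\<beta> * e)" for i
        using True \<beta> by (simp add: v_def)
      have inner: "0 \<le> orb \<beta> (\<tau> 1) i + \<beta> ^ i * (u - \<tau> 1) \<and>
                    orb \<beta> (\<tau> 1) i + \<beta> ^ i * (u - \<tau> 1) < 1" if "i \<le> n - 2" for i
      proof -
        have "orb \<beta> (\<tau> 1) i = \<tau> (Suc i)"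
          by (simp add: \<tau>_def flip: orb_add)
        moreover have "\<beta> ^ i * (\<tau> 1 - u) \<ge> 0"
          using u_lt \<beta> by simp
        moreover have "v (Suc i) > 0"
          using v_pos[of "Suc i"] that n2 by simp
        ultimately show ?thesis
          using below_v[of i] \<tau>_lt[of "Suc i"] by (auto simp: v_def algebra_simps)
      qed
      have u_n2: "orb \<beta> u (n - 2) = \<tau> (n - 1) + \<beta> ^ (n - 2) * (u - \<tau> 1)"
      proof -
        have "orb \<beta> u (n - 2) = orb \<beta> (\<tau> 1) (n - 2) + \<beta> ^ (n - 2) * (u - \<tau> 1)"
          by (rule orb_affine) (use inner in auto)
        moreover have "orb \<beta> (\<tau> 1) (n - 2) = \<tau> (n - 1)"
          using n2 by (simp add: \<tau>_def numeral_2_eq_2 Suc_diff_Suc flip: orb_add)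
        ultimately show ?thesis by simp
      qed
      define y where "y = \<tau> n - \<beta> ^ (n - 1) * (\<tau> 1 - u)"
      have \<beta>y: "\<beta> * orb \<beta> u (n - 2) = of_int k + y"
      proof -
        have "\<beta> * orb \<beta> u (n - 2) = \<beta> * \<tau> (n - 1) + \<beta> ^ (n - 1) * (u - \<tau> 1)"
          unfolding u_n2 pow(2)[symmetric] by (simp add: algebra_simps)
        also have "\<beta> * \<tau> (n - 1) = \<tau> n + of_int k"
          using \<tau>_Suc[of "n - 1"] last n by simp
        finally show ?thesis
          by (simp add: y_def algebra_simps)
      qed
      have sn: "Suc (n - 2) = n - 1"
        using n2 by simp
      have y_lt: "y < \<tau> n"
        using u_lt \<beta> by (simp add: y_def)
      have y_gt: "1 + y > 1 - e"
      proof -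
        have "\<beta> ^ (n - 1) * (\<beta> * e) = \<tau> n + e"
          unfolding e_eq[symmetric] pow(1)[symmetric] by simp
        then show ?thesis
          using below_v[of "n - 1"] by (simp add: y_def)
      qed
      show False
      proof (cases "y \<ge> 0")
        case True
        then have "v j = y"
          using digit_unique(2)[of \<beta> u "n - 2" k y] \<beta>y y_lt \<tau>_lt[OF n] u_ret sn by simp
        also have "\<tau> 1 - u = \<beta> - 1 - \<beta> * v j"
          using \<tau>1 by (simp add: u_def)
        then have "y = \<tau> n - \<beta> ^ (n - 1) * (\<beta> - 1 - \<beta> * v j)"
          by (simp add: y_def)
        finally have "\<tau> n - v j = \<beta> ^ (n - 1) * (\<beta> - 1 - \<beta> * v j)"
          by simp
        moreover have "\<beta> ^ (n - 1) * (\<beta> - 1 - \<beta> * v j) > \<beta> ^ (n - 1) * (\<beta> * (\<tau> n - v j))"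
          using leave' \<beta> by (intro mult_strict_left_mono) (auto simp: algebra_simps)
        moreover have "\<beta> ^ (n - 1) * (\<beta> * (\<tau> n - v j)) = \<beta> ^ n * (\<tau> n - v j)"
          unfolding pow(1)[symmetric] by (simp add: algebra_simps)
        moreover have "\<beta> ^ n * (\<tau> n - v j) > 1 * (\<tau> n - v j)"
          using \<beta>n j by (intro mult_strict_right_mono) auto
        ultimately show False
          by (metis mult_1 less_trans less_irrefl)
      next
        case False
        then have "v j = 1 + y"
          using digit_unique(2)[of \<beta> u "n - 2" "k - 1" "1 + y"] \<beta>y y_gt v_pos[OF n] v0
            u_ret sn by simp
        then show False
          using y_gt v_less[of j] v0 by (cases "j = 0") auto
      qed
    next
      case False
      then have u_le: "u \<le> v 1"
        by simp
      have "j < n - 1"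
      proof (rule ccontr)
        assume "\<not> j < n - 1"
        then have "j = n - 1"
          using j by simp
        then have "u = 1 - e"
          using v_last by (simp add: u_def)
        then show False
          using u_le v_less[of 1] by simp
      qed
      note j' = this
      have "j > 0"
        using dj[OF j'] digit0 by (cases j) auto
      \<comment> \<open>The order of the \<open>\<tau>\<close> forces one inequality between the digits, that of the \<open>v\<close> the other.\<close>
      have step: "\<tau> i \<le> \<tau> (j + i) \<and> v (j + i) \<le> v i" if "1 \<le> i" "j + i \<le> n - 1" for i
        using that
      proof (induction i rule: dec_induct)
        case base
        have "\<tau> (Suc j) = \<beta> * \<tau> j - (of_int k - 1)"
          using \<tau>_Suc[of j] dj[OF j'] by simp
        moreover have "v (Suc j) = u"
          using v_Suc[of j] dj[OF j'] by (simp add: u_def)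
        ultimately show ?case
          using stay'[OF j(1)] \<tau>1 u_le by simp
      next
        case (step i)
        then have IH: "\<tau> i \<le> \<tau> (j + i)" "v (j + i) \<le> v i"
          by auto
        have fl: "\<lfloor>\<beta> * v l\<rfloor> = digit \<beta> 1 l" if "l < n - 1" for l
        proof (rule floor_unique)
          have "Suc l < n"
            using that by linarith
          then show "of_int (digit \<beta> 1 l) \<le> \<beta> * v l"
            using v_Suc[of l] v_pos[of "Suc l"] by linarith
          show "\<beta> * v l < of_int (digit \<beta> 1 l) + 1"
            using v_Suc[of l] v_less[of "Suc l"] e by linarith
        qed
        have "\<beta> * v (j + i) \<le> \<beta> * v i"
          using IH \<beta> by simp
        then have "digit \<beta> 1 (j + i) \<le> digit \<beta> 1 i"
          using floor_mono[of "\<beta> * v (j + i)" "\<beta> * v i"] fl[of i] fl[of "j + i"] step.prems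
          by simp
        moreover have "\<beta> * \<tau> i \<le> \<beta> * \<tau> (j + i)"
          using IH \<beta> by simp
        then have "digit \<beta> 1 i \<le> digit \<beta> 1 (j + i)"
          unfolding digit_def \<tau>_def by (rule floor_mono)
        ultimately have "digit \<beta> 1 i = digit \<beta> 1 (j + i)"
          by simp
        then show ?case
          using \<tau>_Suc[of i] \<tau>_Suc[of "j + i"] v_Suc[of i] v_Suc[of "j + i"] IH \<beta> by simp
      qed
      define i where "i = n - 1 - j"
      have i: "1 \<le> i" "j + i = n - 1" "Suc i < n"
        using j' \<open>j > 0\<close> by (auto simp: i_def)
      have fin: "\<tau> i \<le> \<tau> (n - 1)" "v (n - 1) \<le> v i"
        using step[of i] i by auto
      have fin\<beta>: "\<beta> * \<tau> i \<le> \<beta> * \<tau> (n - 1)" "\<beta> * v (n - 1) \<le> \<beta> * v i"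
        using fin \<beta> by auto
      show False
      proof (cases "digit \<beta> 1 i = k")
        case True
        then have "\<tau> (Suc i) \<le> \<tau> n"
          using \<tau>_Suc[of i] \<tau>_Suc[of "n - 1"] last n fin\<beta> by simp
        then show False
          using stay[OF i(3)] leave by simp
      next
        case False
        then have "digit \<beta> 1 i = k - 1"
          using digits[of i] i by auto
        then have "1 - e \<le> v (Suc i)"
          using v_Suc[of i] fin\<beta> v_last by simp
        then show False
          using v_less[of "Suc i"] by simp
      qed
    qed
  qed
qed

text \<open>A first exit produces an isolated point unless it hits \<open>0\<close>, which would give \<open>e = 0\<close> and thus
  the orbit of \<open>1\<close> itself in place of a periodic orbit of points below \<open>1\<close>.\<close>

lemma orbit_of_one_confined:
  assumes \<beta>: "\<beta> > 1" and nz: "\<And>n. orb \<beta> 1 n \<noteq> 0"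
    and no_isolated: "\<And>t. \<not> t isolated_in bifurcation_set \<beta>"
  shows "1 - 1 / \<beta> \<le> orb \<beta> 1 n"
proof (induction n rule: less_induct)
  case (less n)
  show ?case
  proof (rule ccontr)
    assume leave: "\<not> ?thesis"
    then have n: "n > 0"
      using \<beta> by (cases n) auto
    have pos: "orb \<beta> 1 n > 0"
      using nz[of n] orb_nonneg[of 1 \<beta> n] by simp
    have "\<exists>t. t isolated_in bifurcation_set \<beta> \<and> orb \<beta> 1 n \<le> t \<and> (\<forall>i<n. t \<le> orb \<beta> 1 i)"
      using leave less
      by (intro isolated_point_of_orbit_of_one[OF \<beta> n pos] first_exit_of_orbit_of_one[OF \<beta> n pos])
         auto
    then show False
      using no_isolated by blast
  qed
qed

section \<open>Two ways in which minimal points are accumulated by periodic ones\<close>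

text \<open>Cutting the digit sequence of \<open>t\<close> after \<open>N\<close> places and repeating the block gives the
  fixed point \<open>t - r N\<close> of the branch of \<open>T ^ N\<close> at \<open>t\<close>, where
  \<open>r i = (T ^ i t - t) / (\<beta> ^ i - 1)\<close>. It is minimal on its orbit when \<open>N\<close> is a record
  low of \<open>r\<close>, and there are infinitely many records since \<open>r\<close> is positive and tends to \<open>0\<close>.\<close>

lemma islimpt_of_nonperiodic:
  assumes \<beta>: "\<beta> > 1" and t: "t \<in> bifurcation_set \<beta>" "t > 0"
    and nonper: "\<And>n. n > 0 \<Longrightarrow> orb \<beta> t n \<noteq> t"
  shows "t islimpt bifurcation_set \<beta>"
  unfolding islimpt_approachable
proof (intro allI impI)
  fix e :: real assume e: "e > 0"
  have t_le: "t \<le> orb \<beta> t n" and t1: "t < 1" for n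
    using t(1) by (auto simp: mem_bifurcation_set[OF \<beta>])
  define r where "r i = (orb \<beta> t i - t) / (\<beta> ^ i - 1)" for i
  obtain n where n: "1 + 1 / min e t < \<beta> ^ n"
    using real_arch_pow[OF \<beta>] by blast
  have "1 / min e t > 0"
    using e t by simp
  then have n0: "n > 0"
    using n by (cases n) auto
  have "r n < min e t"
  proof -
    have "1 < min e t * (\<beta> ^ n - 1)"
      using n e t by (simp add: field_simps)
    moreover have "\<beta> ^ n - 1 > 0"
      using \<beta> n0 by simp
    moreover have "orb \<beta> t n - t < 1"
      using orb_bounds(2)[of n t \<beta>] n0 t by simp
    ultimately show ?thesis
      by (simp add: r_def pos_divide_less_eq del: min_less_iff_conj)
  qed
  obtain N' where "N' < n" and min': "\<And>i. i < n \<Longrightarrow> r (Suc N') \<le> r (Suc i)"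
    using exists_minimum_below[OF n0, of "\<lambda>i. r (Suc i)"] by blast
  define N where "N = Suc N'"
  have N: "0 < N" "N \<le> n" and min: "\<And>i. 0 < i \<Longrightarrow> i \<le> n \<Longrightarrow> r N \<le> r i"
  proof -
    show "0 < N" "N \<le> n"
      using \<open>N' < n\<close> by (auto simp: N_def)
    show "r N \<le> r i" if "0 < i" "i \<le> n" for i
      using min'[of "i - 1"] that by (simp add: N_def)
  qed
  have pow: "\<beta> ^ i - 1 > 0" if "i > 0" for i
    using that \<beta> by simp
  have rN: "r N > 0" "r N < e" "r N < t"
  proof -
    show "r N > 0"
      using nonper[OF N(1)] t_le[of N] pow[OF N(1)] by (simp add: r_def)
    show "r N < e" "r N < t"
      using min[OF n0] \<open>r n < min e t\<close> by auto
  qed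
  define p where "p = t - r N"
  have p_le: "p \<le> orb \<beta> t i + \<beta> ^ i * (p - t)" if "i \<le> N" for i
  proof (cases "i = 0")
    case False
    then have "r N * (\<beta> ^ i - 1) \<le> orb \<beta> t i - t"
      using min[of i] that N pow[of i] by (simp add: r_def pos_le_divide_eq)
    then show ?thesis
      by (simp add: p_def algebra_simps)
  qed (simp add: p_def)
  have orb_p: "orb \<beta> p i = orb \<beta> t i + \<beta> ^ i * (p - t)" if "i \<le> N" for i
  proof (rule orb_affine)
    fix j assume j: "1 \<le> j" "j \<le> i"
    have "\<beta> ^ j * (p - t) \<le> 0"
      using rN \<beta> by (simp add: p_def mult_nonneg_nonpos)
    then show "0 \<le> orb \<beta> t j + \<beta> ^ j * (p - t) \<and> orb \<beta> t j + \<beta> ^ j * (p - t) < 1"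
      using p_le[of j] that j rN orb_bounds(2)[of j t \<beta>] by (simp add: p_def)
  qed
  have "orb \<beta> p N = p"
  proof -
    have "r N * (\<beta> ^ N - 1) = orb \<beta> t N - t"
      using pow[OF N(1)] by (simp add: r_def)
    then show ?thesis
      using orb_p[of N] by (simp add: p_def algebra_simps)
  qed
  then have "p \<in> bifurcation_set \<beta>"
    using rN t1 N p_le orb_p by (intro periodic_in_bifurcation_set[OF \<beta>]) (auto simp: p_def)
  moreover have "p \<noteq> t" "dist p t < e"
    using rN by (auto simp: p_def dist_real_def)
  ultimately show "\<exists>p\<in>bifurcation_set \<beta>. p \<noteq> t \<and> dist p t < e"
    by blast
qed

text \<open>A periodic minimal point \<open>t\<close> can only be approached from the right, and there the obstacle
  is the largest point \<open>v\<close> of its orbit, which is the first to overtake \<open>1\<close>. If there is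
  room for a surviving point \<open>z\<close> between \<open>v\<close> and \<open>1\<close>, one follows the orbit of \<open>t\<close> for
  \<open>K\<close> steps, then the orbit of \<open>z\<close> for \<open>l\<close> steps, and closes up. Taking for \<open>l\<close> the first
  positive time at which \<open>T ^ l z - t < \<beta> ^ l * (z - v)\<close> makes the resulting periodic point \<open>t + d\<close>
  minimal on its orbit, whatever \<open>K\<close> is.\<close>

lemma islimpt_of_periodic:
  assumes \<beta>: "\<beta> > 1" and t: "t \<in> bifurcation_set \<beta>" and m: "m > 0" "orb \<beta> t m = t"
    and v: "\<And>j. orb \<beta> t j \<le> orb \<beta> t i"
    and z: "orb \<beta> t i < z" "z < 1" "\<And>n. t \<le> orb \<beta> z n"
  shows "t islimpt bifurcation_set \<beta>"
  unfolding islimpt_approachable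
proof (intro allI impI)
  fix e :: real assume e: "e > 0"
  have t_le: "t \<le> orb \<beta> t n" and t1: "t < 1" "0 \<le> t" for n
    using t(1) by (auto simp: mem_bifurcation_set[OF \<beta>])
  define w where "w = orb \<beta> t i"
  define G where "G = z - w"
  have G: "G > 0"
    using z by (simp add: G_def w_def)
  have z0: "z \<ge> 0"
    using z t_le[of i] t1 by simp
  have z_lt: "orb \<beta> z n < 1" for n
    using orb_bounds(2)[of n z \<beta>] z0 z by simp
  have "\<exists>l. 0 < l \<and> orb \<beta> z l - t < \<beta> ^ l * G"
  proof -
    obtain l where l: "1 / G < \<beta> ^ l"
      using real_arch_pow[OF \<beta>] by blast
    have "1 < \<beta> ^ l * G"
      using l G by (simp add: field_simps)
    also have "\<dots> \<le> \<beta> ^ Suc l * G"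
      using \<beta> G by simp
    finally have "orb \<beta> z (Suc l) - t < \<beta> ^ Suc l * G"
      using z_lt[of "Suc l"] t1 by simp
    then show ?thesis by blast
  qed
  define l where "l = (LEAST l. 0 < l \<and> orb \<beta> z l - t < \<beta> ^ l * G)"
  have l: "0 < l" "orb \<beta> z l - t < \<beta> ^ l * G"
    using LeastI_ex[OF \<open>\<exists>l. 0 < l \<and> orb \<beta> z l - t < \<beta> ^ l * G\<close>] by (auto simp: l_def)
  have before_l: "\<beta> ^ j * G \<le> orb \<beta> z j - t" if "j < l" for j
  proof (cases "j = 0")
    case True
    then show ?thesis
      using t_le[of i] by (simp add: G_def w_def)
  next
    case False
    then show ?thesis
      using not_less_Least[of j "\<lambda>l. 0 < l \<and> orb \<beta> z l - t < \<beta> ^ l * G"] that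
      by (auto simp: l_def)
  qed
  define h where "h = \<beta> ^ l * G - (orb \<beta> z l - t)"
  have h: "0 < h" "h \<le> \<beta> ^ l * G"
    using l z(3)[of l] by (auto simp: h_def)
  obtain j0 where j0: "j0 < l" "\<And>j. j < l \<Longrightarrow> 1 - orb \<beta> z j0 \<le> 1 - orb \<beta> z j"
    using exists_minimum_below[OF l(1), of "\<lambda>j. 1 - orb \<beta> z j"] by blast
  define c where "c = 1 - orb \<beta> z j0"
  have c: "c > 0" "\<And>j. j < l \<Longrightarrow> orb \<beta> z j \<le> 1 - c"
    using z_lt[of j0] j0 by (force simp: c_def)+
  obtain k where k: "max (h / e) (\<beta> ^ l * G / c) + 1 < \<beta> ^ k"
    using real_arch_pow[OF \<beta>] by blast
  \<comment> \<open>After \<open>K\<close> steps \<open>t\<close> sits at the largest point of its orbit; large \<open>k\<close> makes \<open>d\<close> small and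
    keeps all points of the new orbit below \<open>1\<close>.\<close>
  define K where "K = m * k + i"
  define q where "q = \<beta> ^ (K + l) - 1"
  have "k \<le> m * k"
    using m by simp
  then have "k \<le> K + l"
    unfolding K_def by linarith
  then have "\<beta> ^ k \<le> \<beta> ^ (K + l)"
    using \<beta> by (intro power_increasing) auto
  then have "max (h / e) (\<beta> ^ l * G / c) < q"
    using k unfolding q_def by linarith
  then have q: "h / e < q" "\<beta> ^ l * G / c < q"
    by auto
  have q0: "q > 0"
    using q(1) h e by (smt (verit) divide_pos_pos)
  \<comment> \<open>The value of \<open>d\<close> for which the orbit of \<open>t + d\<close> closes up after \<open>K + l\<close> steps.\<close>
  define d where "d = h / q"
  have d: "d > 0" "d < e"
    using q(1) q0 h e by (auto simp: d_def field_simps)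
  have dq: "\<beta> ^ (K + l) * d = h + d"
    using q0 by (simp add: d_def q_def field_simps)
  have room: "\<beta> ^ j * (G / q) < c" if "j \<le> l" for j
  proof -
    have "\<beta> ^ j * (G / q) \<le> \<beta> ^ l * (G / q)"
      using that \<beta> G q0 by (intro mult_right_mono power_increasing) auto
    also have "\<dots> < c"
      using q(2) q0 c(1) by (simp add: field_simps)
    finally show ?thesis .
  qed
  have over: "\<beta> ^ K * d - G \<le> G / q"
  proof -
    have "\<beta> ^ K * d \<le> \<beta> ^ K * (\<beta> ^ l * G / q)"
      using h q0 \<beta> by (intro mult_left_mono) (auto simp: d_def divide_right_mono)
    also have "\<dots> = (q + 1) * G / q"
      by (simp add: q_def power_add)
    also have "\<dots> = G + G / q"
      using q0 by (simp add: field_simps)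
    finally show ?thesis by simp
  qed
  define p where "p = t + d"
  have first: "p \<le> orb \<beta> t j + \<beta> ^ j * (p - t) \<and> orb \<beta> t j + \<beta> ^ j * (p - t) < 1"
    if "j \<le> K" for j
  proof
    have "1 * d \<le> \<beta> ^ j * d"
      using \<beta> d by (intro mult_right_mono) auto
    then show "p \<le> orb \<beta> t j + \<beta> ^ j * (p - t)"
      using t_le[of j] by (simp add: p_def)
    have "\<beta> ^ j * d \<le> \<beta> ^ K * d"
      using that \<beta> d by (intro mult_right_mono power_increasing) auto
    also have "\<dots> \<le> G + G / q"
      using over by simp
    also have "\<dots> < G + (1 - z)"
      using room[of 0] c(2)[of 0] l by simp
    finally show "orb \<beta> t j + \<beta> ^ j * (p - t) < 1"
      using v[of j] by (simp add: p_def G_def w_def)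
  qed
  have orb_p: "orb \<beta> p j = orb \<beta> t j + \<beta> ^ j * (p - t)" if "j \<le> K" for j
  proof (rule orb_affine)
    fix j' assume "1 \<le> j'" "j' \<le> j"
    then show "0 \<le> orb \<beta> t j' + \<beta> ^ j' * (p - t) \<and> orb \<beta> t j' + \<beta> ^ j' * (p - t) < 1"
      using first[of j'] that d(1) t1 unfolding p_def by linarith
  qed
  have p1: "p < 1"
    using first[of 0] by simp
  define y where "y = orb \<beta> p K"
  have y: "y = z + (\<beta> ^ K * d - G)"
    using orb_p[of K] orb_periodic(2)[OF m(2), of k i] by (simp add: y_def K_def p_def G_def w_def)
  have p_le_y: "p \<le> orb \<beta> z j + \<beta> ^ j * (y - z)" if "j < l" for j
  proof -
    have "1 * d \<le> \<beta> ^ (K + j) * d"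
      using \<beta> d by (intro mult_right_mono) auto
    then show ?thesis
      using before_l[OF that] by (simp add: y p_def power_add algebra_simps)
  qed
  have return: "orb \<beta> z l + \<beta> ^ l * (y - z) = p"
    using dq by (simp add: y p_def h_def power_add algebra_simps)
  have orb_y: "orb \<beta> y j = orb \<beta> z j + \<beta> ^ j * (y - z)" if "j \<le> l" for j
  proof (rule orb_affine)
    fix j' assume j': "1 \<le> j'" "j' \<le> j"
    show "0 \<le> orb \<beta> z j' + \<beta> ^ j' * (y - z) \<and> orb \<beta> z j' + \<beta> ^ j' * (y - z) < 1"
    proof (cases "j' = l")
      case True
      then show ?thesis
        using return p1 d t1 by (simp add: p_def)
    next
      case False
      then have "j' < l"
        using j' that by simp
      moreover have "\<beta> ^ j' * (y - z) \<le> \<beta> ^ j' * (G / q)"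
        using over \<beta> by (intro mult_left_mono) (auto simp: y)
      ultimately show ?thesis
        using p_le_y[of j'] c(2)[of j'] room[of j'] d t1 by (simp add: p_def)
    qed
  qed
  have "p \<in> bifurcation_set \<beta>"
  proof (rule periodic_in_bifurcation_set[OF \<beta>])
    show "0 \<le> p" "p < 1" "0 < K + l"
      using d t1 p1 l by (auto simp: p_def)
    show "orb \<beta> p (K + l) = p"
      using orb_y[of l] return by (simp add: orb_add y_def)
    fix j assume j: "j < K + l"
    show "p \<le> orb \<beta> p j"
    proof (cases "j \<le> K")
      case True
      then show ?thesis
        using first orb_p by simp
    next
      case False
      then obtain j' where "j = K + j'" "j' < l"
        using j that[of "j - K"] by auto
      then show ?thesis
        using orb_y[of j'] p_le_y[of j'] by (simp add: orb_add y_def)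
    qed
  qed
  moreover have "p \<noteq> t" "dist p t < e"
    using d by (auto simp: p_def dist_real_def)
  ultimately show "\<exists>p\<in>bifurcation_set \<beta>. p \<noteq> t \<and> dist p t < e"
    by blast
qed

section \<open>Hausdorff measure on the line\<close>

lemma hausdorff_measure_zeroI:
  fixes A :: "'a::metric_space set"
  assumes "\<And>e::real. e > 0 \<Longrightarrow> \<exists>U::nat \<Rightarrow> 'a set. (\<forall>i. bounded (U i) \<and> diameter (U i) \<le> e) \<and>
             A \<subseteq> (\<Union>i. U i) \<and> (\<Sum>i. diam_pow s (U i)) \<le> ennreal e"
  shows "hausdorff_measure s A = 0"
proof -
  have "hausdorff_premeasure s \<delta> A \<le> 0" if \<delta>: "\<delta> > 0" for \<delta>
  proof (rule ennreal_le_epsilon)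
    fix e :: real assume e: "e > 0"
    obtain U :: "nat \<Rightarrow> 'a set" where
      U: "\<forall>i. bounded (U i) \<and> diameter (U i) \<le> min e \<delta>" "A \<subseteq> (\<Union>i. U i)"
        "(\<Sum>i. diam_pow s (U i)) \<le> ennreal (min e \<delta>)"
      using assms[of "min e \<delta>"] e \<delta> by auto
    have "hausdorff_premeasure s \<delta> A \<le> (\<Sum>i. diam_pow s (U i))"
      unfolding hausdorff_premeasure_def using U by (intro Inf_lower) auto
    also have "\<dots> \<le> ennreal e"
      using U(3) by (rule order_trans) (auto intro!: ennreal_leI)
    finally show "hausdorff_premeasure s \<delta> A \<le> 0 + ennreal e"
      by simp
  qed
  then show ?thesis
    unfolding hausdorff_measure_def
    by (metis (no_types, lifting) SUP_eq_iff SUP_least bot_ennreal empty_iff greaterThan_iff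
        le_zero_eq zero_less_one)
qed

lemma hausdorff_measure_zeroD:
  fixes A :: "'a::metric_space set"
  assumes "hausdorff_measure s A = 0" and \<delta>: "\<delta> > 0" and e: "e > 0"
  shows "\<exists>U::nat \<Rightarrow> 'a set. (\<forall>i. bounded (U i) \<and> diameter (U i) \<le> \<delta>) \<and>
           A \<subseteq> (\<Union>i. U i) \<and> (\<Sum>i. diam_pow s (U i)) < ennreal e"
proof -
  have "hausdorff_premeasure s \<delta> A \<le> hausdorff_measure s A"
    unfolding hausdorff_measure_def using \<delta> by (intro SUP_upper) auto
  then have "hausdorff_premeasure s \<delta> A < ennreal e"
    using assms by simp
  then show ?thesis
    unfolding hausdorff_premeasure_def Inf_less_iff by blast
qed

lemma hausdorff_null_subset:
  fixes B :: "'a::metric_space set"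
  assumes "A \<subseteq> B" "hausdorff_measure s B = 0"
  shows "hausdorff_measure s A = 0"
proof (rule hausdorff_measure_zeroI)
  fix e :: real assume "e > 0"
  from hausdorff_measure_zeroD[OF assms(2) this this]
  show "\<exists>U::nat \<Rightarrow> 'a set. (\<forall>i. bounded (U i) \<and> diameter (U i) \<le> e) \<and>
             A \<subseteq> (\<Union>i. U i) \<and> (\<Sum>i. diam_pow s (U i)) \<le> ennreal e"
    using assms(1) by (metis less_imp_le subset_trans)
qed

lemma hausdorff_null_UN:
  fixes A :: "nat \<Rightarrow> 'a::metric_space set"
  assumes "\<And>n. hausdorff_measure s (A n) = 0"
  shows "hausdorff_measure s (\<Union>n. A n) = 0"
proof (rule hausdorff_measure_zeroI)
  fix e :: real assume e: "e > 0"
  have "\<exists>U::nat \<Rightarrow> 'a set. (\<forall>i. bounded (U i) \<and> diameter (U i) \<le> e) \<and> A n \<subseteq> (\<Union>i. U i) \<and>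
          (\<Sum>i. diam_pow s (U i)) \<le> ennreal (e * (1 / 2) ^ Suc n)" for n
  proof -
    have "e * (1 / 2) ^ Suc n > 0"
      using e by simp
    from hausdorff_measure_zeroD[OF assms[of n] e this] show ?thesis
      by (metis less_imp_le)
  qed
  then have "\<forall>n. \<exists>U::nat \<Rightarrow> 'a set. (\<forall>i. bounded (U i) \<and> diameter (U i) \<le> e) \<and>
      A n \<subseteq> (\<Union>i. U i) \<and> (\<Sum>i. diam_pow s (U i)) \<le> ennreal (e * (1 / 2) ^ Suc n)"
    by blast
  from choice[OF this] obtain U :: "nat \<Rightarrow> nat \<Rightarrow> 'a set" where
    U: "\<And>n i. bounded (U n i)" "\<And>n i. diameter (U n i) \<le> e" "\<And>n. A n \<subseteq> (\<Union>i. U n i)"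
      "\<And>n. (\<Sum>i. diam_pow s (U n i)) \<le> ennreal (e * (1 / 2) ^ Suc n)"
    by blast
  define V where "V i = case_prod U (prod_decode i)" for i
  have "(\<Sum>i. diam_pow s (V i)) = (\<Sum>n i. diam_pow s (U n i))"
    using suminf_ennreal_2dimen[of "\<lambda>n. \<Sum>i. diam_pow s (U n i)" "\<lambda>(n, i). diam_pow s (U n i)"]
    by (simp add: V_def case_prod_unfold)
  also have "\<dots> \<le> (\<Sum>n. ennreal (e * (1 / 2) ^ Suc n))"
    by (intro suminf_le U) auto
  also have "\<dots> = ennreal e"
    using e sums_mult[OF power_half_series, of e] by (intro suminf_ennreal_eq) auto
  finally have "(\<Sum>i. diam_pow s (V i)) \<le> ennreal e" .
  moreover have "(\<Union>n. A n) \<subseteq> (\<Union>i. V i)"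
  proof
    fix x assume "x \<in> (\<Union>n. A n)"
    then obtain n i where "x \<in> U n i"
      using U(3) by blast
    then have "x \<in> V (prod_encode (n, i))"
      by (simp add: V_def)
    then show "x \<in> (\<Union>i. V i)"
      by blast
  qed
  ultimately show "\<exists>U::nat \<Rightarrow> 'a set. (\<forall>i. bounded (U i) \<and> diameter (U i) \<le> e) \<and>
             (\<Union>n. A n) \<subseteq> (\<Union>i. U i) \<and> (\<Sum>i. diam_pow s (U i)) \<le> ennreal e"
    using U(1,2) by (intro exI[of _ V]) (auto simp: V_def case_prod_unfold)
qed

lemma hausdorff_null_countable:
  fixes A :: "'a::metric_space set"
  assumes "countable A" "s > 0"
  shows "hausdorff_measure s A = 0"
proof (rule hausdorff_measure_zeroI)
  fix e :: real assume e: "e > 0"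
  define U where "U i = (if A = {} then {} else {from_nat_into A i})" for i
  have "A \<subseteq> (\<Union>i. U i)"
    using from_nat_into_surj[OF assms(1)] by (auto simp: U_def)
  moreover have "diam_pow s (U i) = 0" for i
    using assms(2) by (auto simp: U_def diam_pow_def)
  moreover have "bounded (U i) \<and> diameter (U i) \<le> e" for i
    using e by (auto simp: U_def)
  ultimately show "\<exists>U::nat \<Rightarrow> 'a set. (\<forall>i. bounded (U i) \<and> diameter (U i) \<le> e) \<and>
             A \<subseteq> (\<Union>i. U i) \<and> (\<Sum>i. diam_pow s (U i)) \<le> ennreal e"
    by (intro exI[of _ U]) auto
qed

lemma hausdorff_null_finite_cover:
  fixes A :: "'a::metric_space set"
  assumes s: "s > 0"
    and cover: "\<And>e::real. e > 0 \<Longrightarrow> \<exists>d \<U>. 0 < d \<and> d \<le> e \<and> finite \<U> \<and> A \<subseteq> \<Union>\<U> \<and>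
      (\<forall>u\<in>\<U>. bounded u \<and> diameter u \<le> d) \<and> real (card \<U>) * d powr s \<le> e"
  shows "hausdorff_measure s A = 0"
proof (rule hausdorff_measure_zeroI)
  fix e :: real assume e: "e > 0"
  obtain d and \<U> :: "'a set set" where d: "0 < d" "d \<le> e" "finite \<U>" "A \<subseteq> \<Union>\<U>"
    "\<forall>u\<in>\<U>. bounded u \<and> diameter u \<le> d" "real (card \<U>) * d powr s \<le> e"
    using cover[OF e] by blast
  obtain f where f: "bij_betw f {0..<card \<U>} \<U>"
    using ex_bij_betw_nat_finite[OF d(3)] by blast
  define U where "U i = (if i < card \<U> then f i else {})" for i
  have fU: "f i \<in> \<U>" if "i < card \<U>" for i
    using f that by (auto simp: bij_betw_def)
  have "(\<Sum>i. diam_pow s (U i)) = (\<Sum>i<card \<U>. diam_pow s (U i))"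
    by (rule suminf_finite) (auto simp: U_def diam_pow_def)
  also have "\<dots> \<le> (\<Sum>i<card \<U>. ennreal (d powr s))"
  proof (rule sum_mono)
    fix i assume "i \<in> {..<card \<U>}"
    then have "bounded (U i)" "diameter (U i) \<le> d"
      using fU[of i] d(5) by (auto simp: U_def)
    then show "diam_pow s (U i) \<le> ennreal (d powr s)"
      using s by (auto simp: diam_pow_def intro!: ennreal_leI powr_mono2 diameter_ge_0)
  qed
  also have "\<dots> = ennreal (real (card \<U>) * d powr s)"
    by (simp add: ennreal_mult' ennreal_of_nat_eq_real_of_nat)
  also have "\<dots> \<le> ennreal e"
    by (intro ennreal_leI d)
  finally have "(\<Sum>i. diam_pow s (U i)) \<le> ennreal e" .
  moreover have "A \<subseteq> (\<Union>i. U i)"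
  proof
    fix x assume "x \<in> A"
    then obtain u where u: "u \<in> \<U>" "x \<in> u"
      using d(4) by blast
    then have "u \<in> f ` {0..<card \<U>}"
      using bij_betw_imp_surj_on[OF f] by simp
    then obtain i where "i < card \<U>" "u = f i"
      by auto
    then show "x \<in> (\<Union>i. U i)"
      using u by (auto simp: U_def)
  qed
  moreover have "bounded (U i) \<and> diameter (U i) \<le> e" for i
    using fU[of i] d e by (force simp: U_def)
  ultimately show "\<exists>U::nat \<Rightarrow> 'a set. (\<forall>i. bounded (U i) \<and> diameter (U i) \<le> e) \<and>
             A \<subseteq> (\<Union>i. U i) \<and> (\<Sum>i. diam_pow s (U i)) \<le> ennreal e"
    by (intro exI[of _ U]) auto
qed

lemma hausdorff_measure_0_eq_0_imp_empty:
  fixes A :: "'a::metric_space set"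
  assumes "hausdorff_measure 0 A = 0"
  shows "A = {}"
proof -
  obtain U :: "nat \<Rightarrow> 'a set" where U: "A \<subseteq> (\<Union>i. U i)" "(\<Sum>i. diam_pow 0 (U i)) < ennreal 1"
    using hausdorff_measure_zeroD[OF assms zero_less_one zero_less_one] by blast
  have "U i = {}" for i
  proof (rule ccontr)
    assume "U i \<noteq> {}"
    then have "1 \<le> (\<Sum>j\<in>{i}. diam_pow 0 (U j))"
      by (simp add: diam_pow_def)
    also have "\<dots> \<le> (\<Sum>j. diam_pow 0 (U j))"
      by (rule sum_le_suminf) auto
    finally show False
      using U(2) by simp
  qed
  then show ?thesis
    using U(1) by simp
qed

text \<open>The mass distribution principle in a form that needs no measure on \<open>A\<close>: a set that is
  mapped onto the unit interval by the Hoelder continuous inverse of \<open>g\<close> is not null, since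
  Hoelder maps do not increase covering sums by more than a constant factor.\<close>

lemma hausdorff_measure_pos_of_expanding:
  fixes A :: "real set" and g :: "real \<Rightarrow> real"
  assumes s: "s > 0" and C: "C \<ge> 0"
    and g: "\<And>y. 0 \<le> y \<Longrightarrow> y < 1 \<Longrightarrow> g y \<in> A"
    and expand: "\<And>y y'. 0 \<le> y \<Longrightarrow> y < 1 \<Longrightarrow> 0 \<le> y' \<Longrightarrow> y' < 1 \<Longrightarrow>
      \<bar>y - y'\<bar> \<le> C * \<bar>g y - g y'\<bar> powr s"
  shows "hausdorff_measure s A \<noteq> 0"
proof
  assume null: "hausdorff_measure s A = 0"
  have e: "1 / (2 * C + 1) > 0"
    using C by simp
  obtain U :: "nat \<Rightarrow> real set" where U: "\<And>i. bounded (U i)" "A \<subseteq> (\<Union>i. U i)"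
    "(\<Sum>i. diam_pow s (U i)) < ennreal (1 / (2 * C + 1))"
    using hausdorff_measure_zeroD[OF null zero_less_one e] by blast
  have "\<exists>a b. {y \<in> {0..<1}. g y \<in> U i} \<subseteq> {a..b} \<and>
          emeasure lborel {a..b} \<le> ennreal (2 * C) * diam_pow s (U i)" for i
  proof (cases "{y \<in> {0..<1}. g y \<in> U i} = {}")
    case True
    then show ?thesis
      by (intro exI[of _ 1] exI[of _ 0]) simp
  next
    case False
    then obtain y0 where y0: "0 \<le> y0" "y0 < 1" "g y0 \<in> U i"
      by auto
    define r where "r = C * diameter (U i) powr s"
    have r: "r \<ge> 0"
      using C by (simp add: r_def)
    have near: "\<bar>y - y0\<bar> \<le> r" if "0 \<le> y" "y < 1" "g y \<in> U i" for y
    proof -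
      have "\<bar>g y - g y0\<bar> \<le> diameter (U i)"
        using diameter_bounded_bound[OF U(1) that(3) y0(3)] by (simp add: dist_real_def)
      then have "C * \<bar>g y - g y0\<bar> powr s \<le> r"
        unfolding r_def using C s by (intro mult_left_mono powr_mono2) auto
      then show ?thesis
        using expand[of y y0] that y0 by simp
    qed
    have "{y \<in> {0..<1}. g y \<in> U i} \<subseteq> {y0 - r..y0 + r}"
    proof
      fix y assume "y \<in> {y \<in> {0..<1}. g y \<in> U i}"
      then have "\<bar>y - y0\<bar> \<le> r"
        using near[of y] by simp
      then show "y \<in> {y0 - r..y0 + r}"
        unfolding atLeastAtMost_iff by linarith
    qed
    moreover have "emeasure lborel {y0 - r..y0 + r} = ennreal (2 * C) * diam_pow s (U i)"
    proof -
      have "U i \<noteq> {}"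
        using y0(3) by auto
      then have "diam_pow s (U i) = ennreal (diameter (U i) powr s)"
        using s by (simp add: diam_pow_def)
      then have "ennreal (2 * C) * diam_pow s (U i) = ennreal (2 * r)"
        using C by (simp add: r_def ennreal_mult'[symmetric] mult.assoc)
      then show ?thesis
        using r by simp
    qed
    ultimately show ?thesis
      by (intro exI[of _ "y0 - r"] exI[of _ "y0 + r"]) simp
  qed
  then obtain a b where ab: "\<And>i. {y \<in> {0..<1}. g y \<in> U i} \<subseteq> {a i..b i}"
    "\<And>i. emeasure lborel {a i..b i} \<le> ennreal (2 * C) * diam_pow s (U i)"
    by metis
  have "{0..<1} \<subseteq> (\<Union>i. {a i..b i})"
  proof
    fix y :: real assume y: "y \<in> {0..<1}"
    then obtain i where "g y \<in> U i"
      using g[of y] U(2) by auto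
    then show "y \<in> (\<Union>i. {a i..b i})"
      using ab(1)[of i] y by blast
  qed
  have "1 = emeasure lborel {0..<1::real}"
    by simp
  also have "\<dots> \<le> emeasure lborel (\<Union>i. {a i..b i})"
    by (rule emeasure_mono[OF \<open>{0..<1} \<subseteq> _\<close>]) auto
  also have "\<dots> \<le> (\<Sum>i. emeasure lborel {a i..b i})"
    by (rule emeasure_subadditive_countably) auto
  also have "\<dots> \<le> (\<Sum>i. ennreal (2 * C) * diam_pow s (U i))"
    by (intro suminf_le ab) auto
  also have "\<dots> = ennreal (2 * C) * (\<Sum>i. diam_pow s (U i))"
    by (rule ennreal_suminf_cmult)
  also have "\<dots> \<le> ennreal (2 * C) * ennreal (1 / (2 * C + 1))"
    using U(3) by (intro mult_left_mono) auto
  also have "\<dots> = ennreal (2 * C / (2 * C + 1))"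
    using C by (simp add: ennreal_mult'[symmetric])
  also have "\<dots> < 1"
    using C by (simp add: ennreal_less_one_iff)
  finally show False by simp
qed

section \<open>Counting full cylinders\<close>

text \<open>\<open>full \<beta> j\<close> consists of the left end points of those branches of the \<open>j\<close>-th iterate that
  are onto the unit interval.\<close>

definition full :: "real \<Rightarrow> nat \<Rightarrow> real set" where
  "full \<beta> j = {a. 0 \<le> a \<and> a + 1 / \<beta> ^ j \<le> 1 \<and>
     (\<forall>y. a \<le> y \<and> y < a + 1 / \<beta> ^ j \<longrightarrow> orb \<beta> y j = \<beta> ^ j * (y - a))}"

lemma orb_le_power:
  assumes "\<beta> > 1" "0 \<le> x"
  shows "orb \<beta> x n \<le> \<beta> ^ n * x"
proof (induction n)
  case (Suc n)
  have "0 \<le> digit \<beta> x n"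
    using assms orb_nonneg[of x \<beta> n] by (simp add: digit_def)
  then have "orb \<beta> x (Suc n) \<le> \<beta> * orb \<beta> x n"
    by (simp add: orb_Suc)
  also have "\<dots> \<le> \<beta> * (\<beta> ^ n * x)"
    using Suc assms by (intro mult_left_mono) auto
  finally show ?case by simp
qed simp

lemma orb_near_one:
  assumes \<beta>: "\<beta> > 1" and z: "z < 1" "0 \<le> orb \<beta> 1 i - \<beta> ^ i * (1 - z)"
  shows "orb \<beta> z i = orb \<beta> 1 i - \<beta> ^ i * (1 - z)"
proof -
  have "orb \<beta> z i = orb \<beta> 1 i + \<beta> ^ i * (z - 1)"
  proof (rule orb_affine)
    fix l assume l: "1 \<le> l" "l \<le> i"
    have "orb \<beta> 1 i \<le> \<beta> ^ (i - l) * orb \<beta> 1 l"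
      using orb_le_power[OF \<beta>, of "orb \<beta> 1 l" "i - l"] orb_nonneg[of 1 \<beta> l] l
      by (simp flip: orb_add)
    moreover have "\<beta> ^ i * (1 - z) = \<beta> ^ (i - l) * (\<beta> ^ l * (1 - z))"
      using l by (simp flip: power_add mult.assoc)
    ultimately have "0 \<le> \<beta> ^ (i - l) * (orb \<beta> 1 l - \<beta> ^ l * (1 - z))"
      using z(2) by (simp add: right_diff_distrib)
    moreover have "\<beta> ^ (i - l) > 0"
      using \<beta> by simp
    ultimately have "0 \<le> orb \<beta> 1 l - \<beta> ^ l * (1 - z)"
      unfolding zero_le_mult_iff by linarith
    moreover have "\<beta> ^ l * (1 - z) > 0"
      using \<beta> z by simp
    ultimately show "0 \<le> orb \<beta> 1 l + \<beta> ^ l * (z - 1) \<and> orb \<beta> 1 l + \<beta> ^ l * (z - 1) < 1"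
      using orb_bounds(2)[of l 1 \<beta>] l by (simp add: algebra_simps)
  qed
  then show ?thesis
    by (simp add: algebra_simps)
qed

lemma zero_in_full:
  assumes "\<beta> > 1"
  shows "0 \<in> full \<beta> j"
proof -
  have "orb \<beta> y j = \<beta> ^ j * y" if "0 \<le> y" "y < 1 / \<beta> ^ j" for y
    using that assms by (intro orb_small) (auto simp: field_simps)
  then show ?thesis
    using assms by (simp add: full_def)
qed

text \<open>Every point is reached from a full cylinder by following the expansion of \<open>1\<close>: as long as
  the digits of \<open>T ^ j x\<close> agree with those of \<open>1\<close> the cylinder may fail to be full, and it
  becomes full again with the first smaller digit.\<close>

lemma exists_full_ancestor:
  assumes \<beta>: "\<beta> > 1" and x: "0 \<le> x" "x < 1"
  shows "\<exists>j a. j \<le> m \<and> a \<in> full \<beta> j \<and> a \<le> x \<and> \<beta> ^ j * (x - a) < 1 \<and>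
           0 \<le> orb \<beta> 1 (m - j) - \<beta> ^ (m - j) * (1 - \<beta> ^ j * (x - a))"
proof (induction m)
  case 0
  have "0 \<in> full \<beta> 0"
    using zero_in_full[OF \<beta>] .
  then show ?case
    using x by (intro exI[of _ 0] exI[of _ "0::real"]) simp
next
  case (Suc m)
  then obtain j a where ja: "j \<le> m" "a \<in> full \<beta> j" "a \<le> x" "\<beta> ^ j * (x - a) < 1"
    "0 \<le> orb \<beta> 1 (m - j) - \<beta> ^ (m - j) * (1 - \<beta> ^ j * (x - a))"
    by blast
  define i where "i = m - j"
  define \<tau> where "\<tau> = orb \<beta> 1 i"
  have m: "m = j + i"
    using ja by (simp add: i_def)
  have \<beta>0: "\<beta> ^ l > 0" for l
    using \<beta> by simp
  have orb_j: "orb \<beta> y j = \<beta> ^ j * (y - a)" if "a \<le> y" "\<beta> ^ j * (y - a) < 1" for y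
  proof -
    have "y < a + 1 / \<beta> ^ j"
      using that(2) pos_less_divide_eq[OF \<beta>0[of j], of "y - a" 1] by (simp add: mult.commute)
    then show ?thesis
      using ja(2) that(1) by (simp add: full_def)
  qed
  have orb_m: "orb \<beta> y m = \<tau> - \<beta> ^ i * (1 - \<beta> ^ j * (y - a))"
    if "a \<le> y" "\<beta> ^ j * (y - a) < 1" "0 \<le> \<tau> - \<beta> ^ i * (1 - \<beta> ^ j * (y - a))" for y
    unfolding m orb_add orb_j[OF that(1,2)] \<tau>_def
    using that by (intro orb_near_one[OF \<beta>]) (auto simp: \<tau>_def)
  define w where "w = orb \<beta> x m"
  have w: "w = \<tau> - \<beta> ^ i * (1 - \<beta> ^ j * (x - a))"
    unfolding w_def using ja by (intro orb_m) (auto simp: \<tau>_def i_def)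
  define l where "l = digit \<beta> x m"
  have w_le: "w \<le> \<tau>"
    using ja(4) \<beta> unfolding w by simp
  have l_le: "l \<le> digit \<beta> 1 i"
    unfolding l_def digit_def w_def[symmetric] \<tau>_def[symmetric]
    using w_le \<beta> by (intro floor_mono) simp
  have l0: "l \<ge> 0"
    using orb_nonneg[OF x(1), of \<beta> m] \<beta> by (simp add: l_def digit_def)
  have x_Suc: "orb \<beta> x (Suc m) = \<beta> * w - of_int l"
    by (simp add: orb_Suc w_def l_def)
  have x_Suc_bounds: "0 \<le> orb \<beta> x (Suc m)" "orb \<beta> x (Suc m) < 1"
    using orb_bounds[of "Suc m" x \<beta>] by auto
  show ?case
  proof (cases "l = digit \<beta> 1 i")
    case True
    have "orb \<beta> 1 (Suc m - j) - \<beta> ^ (Suc m - j) * (1 - \<beta> ^ j * (x - a)) = \<beta> * w - of_int l"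
      using ja(1) unfolding w by (simp add: Suc_diff_le i_def \<tau>_def True orb_Suc algebra_simps)
    then show ?thesis
      using ja x_Suc x_Suc_bounds by (intro exI[of _ j] exI[of _ a]) auto
  next
    case False
    define a' where "a' = x - orb \<beta> x (Suc m) / \<beta> ^ Suc m"
    have branch: "a \<le> y \<and> \<beta> ^ j * (y - a) < 1 \<and> orb \<beta> y (Suc m) = \<beta> ^ Suc m * (y - a')"
      if y: "a' \<le> y" "y < a' + 1 / \<beta> ^ Suc m" for y
    proof -
      define r where "r = \<beta> ^ Suc m * (y - a')"
      have r: "0 \<le> r" "r < 1"
        using y \<beta>0[of "Suc m"] \<beta> by (auto simp: r_def field_simps)
      define wy where "wy = w + \<beta> ^ m * (y - x)"
      have "\<beta> ^ Suc m * (x - a') = orb \<beta> x (Suc m)"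
        using \<beta> by (simp add: a'_def)
      then have "r = \<beta> ^ Suc m * (y - x) + orb \<beta> x (Suc m)"
        by (simp add: r_def algebra_simps)
      then have \<beta>wy: "\<beta> * wy = of_int l + r"
        using x_Suc by (simp add: wy_def algebra_simps)
      have "0 \<le> \<beta> * wy"
        using \<beta>wy r l0 by simp
      then have wy0: "0 \<le> wy"
        using \<beta> by (simp add: zero_le_mult_iff)
      have "of_int l + 1 \<le> \<beta> * \<tau>"
        using l_le False unfolding digit_def \<tau>_def by linarith
      then have "\<beta> * wy < \<beta> * \<tau>"
        using \<beta>wy r by simp
      then have wy_lt: "wy < \<tau>"
        using \<beta> by simp
      have wy: "wy = \<tau> - \<beta> ^ i * (1 - \<beta> ^ j * (y - a))"
        unfolding wy_def w m by (simp add: power_add algebra_simps)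
      have z1: "\<beta> ^ j * (y - a) < 1"
        using wy_lt \<beta>0[of i] \<beta> unfolding wy by (simp add: zero_less_mult_iff)
      have "\<tau> \<le> \<beta> ^ i * 1"
        unfolding \<tau>_def using \<beta> by (intro orb_le_power) auto
      then have "\<beta> ^ i * (1 - \<beta> ^ j * (y - a)) \<le> \<beta> ^ i * 1"
        using wy0 unfolding wy by simp
      then have "1 - \<beta> ^ j * (y - a) \<le> 1"
        using mult_le_cancel_left_pos[OF \<beta>0[of i]] by blast
      then have "0 \<le> \<beta> ^ j * (y - a)"
        by simp
      then have ay: "a \<le> y"
        using \<beta>0[of j] by (simp add: zero_le_mult_iff)
      have "orb \<beta> y m = wy"
        using orb_m[OF ay z1] wy wy0 by simp
      then have "orb \<beta> y (Suc m) = r"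
        using \<beta>wy r by (intro digit_unique(2)[where a = l]) auto
      then show ?thesis
        using ay z1 by (simp add: r_def)
    qed
    have "a' < a' + 1 / \<beta> ^ Suc m"
      using \<beta> by simp
    then have "a \<le> a'"
      using branch[of a'] by auto
    moreover have "0 \<le> a" "a + 1 / \<beta> ^ j \<le> 1"
      using ja(2) by (auto simp: full_def)
    moreover have "a' \<le> x"
      using x_Suc_bounds \<beta> by (simp add: a'_def)
    moreover have "a' + 1 / \<beta> ^ Suc m \<le> 1"
    proof (rule ccontr)
      assume "\<not> ?thesis"
      then have "\<beta> ^ j * (1 - a) < 1"
        using branch[of 1] \<open>a' \<le> x\<close> x by auto
      then show False
        using \<open>a + 1 / \<beta> ^ j \<le> 1\<close> pos_divide_le_eq[OF \<beta>0[of j], of 1 "1 - a"]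
        by (simp add: mult.commute)
    qed
    ultimately have "a' \<in> full \<beta> (Suc m)"
      using branch unfolding full_def by auto
    moreover have "\<beta> ^ Suc m * (x - a') = orb \<beta> x (Suc m)"
      using \<beta> by (simp add: a'_def)
    ultimately show ?thesis
      using x_Suc_bounds \<open>a' \<le> x\<close> by (intro exI[of _ "Suc m"] exI[of _ a']) auto
  qed
qed

lemma full_separated:
  assumes "\<beta> > 1" "a \<in> full \<beta> j" "a' \<in> full \<beta> j" "a < a'"
  shows "a + 1 / \<beta> ^ j \<le> a'"
proof (rule ccontr)
  assume "\<not> ?thesis"
  then have "orb \<beta> a' j = \<beta> ^ j * (a' - a)"
    using assms by (auto simp: full_def)
  moreover have "orb \<beta> a' j = 0"
    using assms by (auto simp: full_def)
  ultimately show False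
    using assms by simp
qed

lemma finite_full:
  assumes \<beta>: "\<beta> > 1"
  shows "finite (full \<beta> j)"
proof (rule inj_on_finite)
  show "inj_on (\<lambda>a. \<lfloor>\<beta> ^ j * a\<rfloor>) (full \<beta> j)"
  proof (rule linorder_inj_onI)
    fix a a' assume a: "a < a'" "a \<in> full \<beta> j" "a' \<in> full \<beta> j"
    from full_separated[OF \<beta> a(2,3,1)] have "\<beta> ^ j * a + 1 \<le> \<beta> ^ j * a'"
      using \<beta> by (simp add: field_simps)
    then show "\<lfloor>\<beta> ^ j * a\<rfloor> \<noteq> \<lfloor>\<beta> ^ j * a'\<rfloor>"
      by linarith
  qed auto
  show "(\<lambda>a. \<lfloor>\<beta> ^ j * a\<rfloor>) ` full \<beta> j \<subseteq> {0..\<lfloor>\<beta> ^ j\<rfloor>}"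
  proof
    fix x assume "x \<in> (\<lambda>a. \<lfloor>\<beta> ^ j * a\<rfloor>) ` full \<beta> j"
    then obtain a where a: "x = \<lfloor>\<beta> ^ j * a\<rfloor>" "0 \<le> a" "a + 1 / \<beta> ^ j \<le> 1"
      by (auto simp: full_def)
    have "1 / \<beta> ^ j > 0"
      using \<beta> by simp
    then have "a \<le> 1"
      using a(3) by linarith
    then have "\<beta> ^ j * a \<le> \<beta> ^ j" "0 \<le> \<beta> ^ j * a"
      using \<beta> a(2) by (simp_all add: mult_left_le)
    then show "x \<in> {0..\<lfloor>\<beta> ^ j\<rfloor>}"
      using a(1) by (simp add: floor_mono)
  qed
qed simp

text \<open>The part of a full cylinder of order \<open>j\<close> that is still waiting for a smaller digit at time
  \<open>m\<close> has length at most \<open>\<beta> ^ -m\<close>, and these parts cover the unit interval.\<close>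

lemma power_le_sum_card_full:
  assumes \<beta>: "\<beta> > 1"
  shows "\<beta> ^ m \<le> (\<Sum>j\<le>m. real (card (full \<beta> j)))"
proof -
  define I where "I = Sigma {..m} (full \<beta>)"
  define J where "J p = {snd p + 1 / \<beta> ^ fst p - 1 / \<beta> ^ m ..< snd p + 1 / \<beta> ^ fst p}" for p :: "nat \<times> real"
  have fin: "finite I"
    unfolding I_def by (intro finite_SigmaI finite_full[OF \<beta>]) auto
  have sub: "{0..<1} \<subseteq> (\<Union>p\<in>I. J p)"
  proof
    fix x :: real assume "x \<in> {0..<1}"
    then have "0 \<le> x" "x < 1"
      by auto
    then obtain j a where ja: "j \<le> m" "a \<in> full \<beta> j" "a \<le> x" "\<beta> ^ j * (x - a) < 1"
      "0 \<le> orb \<beta> 1 (m - j) - \<beta> ^ (m - j) * (1 - \<beta> ^ j * (x - a))"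
      using exists_full_ancestor[OF \<beta>] by blast
    have "\<beta> ^ (m - j) * (1 - \<beta> ^ j * (x - a)) \<le> 1"
      using ja(5) orb_le_1[of 1 \<beta> "m - j"] by simp
    moreover have "\<beta> ^ (m - j) * (\<beta> ^ j * (x - a)) = \<beta> ^ m * (x - a)"
      using ja(1) by (simp flip: power_add mult.assoc)
    ultimately have "\<beta> ^ (m - j) - 1 \<le> \<beta> ^ m * (x - a)"
      by (simp add: right_diff_distrib)
    then have "(\<beta> ^ (m - j) - 1) / \<beta> ^ m \<le> x - a"
      using \<beta> by (simp add: pos_divide_le_eq mult.commute)
    moreover have "\<beta> ^ m = \<beta> ^ (m - j) * \<beta> ^ j"
      using ja(1) by (simp flip: power_add)
    then have "(\<beta> ^ (m - j) - 1) / \<beta> ^ m = 1 / \<beta> ^ j - 1 / \<beta> ^ m"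
      using \<beta> by (simp add: diff_divide_distrib)
    ultimately have "x \<in> J (j, a)"
      using ja(4) \<beta> by (simp add: J_def field_simps)
    then show "x \<in> (\<Union>p\<in>I. J p)"
      using ja by (force simp: I_def)
  qed
  have "ennreal 1 = emeasure lborel {0..<1::real}"
    by simp
  also have "\<dots> \<le> emeasure lborel (\<Union>p\<in>I. J p)"
    by (rule emeasure_mono[OF sub]) (auto simp: J_def fin)
  also have "\<dots> \<le> (\<Sum>p\<in>I. emeasure lborel (J p))"
    by (rule emeasure_subadditive_finite[OF fin]) (auto simp: J_def)
  also have "\<dots> = (\<Sum>p\<in>I. ennreal (1 / \<beta> ^ m))"
    using \<beta> by (intro sum.cong refl) (auto simp: J_def)
  also have "\<dots> = ennreal (real (card I) * (1 / \<beta> ^ m))"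
    using \<beta> by (simp add: ennreal_of_nat_eq_real_of_nat flip: ennreal_mult')
  finally have "1 \<le> real (card I) * (1 / \<beta> ^ m)"
    using \<beta> by (subst (asm) ennreal_le_iff) auto
  then have "\<beta> ^ m \<le> real (card I)"
    using \<beta> by (simp add: field_simps)
  also have "card I = (\<Sum>j\<le>m. card (full \<beta> j))"
    unfolding I_def by (rule card_SigmaI) (auto simp: finite_full[OF \<beta>])
  finally show ?thesis by simp
qed

text \<open>If all counts from \<open>J\<close> on were smaller, their sum up to \<open>m\<close> could not keep up with
  \<open>\<beta> ^ m\<close>.\<close>

lemma many_full_cylinders:
  assumes \<beta>: "\<beta> > 1" and s: "s < 1"
  shows "\<exists>j\<ge>J. \<beta> powr (s * real j) + 3 \<le> real (card (full \<beta> j))"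
proof (rule ccontr)
  assume "\<not> ?thesis"
  then have few: "real (card (full \<beta> j)) \<le> \<beta> powr (s * real j) + 3" if "j \<ge> J" for j
    using that by force
  define s' where "s' = max s 0"
  have s': "0 \<le> s'" "s' < 1" "s \<le> s'"
    using s by (auto simp: s'_def)
  define C where "C = (\<Sum>j<J. real (card (full \<beta> j)))"
  define r where "r = \<beta> powr (s' - 1)"
  have r: "0 < r" "r < 1"
    using \<beta> s' by (auto simp: r_def powr_less_one)
  have bound: "\<beta> ^ m \<le> C + (real m + 1) * (\<beta> powr (s' * real m) + 3)" for m
  proof -
    have "\<beta> ^ m \<le> (\<Sum>j\<le>m. real (card (full \<beta> j)))"
      by (rule power_le_sum_card_full[OF \<beta>])
    also have "\<dots> \<le> (\<Sum>j\<in>{..<J} \<union> {J..m}. real (card (full \<beta> j)))"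
      by (intro sum_mono2) auto
    also have "\<dots> = C + (\<Sum>j=J..m. real (card (full \<beta> j)))"
      unfolding C_def by (rule sum.union_disjoint) auto
    also have "(\<Sum>j=J..m. real (card (full \<beta> j))) \<le> (\<Sum>j=J..m. \<beta> powr (s' * real m) + 3)"
    proof (rule sum_mono)
      fix j assume j: "j \<in> {J..m}"
      have "s * real j \<le> s' * real m"
        using s' j by (intro mult_mono) auto
      then have "\<beta> powr (s * real j) \<le> \<beta> powr (s' * real m)"
        using \<beta> by simp
      then show "real (card (full \<beta> j)) \<le> \<beta> powr (s' * real m) + 3"
        using few[of j] j by simp
    qed
    also have "\<dots> \<le> (\<Sum>j\<le>m. \<beta> powr (s' * real m) + 3)"
      by (rule sum_mono2) auto
    also have "\<dots> = (real m + 1) * (\<beta> powr (s' * real m) + 3)"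
      by (simp add: algebra_simps)
    finally show ?thesis by simp
  qed
  define q where "q = 1 / \<beta>"
  have q: "0 < q" "q < 1"
    using \<beta> by (auto simp: q_def)
  have "1 \<le> C * q ^ m + (real m * r ^ m + r ^ m) + 3 * (real m * q ^ m + q ^ m)" for m
  proof -
    have "\<beta> powr (s' * real m) = r ^ m * \<beta> ^ m"
    proof -
      have "r ^ m = \<beta> powr ((s' - 1) * real m)"
        using r(1) by (simp add: powr_realpow[symmetric] r_def powr_powr)
      moreover have "\<beta> ^ m = \<beta> powr real m"
        using \<beta> by (simp add: powr_realpow)
      ultimately have "r ^ m * \<beta> ^ m = \<beta> powr ((s' - 1) * real m + real m)"
        by (simp only: powr_add)
      then show ?thesis
        by (simp add: left_diff_distrib)
    qed
    then have "\<beta> ^ m \<le> C + (real m + 1) * (r ^ m * \<beta> ^ m + 3)"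
      using bound[of m] by simp
    then have "\<beta> ^ m * q ^ m \<le> (C + (real m + 1) * (r ^ m * \<beta> ^ m + 3)) * q ^ m"
      using q by (intro mult_right_mono) auto
    also have "\<dots> = C * q ^ m + (real m + 1) * r ^ m * (\<beta> ^ m * q ^ m) + 3 * (real m * q ^ m + q ^ m)"
      by (simp add: algebra_simps)
    finally have "\<beta> ^ m * q ^ m
        \<le> C * q ^ m + (real m + 1) * r ^ m * (\<beta> ^ m * q ^ m) + 3 * (real m * q ^ m + q ^ m)" .
    moreover have "\<beta> ^ m * q ^ m = 1"
      using \<beta> by (simp add: q_def power_one_over)
    ultimately show ?thesis
      by (simp add: distrib_right)
  qed
  moreover have "(\<lambda>m. C * q ^ m + (real m * r ^ m + r ^ m) + 3 * (real m * q ^ m + q ^ m))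
      \<longlonglongrightarrow> C * 0 + (0 + 0) + 3 * (0 + 0)"
    using q r by (intro tendsto_intros powser_times_n_limit_0 LIMSEQ_realpow_zero) auto
  ultimately have "1 \<le> C * 0 + (0 + 0) + 3 * (0 + 0)"
    by (intro Lim_bounded2) auto
  then show False by simp
qed

section \<open>The bifurcation set has full Hausdorff dimension near zero\<close>

text \<open>Points with a prescribed sequence of full branches: the attractor of the similarities
  \<open>x \<mapsto> \<omega> + B * x\<close>. The margins \<open>B\<close> and \<open>1 - 2 * B\<close> keep the attractor away from the two
  end points of the unit interval.\<close>

definition code_point :: "real \<Rightarrow> (nat \<Rightarrow> real) \<Rightarrow> real" where
  "code_point B \<omega> = (\<Sum>k. \<omega> k * B ^ k)"

context
  fixes B :: real and \<omega> :: "nat \<Rightarrow> real"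
  assumes B: "0 < B" "B < 1" and \<omega>: "\<And>k. B \<le> \<omega> k" "\<And>k. \<omega> k \<le> 1 - 2 * B"
begin

lemma code_point_summable: "summable (\<lambda>k. \<omega> k * B ^ k)"
proof (rule summable_comparison_test')
  show "summable (\<lambda>k. 1 * B ^ k)"
    using B by simp
  fix n :: nat assume "n \<ge> 0"
  have "\<bar>\<omega> n\<bar> \<le> 1"
    using \<omega>(1)[of n] \<omega>(2)[of n] B by simp
  then show "norm (\<omega> n * B ^ n) \<le> 1 * B ^ n"
    using B by (simp add: abs_mult mult_right_mono)
qed

lemma code_point_Suc: "code_point B \<omega> = \<omega> 0 + B * code_point B (\<lambda>k. \<omega> (Suc k))"
proof -
  have "(\<Sum>k. \<omega> (Suc k) * B ^ Suc k) = code_point B \<omega> - \<omega> 0"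
    using suminf_split_head[OF code_point_summable] by (simp add: code_point_def)
  moreover have "summable (\<lambda>k. \<omega> (Suc k) * B ^ k)"
    using code_point_summable B summable_Suc_iff[of "\<lambda>k. \<omega> k * B ^ k"]
      summable_mult_D[of B "\<lambda>k. \<omega> (Suc k) * B ^ k"] by (simp add: algebra_simps)
  then have "(\<Sum>k. B * (\<omega> (Suc k) * B ^ k)) = B * code_point B (\<lambda>k. \<omega> (Suc k))"
    unfolding code_point_def by (rule suminf_mult)
  ultimately show ?thesis
    by (simp add: algebra_simps)
qed

lemma code_point_less_1: "code_point B \<omega> < 1"
proof -
  have "(\<lambda>k. (1 - 2 * B) * B ^ k) sums ((1 - 2 * B) * (1 / (1 - B)))"
    using B by (intro sums_mult geometric_sums) auto
  then have "code_point B \<omega> \<le> (1 - 2 * B) * (1 / (1 - B))"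
    unfolding code_point_def using code_point_summable \<omega> B
    by (intro sums_le[OF _ summable_sums]) (auto intro!: mult_right_mono)
  also have "\<dots> < 1"
    using B by (simp add: field_simps)
  finally show ?thesis .
qed

lemma code_point_nonneg: "0 \<le> code_point B \<omega>"
  unfolding code_point_def
proof (intro suminf_nonneg code_point_summable)
  show "0 \<le> \<omega> n * B ^ n" for n
    using \<omega>(1)[of n] B by simp
qed

end

lemma code_point_ge:
  assumes B: "0 < B" "B < 1" and \<omega>: "\<And>k. B \<le> \<omega> k" "\<And>k. \<omega> k \<le> 1 - 2 * B"
  shows "\<omega> 0 \<le> code_point B \<omega>"
  using code_point_nonneg[of B "\<lambda>k. \<omega> (Suc k)"] code_point_Suc[of B \<omega>] assms by simp

lemma code_point_separated:
  assumes B: "0 < B" "B < 1"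
    and \<omega>: "\<And>k. B \<le> \<omega> k" "\<And>k. \<omega> k \<le> 1 - 2 * B"
    and \<omega>': "\<And>k. B \<le> \<omega>' k" "\<And>k. \<omega>' k \<le> 1 - 2 * B"
    and agree: "\<And>i. i < k \<Longrightarrow> \<omega> i = \<omega>' i" and diff: "\<omega> k + B \<le> \<omega>' k"
  shows "B ^ k * B\<^sup>2 \<le> code_point B \<omega>' - code_point B \<omega>"
  using \<omega> \<omega>' agree diff
proof (induction k arbitrary: \<omega> \<omega>')
  case 0
  have "B * code_point B (\<lambda>k. \<omega> (Suc k)) \<le> B * 1"
    using code_point_less_1[OF B, of "\<lambda>k. \<omega> (Suc k)"] 0 B by (intro mult_left_mono) auto
  moreover have "B \<le> code_point B (\<lambda>k. \<omega>' (Suc k))"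
    using order_trans[OF 0(3)[of "Suc 0"] code_point_ge[OF B, of "\<lambda>k. \<omega>' (Suc k)"]] 0(3,4)
    by simp
  then have "B * B \<le> B * code_point B (\<lambda>k. \<omega>' (Suc k))"
    using B by (intro mult_left_mono) auto
  ultimately show ?case
    using code_point_Suc[OF B, of \<omega>] code_point_Suc[OF B, of \<omega>'] 0 by (simp add: power2_eq_square)
next
  case (Suc k)
  have "B ^ k * B\<^sup>2 \<le> code_point B (\<lambda>k. \<omega>' (Suc k)) - code_point B (\<lambda>k. \<omega> (Suc k))"
    using Suc.prems by (intro Suc.IH) auto
  then have "B * (B ^ k * B\<^sup>2) \<le> B * (code_point B (\<lambda>k. \<omega>' (Suc k)) - code_point B (\<lambda>k. \<omega> (Suc k)))"
    using B by (intro mult_left_mono) auto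
  then show ?case
    using code_point_Suc[OF B, of \<omega>] code_point_Suc[OF B, of \<omega>'] Suc.prems(5)[of 0] Suc.prems
    by (simp add: algebra_simps)
qed

lemma orb_code_point:
  assumes \<beta>: "\<beta> > 1" and B: "B = 1 / \<beta> ^ j" "j > 0"
    and \<omega>: "\<And>k. B \<le> \<omega> k" "\<And>k. \<omega> k \<le> 1 - 2 * B" and full: "\<And>k. \<omega> k \<in> full \<beta> j"
  shows "B\<^sup>2 \<le> orb \<beta> (code_point B \<omega>) n"
proof -
  have B01: "0 < B" "B < 1"
    using \<beta> B by (auto simp: divide_less_eq_1)
  have step: "orb \<beta> (code_point B \<omega>) (j * k) = code_point B (\<lambda>i. \<omega> (i + k))" for k
  proof (induction k)
    case (Suc k)
    let ?x = "code_point B (\<lambda>i. \<omega> (i + k))" and ?x' = "code_point B (\<lambda>i. \<omega> (i + Suc k))"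
    have x: "?x = \<omega> k + B * ?x'"
      using code_point_Suc[OF B01, of "\<lambda>i. \<omega> (i + k)"] \<omega> by simp
    have x': "0 \<le> ?x'" "?x' < 1"
      using \<omega> by (auto intro!: code_point_nonneg[OF B01] code_point_less_1[OF B01])
    then have "B * ?x' < B * 1"
      using B01 by (intro mult_strict_left_mono) auto
    then have "orb \<beta> ?x j = \<beta> ^ j * (?x - \<omega> k)"
      using full[of k] x x' B01 by (simp add: full_def B)
    also have "\<dots> = ?x'"
      unfolding x using \<beta> by (simp add: B)
    finally have "orb \<beta> (orb \<beta> (code_point B \<omega>) (j * k)) j = ?x'"
      unfolding Suc .
    moreover have "j * Suc k = j * k + j"
      by simp
    ultimately show ?case
      by (simp only: orb_add)
  qed simp
  define k i where "k = n div j" and "i = n mod j"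
  have n: "n = j * k + i" and i: "i < j"
    using B by (auto simp: k_def i_def)
  have "B \<le> \<omega> (Suc k)"
    by (rule \<omega>)
  also have "\<dots> \<le> code_point B (\<lambda>i. \<omega> (i + Suc k))"
    using code_point_ge[OF B01, of "\<lambda>i. \<omega> (i + Suc k)"] \<omega> by simp
  also have "\<dots> = orb \<beta> (orb \<beta> (code_point B \<omega>) n) (j - i)"
    unfolding step[symmetric] orb_add[symmetric] using i n by (simp add: add.commute)
  also have "\<dots> \<le> \<beta> ^ (j - i) * orb \<beta> (code_point B \<omega>) n"
    using code_point_nonneg[OF B01, of \<omega>] \<omega> by (intro orb_le_power[OF \<beta>] orb_nonneg) auto
  also have "\<dots> \<le> \<beta> ^ j * orb \<beta> (code_point B \<omega>) n"
    using \<beta> code_point_nonneg[OF B01, of \<omega>] \<omega>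
    by (intro mult_right_mono power_increasing orb_nonneg) auto
  finally have "B * B \<le> B * (\<beta> ^ j * orb \<beta> (code_point B \<omega>) n)"
    using B01 by (intro mult_left_mono) auto
  then show ?thesis
    using \<beta> by (simp add: B power2_eq_square)
qed

lemma floor_power_digits_agree:
  fixes y y' :: real and M :: nat
  assumes "M > 0" "0 \<le> y" "y < 1" "0 \<le> y'" "y' < 1"
    and "\<And>i. i < k \<Longrightarrow> \<lfloor>M ^ Suc i * y\<rfloor> mod int M = \<lfloor>M ^ Suc i * y'\<rfloor> mod int M"
  shows "\<lfloor>M ^ k * y\<rfloor> = \<lfloor>M ^ k * y'\<rfloor>"
  using assms(6)
proof (induction k)
  case 0
  have "\<lfloor>y\<rfloor> = 0" "\<lfloor>y'\<rfloor> = 0"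
    using assms by linarith+
  then show ?case by simp
next
  case (Suc k)
  have div: "\<lfloor>M ^ Suc k * w\<rfloor> div int M = \<lfloor>M ^ k * w\<rfloor>" for w :: real
    using floor_divide_real_eq_div[of "int M" "M ^ Suc k * w"] assms(1) by simp
  have "\<lfloor>M ^ Suc k * y\<rfloor> div int M = \<lfloor>M ^ Suc k * y'\<rfloor> div int M"
    unfolding div using Suc by simp
  then show ?case
    using Suc.prems[of k] by (metis div_mult_mod_eq lessI)
qed

text \<open>Shrinking a point \<open>x\<close> whose orbit stays above \<open>\<beta> ^ -N\<close> by the factor \<open>\<beta> ^ N\<close> puts \<open>N\<close>
  zeros in front of its expansion and makes it minimal on its orbit.\<close>

lemma shrunk_survivor_in_bifurcation_set:
  assumes \<beta>: "\<beta> > 1" and x: "0 < x" "x < 1" "\<And>n. 1 / \<beta> ^ N \<le> orb \<beta> x n"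
  shows "x / \<beta> ^ N \<in> bifurcation_set \<beta>"
proof -
  define t where "t = x / \<beta> ^ N"
  have t: "0 < t" "t < 1 / \<beta> ^ N" "\<beta> ^ N * t = x"
    using x \<beta> by (auto simp: t_def divide_strict_right_mono)
  have "1 / \<beta> ^ N \<le> 1"
    using \<beta> by simp
  have "t \<le> orb \<beta> t n" for n
  proof (cases "n \<le> N")
    case True
    have "\<beta> ^ n * t \<le> \<beta> ^ N * t"
      using True \<beta> t by (intro mult_right_mono power_increasing) auto
    then have "orb \<beta> t n = \<beta> ^ n * t"
      using t x by (intro orb_small[OF \<beta>]) auto
    moreover have "1 * t \<le> \<beta> ^ n * t"
      using \<beta> t by (intro mult_right_mono) auto
    ultimately show ?thesis by simp
  next
    case False
    then have "orb \<beta> t n = orb \<beta> (orb \<beta> t N) (n - N)"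
      by (simp flip: orb_add)
    also have "orb \<beta> t N = x"
      using t x orb_small[OF \<beta>, of t N] by simp
    finally show ?thesis
      using x(3)[of "n - N"] t by simp
  qed
  then show ?thesis
    using t \<open>1 / \<beta> ^ N \<le> 1\<close> by (simp add: mem_bifurcation_set[OF \<beta>] flip: t_def)
qed

text \<open>Given \<open>M \<ge> \<beta> ^ (s * j)\<close> full cylinders of order \<open>j\<close>, the base \<open>M\<close> digits of a number
  \<open>y\<close> select a point of the attractor. Its distances shrink by \<open>\<beta> ^ -j\<close> per digit while those of
  \<open>y\<close> shrink by \<open>1 / M\<close>, so that the inverse map is Hoelder continuous of exponent \<open>s\<close>.\<close>

lemma hausdorff_measure_bifurcation_set_near_0:
  assumes \<beta>: "\<beta> > 1" and s: "0 < s" "s < 1" and \<epsilon>: "\<epsilon> > 0"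
  shows "hausdorff_measure s (bifurcation_set \<beta> \<inter> {0<..<\<epsilon>}) \<noteq> 0"
proof -
  obtain j where j: "j \<ge> 1" "\<beta> powr (s * real j) + 3 \<le> real (card (full \<beta> j))"
    using many_full_cylinders[OF \<beta> s(2)] by blast
  define B where "B = 1 / \<beta> ^ j"
  have B: "0 < B" "B < 1"
    using \<beta> j(1) by (auto simp: B_def divide_less_eq_1)
  obtain N0 where N0: "1 / \<epsilon> < \<beta> ^ N0"
    using real_arch_pow[OF \<beta>] by blast
  define N where "N = N0 + 2 * j"
  have "1 / \<epsilon> < \<beta> ^ N"
    using less_le_trans[OF N0 power_increasing[of N0 N \<beta>]] \<beta> by (simp add: N_def)
  then have N\<epsilon>: "1 / \<beta> ^ N < \<epsilon>"
    using \<epsilon> \<beta> by (simp add: field_simps)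
  have NB: "1 / \<beta> ^ N \<le> B\<^sup>2"
  proof -
    have "\<beta> ^ (2 * j) \<le> \<beta> ^ N"
      using \<beta> by (intro power_increasing) (auto simp: N_def)
    then have "1 / \<beta> ^ N \<le> 1 / \<beta> ^ (2 * j)"
      using \<beta> by (simp add: frac_le)
    then show ?thesis
      by (simp add: B_def power_divide power_mult mult.commute)
  qed
  \<comment> \<open>Dropping the two extreme cylinders provides the margins needed for the codes.\<close>
  define A where "A = full \<beta> j - {0, Max (full \<beta> j)}"
  have fin: "finite (full \<beta> j)"
    by (rule finite_full[OF \<beta>])
  have A: "a \<in> full \<beta> j" "B \<le> a" "a \<le> 1 - 2 * B" if "a \<in> A" for a
  proof -
    show a: "a \<in> full \<beta> j"
      using that by (simp add: A_def)
    have "0 \<le> a"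
      using a unfolding full_def by blast
    then have "0 < a"
      using that by (auto simp: A_def less_le)
    then show "B \<le> a"
      using full_separated[OF \<beta> zero_in_full[OF \<beta>] a] by (simp add: B_def)
    have max: "Max (full \<beta> j) \<in> full \<beta> j"
      using fin a by (intro Max_in) auto
    then have "Max (full \<beta> j) + B \<le> 1"
      unfolding full_def B_def by blast
    moreover have "a < Max (full \<beta> j)"
      using that Max_ge[OF fin a] by (simp add: A_def less_le)
    then have "a + B \<le> Max (full \<beta> j)"
      using full_separated[OF \<beta> a max] by (simp add: B_def)
    ultimately show "a \<le> 1 - 2 * B"
      by simp
  qed
  define M where "M = card A"
  have "card (full \<beta> j) - card {0, Max (full \<beta> j)} \<le> card A"
    unfolding A_def by (rule diff_card_le_card_Diff) auto
  moreover have "card {0, Max (full \<beta> j)} \<le> 2"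
    by (simp add: card_insert_if)
  ultimately have "real (card (full \<beta> j)) \<le> real M + 2"
    by (simp add: M_def)
  then have M: "\<beta> powr (s * real j) \<le> real M"
    using j(2) by simp
  moreover have "1 < \<beta> powr (s * real j)"
    using \<beta> s j(1) by (intro gr_one_powr) auto
  ultimately have M1: "real M > 1"
    by simp
  have finA: "finite A"
    using fin by (simp add: A_def)
  obtain f where f: "bij_betw f {0..<M} A"
    using ex_bij_betw_nat_finite[OF finA] by (auto simp: M_def)
  \<comment> \<open>The base \<open>M\<close> digits of \<open>y\<close> select the full cylinders visited by \<open>g y\<close>.\<close>
  define dg where "dg y k = \<lfloor>real M ^ Suc k * y\<rfloor> mod int M" for y k
  define \<omega> where "\<omega> y k = f (nat (dg y k))" for y k
  have dg: "0 \<le> dg y k" "dg y k < int M" for y k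
    using M1 by (auto simp: dg_def)
  have \<omega>A: "\<omega> y k \<in> A" for y k
  proof -
    have "nat (dg y k) \<in> {0..<M}"
      using dg[of y k] by auto
    then show ?thesis
      using bij_betw_imp_surj_on[OF f] unfolding \<omega>_def by blast
  qed
  note \<omega> = A[OF \<omega>A]
  define g where "g y = code_point B (\<omega> y) / \<beta> ^ N" for y
  have gE: "g y \<in> bifurcation_set \<beta> \<inter> {0<..<\<epsilon>}" for y
  proof -
    define x where "x = code_point B (\<omega> y)"
    have x: "0 < x" "x < 1"
    proof -
      have "B \<le> \<omega> y 0" "\<omega> y 0 \<le> code_point B (\<omega> y)"
        using code_point_ge[OF B, of "\<omega> y"] \<omega>(2,3) by auto
      then show "0 < x"
        using B unfolding x_def by linarith
      show "x < 1"
        using code_point_less_1[OF B, of "\<omega> y"] \<omega>(2,3) unfolding x_def by blast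
    qed
    have "B\<^sup>2 \<le> orb \<beta> x n" for n
      unfolding x_def using \<omega> j by (intro orb_code_point[OF \<beta> B_def]) auto
    then have "g y \<in> bifurcation_set \<beta>"
      using NB x unfolding g_def x_def[symmetric]
      by (intro shrunk_survivor_in_bifurcation_set[OF \<beta>]) (auto intro: order_trans)
    moreover have "g y < 1 / \<beta> ^ N" "0 < g y"
      using x \<beta> by (auto simp: g_def x_def[symmetric] divide_strict_right_mono)
    ultimately show ?thesis
      using N\<epsilon> by simp
  qed
  define D where "D = B\<^sup>2 / \<beta> ^ N"
  have D: "D > 0"
    using B \<beta> by (simp add: D_def)
  have expand: "\<bar>y - y'\<bar> \<le> D powr (- s) * \<bar>g y - g y'\<bar> powr s"
    if y: "0 \<le> y" "y < 1" "0 \<le> y'" "y' < 1" for y y'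
  proof (cases "y = y'")
    case False
    have close: "real M ^ k * \<bar>y - y'\<bar> < 1" if "\<And>i. i < k \<Longrightarrow> dg y i = dg y' i" for k
    proof -
      have "\<lfloor>real M ^ k * y\<rfloor> = \<lfloor>real M ^ k * y'\<rfloor>"
        using floor_power_digits_agree[of M y y' k] y that M1 by (simp add: dg_def)
      then have "\<bar>real M ^ k * y - real M ^ k * y'\<bar> < 1"
        by linarith
      then show ?thesis
        by (simp add: abs_mult flip: right_diff_distrib)
    qed
    have "\<exists>k. dg y k \<noteq> dg y' k"
    proof (rule ccontr)
      assume "\<nexists>k. dg y k \<noteq> dg y' k"
      then have "real M ^ k * \<bar>y - y'\<bar> < 1" for k
        using close by blast
      moreover obtain k where "1 / \<bar>y - y'\<bar> < real M ^ k"
        using real_arch_pow[OF M1] by blast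
      then have "1 < real M ^ k * \<bar>y - y'\<bar>"
        using False by (simp add: field_simps)
      ultimately show False
        by (meson less_asym)
    qed
    define k where "k = (LEAST k. dg y k \<noteq> dg y' k)"
    have k: "dg y k \<noteq> dg y' k" "\<And>i. i < k \<Longrightarrow> dg y i = dg y' i"
      unfolding k_def using LeastI_ex[OF \<open>\<exists>k. _\<close>] not_less_Least by blast+
    have "\<omega> y k \<noteq> \<omega> y' k"
    proof
      assume "\<omega> y k = \<omega> y' k"
      then have "nat (dg y k) = nat (dg y' k)"
        using f dg[of y k] dg[of y' k] unfolding \<omega>_def bij_betw_def
        by (auto dest!: inj_onD)
      then show False
        using k(1) dg(1)[of y k] dg(1)[of y' k] by simp
    qed
    then have sep: "\<omega> y k + B \<le> \<omega> y' k \<or> \<omega> y' k + B \<le> \<omega> y k"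
      using full_separated[OF \<beta> \<omega>(1) \<omega>(1)] by (auto simp: B_def neq_iff)
    have agree: "\<omega> y i = \<omega> y' i" if "i < k" for i
      using k(2)[OF that] by (simp add: \<omega>_def)
    have "B ^ k * B\<^sup>2 \<le> \<bar>code_point B (\<omega> y) - code_point B (\<omega> y')\<bar>"
      using sep
    proof
      assume "\<omega> y k + B \<le> \<omega> y' k"
      then have "B ^ k * B\<^sup>2 \<le> code_point B (\<omega> y') - code_point B (\<omega> y)"
        using agree by (intro code_point_separated[OF B]) (auto simp: \<omega>)
      then show ?thesis by linarith
    next
      assume "\<omega> y' k + B \<le> \<omega> y k"
      then have "B ^ k * B\<^sup>2 \<le> code_point B (\<omega> y) - code_point B (\<omega> y')"
        using agree by (intro code_point_separated[OF B]) (auto simp: \<omega>)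
      then show ?thesis by linarith
    qed
    then have "B ^ k * D \<le> \<bar>g y - g y'\<bar>"
      using \<beta> by (simp add: g_def D_def divide_right_mono flip: diff_divide_distrib)
    then have "(B ^ k * D) powr s \<le> \<bar>g y - g y'\<bar> powr s"
      using s B D by (intro powr_mono2) auto
    then have "D powr (- s) * (B ^ k * D) powr s \<le> D powr (- s) * \<bar>g y - g y'\<bar> powr s"
      by (intro mult_left_mono) auto
    moreover have "D powr (- s) * (B ^ k * D) powr s = (B ^ k) powr s"
      using B D by (simp add: powr_mult powr_minus field_simps)
    moreover have "\<bar>y - y'\<bar> \<le> (B ^ k) powr s"
    proof -
      have "(B ^ k) powr s = (B powr s) ^ k"
        using B by (simp add: powr_powr mult.commute flip: powr_realpow)
      also have "B powr s = 1 / \<beta> powr (s * real j)"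
        using \<beta> by (simp add: B_def powr_divide powr_powr mult.commute flip: powr_realpow)
      finally have eq: "(B ^ k) powr s = 1 / (\<beta> powr (s * real j)) ^ k"
        by (simp add: power_divide)
      have "(\<beta> powr (s * real j)) ^ k * \<bar>y - y'\<bar> \<le> real M ^ k * \<bar>y - y'\<bar>"
        using M by (intro mult_right_mono power_mono) auto
      also have "\<dots> < 1"
        using close k(2) by blast
      finally show ?thesis
        unfolding eq using \<beta> by (simp add: field_simps)
    qed
    ultimately show ?thesis by simp
  qed simp
  show ?thesis
    by (rule hausdorff_measure_pos_of_expanding[OF s(1), of "D powr (- s)" g]) (use gE expand in auto)
qed

lemma uncountable_bifurcation_set_near_0:
  assumes "\<beta> > 1" "\<epsilon> > 0"
  shows "uncountable (bifurcation_set \<beta> \<inter> {0<..<\<epsilon>})"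
  using hausdorff_null_countable[of "bifurcation_set \<beta> \<inter> {0<..<\<epsilon>}" "1 / 2"]
    hausdorff_measure_bifurcation_set_near_0[of \<beta> "1 / 2" \<epsilon>] assms by auto

lemma hausdorff_dim_bifurcation_set:
  assumes \<beta>: "\<beta> > 1"
  shows "hausdorff_dim (bifurcation_set \<beta>) = 1"
proof (rule antisym)
  have sub: "bifurcation_set \<beta> \<subseteq> {0..1}"
    by (auto simp: bifurcation_set_def)
  have null: "hausdorff_measure s (bifurcation_set \<beta>) = 0" if s: "s > 1" for s
  proof (rule hausdorff_null_finite_cover)
    show "s > 0"
      using s by simp
    fix e :: real assume e: "e > 0"
    have "((\<lambda>n. 1 / real n) \<longlongrightarrow> 0) sequentially"
      by (rule lim_1_over_n)
    moreover have "((\<lambda>n. (1 / real n) powr (s - 1)) \<longlongrightarrow> 0) sequentially"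
      using tendsto_neg_powr[of "1 - s" real sequentially] s filterlim_real_sequentially
      by (simp add: powr_divide powr_minus_divide[symmetric])
    ultimately have "\<forall>\<^sub>F n in sequentially. 1 / real n < e \<and> (1 / real n) powr (s - 1) < e \<and> n > 0"
      using e by (intro eventually_conj order_tendstoD(2) eventually_gt_at_top) auto
    then obtain n where n: "1 / real n < e" "(1 / real n) powr (s - 1) < e" "n > 0"
      by (auto dest: eventually_happens)
    define d where "d = 1 / real n"
    define \<U> where "\<U> = (\<lambda>i. {real i * d..real (Suc i) * d}) ` {..<n}"
    have d: "d > 0" "d < e" "d powr (s - 1) < e" "real n * d = 1"
      using n by (auto simp: d_def)
    have "{0..1} \<subseteq> \<Union>\<U>"
    proof
      fix x :: real assume x: "x \<in> {0..1}"
      show "x \<in> \<Union>\<U>"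
      proof (cases "x = 1")
        case True
        have "x \<in> {real (n - 1) * d..real (Suc (n - 1)) * d}"
          using True d n(3) by (simp add: left_diff_distrib of_nat_diff)
        moreover have "{real (n - 1) * d..real (Suc (n - 1)) * d} \<in> \<U>"
          unfolding \<U>_def by (rule imageI) (use n(3) in simp)
        ultimately show ?thesis
          by blast
      next
        case False
        define i where "i = nat \<lfloor>real n * x\<rfloor>"
        have "real i \<le> real n * x" "real n * x < real i + 1"
          using x by (auto simp: i_def)
        moreover have "real n * x < real n"
          using False x n(3) by simp
        ultimately have "real i * d \<le> x" "x \<le> real (Suc i) * d" "real i < real n"
          using n(3) by (simp add: d_def field_simps, simp add: d_def field_simps, linarith)
        then have i: "real i * d \<le> x" "x \<le> real (Suc i) * d" "i < n"
          by simp_all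
        then show ?thesis
          unfolding \<U>_def by (intro UnionI[of "{real i * d..real (Suc i) * d}"]) auto
      qed
    qed
    then have "bifurcation_set \<beta> \<subseteq> \<Union>\<U>"
      using sub by blast
    moreover have "\<forall>u\<in>\<U>. bounded u \<and> diameter u \<le> d"
      using d(1) by (auto simp: \<U>_def diameter_closed_interval algebra_simps)
    moreover have "real (card \<U>) * d powr s \<le> e"
    proof -
      have "card \<U> \<le> n"
        unfolding \<U>_def using card_image_le[of "{..<n}"] by simp
      then have "real (card \<U>) * d powr s \<le> real n * d powr s"
        by (intro mult_right_mono) auto
      also have "real n * d powr s = real n * (d * d powr (s - 1))"
        using d(1) by (simp add: powr_diff)
      also have "\<dots> = d powr (s - 1)"
        using d(4) by (simp flip: mult.assoc)
      finally show ?thesis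
        using d(3) by simp
    qed
    ultimately show "\<exists>d \<U>. 0 < d \<and> d \<le> e \<and> finite \<U> \<and> bifurcation_set \<beta> \<subseteq> \<Union>\<U> \<and>
      (\<forall>u\<in>\<U>. bounded u \<and> diameter u \<le> d) \<and> real (card \<U>) * d powr s \<le> e"
      using d by (intro exI[of _ d] exI[of _ \<U>]) (auto simp: \<U>_def)
  qed
  show "hausdorff_dim (bifurcation_set \<beta>) \<le> 1"
  proof (rule ennreal_le_epsilon)
    fix e :: real assume e: "e > 0"
    have "hausdorff_dim (bifurcation_set \<beta>) \<le> ennreal (1 + e)"
      unfolding hausdorff_dim_def using null[of "1 + e"] e
      by (intro Inf_lower CollectI exI[of _ "1 + e"]) auto
    then show "hausdorff_dim (bifurcation_set \<beta>) \<le> 1 + ennreal e"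
      using e by simp
  qed
  show "1 \<le> hausdorff_dim (bifurcation_set \<beta>)"
    unfolding hausdorff_dim_def
  proof (rule Inf_greatest, safe)
    fix s :: real assume s: "0 \<le> s" and z: "hausdorff_measure s (bifurcation_set \<beta>) = 0"
    have E: "bifurcation_set \<beta> \<inter> {0<..<1} \<noteq> {}"
      using uncountable_bifurcation_set_near_0[OF \<beta> zero_less_one] by (metis countable_empty)
    have "\<not> s < 1"
    proof
      assume s1: "s < 1"
      show False
      proof (cases "s = 0")
        case True
        then show False
          using hausdorff_measure_0_eq_0_imp_empty z E by blast
      next
        case False
        then show False
          using hausdorff_null_subset[OF Int_lower1 z]
            hausdorff_measure_bifurcation_set_near_0[OF \<beta> _ s1 zero_less_one] s by simp
      qed
    qed
    then show "1 \<le> ennreal s"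
      by (simp add: not_less)
  qed
qed

section \<open>Null sets by contraction on nested cylinders\<close>

definition cyl :: "(nat \<Rightarrow> real \<Rightarrow> int) \<Rightarrow> real set \<Rightarrow> nat \<Rightarrow> real \<Rightarrow> real set" where
  "cyl dg D n x = {y \<in> D. \<forall>i<n. dg i y = dg i x}"

lemma cyl_refl: "x \<in> D \<Longrightarrow> x \<in> cyl dg D n x"
  by (simp add: cyl_def)

lemma cyl_eq: "y \<in> cyl dg D n x \<Longrightarrow> cyl dg D n y = cyl dg D n x"
  by (auto simp: cyl_def)

lemma cyl_antimono: "n \<le> m \<Longrightarrow> cyl dg D m x \<subseteq> cyl dg D n x"
  by (auto simp: cyl_def)

lemma countable_cylinders: "countable {cyl dg D n x |n x. Q n x}"
proof (rule countable_subset)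
  show "{cyl dg D n x |n x. Q n x} \<subseteq> (\<lambda>l. {y \<in> D. \<forall>i<length l. dg i y = l ! i}) ` (UNIV :: int list set)"
  proof
    fix P assume "P \<in> {cyl dg D n x |n x. Q n x}"
    then obtain n x where "P = cyl dg D n x" by auto
    then have "P = {y \<in> D. \<forall>i<length (map (\<lambda>i. dg i x) [0..<n]). dg i y = map (\<lambda>i. dg i x) [0..<n] ! i}"
      by (auto simp: cyl_def)
    then show "P \<in> (\<lambda>l. {y \<in> D. \<forall>i<length l. dg i y = l ! i}) ` (UNIV :: int list set)"
      by (rule image_eqI) simp
  qed
qed (rule countable_image, simp)

lemma cyl_measurable:
  assumes "\<And>i k. {y \<in> D. dg i y = k} \<in> sets M" "D \<in> sets M"
  shows "cyl dg D n x \<in> sets M"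
proof -
  have "cyl dg D n x = D \<inter> (\<Inter>i\<in>{..<n}. {y \<in> D. dg i y = dg i x})" if "n > 0"
    using that by (auto simp: cyl_def)
  moreover have "(\<Inter>i\<in>{..<n}. {y \<in> D. dg i y = dg i x}) \<in> sets M" if "n > 0"
    using that assms by (intro sets.finite_INT) auto
  moreover have "cyl dg D n x = D" if "n = 0"
    using that by (auto simp: cyl_def)
  ultimately show ?thesis
    using assms(2) by (cases "n = 0") auto
qed

lemma emeasure_Int_Union_le:
  assumes Q: "countable \<Q>" "disjoint \<Q>" "\<And>Q. Q \<in> \<Q> \<Longrightarrow> Q \<in> sets M" and X: "X \<in> sets M"
    and le: "\<And>Q. Q \<in> \<Q> \<Longrightarrow> emeasure M (X \<inter> Q) \<le> k * emeasure M Q"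
  shows "emeasure M (X \<inter> \<Union>\<Q>) \<le> k * emeasure M (\<Union>\<Q>)"
proof -
  have dj: "disjoint_family_on (\<lambda>Q. X \<inter> Q) \<Q>" "disjoint_family_on (\<lambda>Q. Q) \<Q>"
    using Q(2) by (auto simp: disjoint_family_on_def disjoint_def)
  have "emeasure M (X \<inter> \<Union>\<Q>) = emeasure M (\<Union>Q\<in>\<Q>. X \<inter> Q)"
    by (rule arg_cong[where f = "emeasure M"]) auto
  also have "\<dots> = (\<integral>\<^sup>+Q. emeasure M (X \<inter> Q) \<partial>count_space \<Q>)"
    using Q X dj by (intro emeasure_UN_countable) auto
  also have "\<dots> \<le> (\<integral>\<^sup>+Q. k * emeasure M Q \<partial>count_space \<Q>)"
    using le by (intro nn_integral_mono) auto
  also have "\<dots> = k * (\<integral>\<^sup>+Q. emeasure M Q \<partial>count_space \<Q>)"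
    by (rule nn_integral_cmult) auto
  also have "(\<integral>\<^sup>+Q. emeasure M Q \<partial>count_space \<Q>) = emeasure M (\<Union>Q\<in>\<Q>. Q)"
    using Q dj by (intro emeasure_UN_countable[symmetric]) auto
  finally show ?thesis by simp
qed

text \<open>Outside a hole that is itself a union of subcylinders, the cylinder splits into subcylinders,
  and summing the density bound over these only picks up the measure of the complement of the
  hole.\<close>

lemma density_improves:
  fixes s c :: real
  assumes sets: "\<And>m y. cyl dg D m y \<in> sets M" and X: "X \<in> sets M"
    and H: "H \<in> sets M" "H \<subseteq> cyl dg D n x" "X \<inter> H = {}"
    and fin: "emeasure M (cyl dg D n x) < \<infinity>"
    and c: "0 \<le> c" "c \<le> 1" "ennreal c * emeasure M (cyl dg D n x) \<le> emeasure M H"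
    and m: "n \<le> m" and sep: "\<And>y. y \<in> cyl dg D n x - H \<Longrightarrow> cyl dg D m y \<inter> H = {}"
    and s: "0 \<le> s" "\<And>y. y \<in> cyl dg D n x \<Longrightarrow>
              emeasure M (X \<inter> cyl dg D m y) \<le> ennreal s * emeasure M (cyl dg D m y)"
  shows "emeasure M (X \<inter> cyl dg D n x) \<le> ennreal (s * (1 - c)) * emeasure M (cyl dg D n x)"
proof -
  define P where "P = cyl dg D n x"
  define \<Q> where "\<Q> = {cyl dg D m y |m' y. y \<in> P - H \<and> m' = m}"
  have PD: "P \<subseteq> D"
    by (auto simp: P_def cyl_def)
  have sub: "cyl dg D m y \<subseteq> P - H" if "y \<in> P - H" for y
  proof -
    have "cyl dg D m y \<subseteq> cyl dg D n y"
      by (rule cyl_antimono[OF m])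
    also have "\<dots> = P"
      using that by (simp add: P_def cyl_eq)
    finally have "cyl dg D m y \<subseteq> P" .
    moreover have "cyl dg D m y \<inter> H = {}"
      using sep[of y] that by (simp add: P_def)
    ultimately show ?thesis
      by blast
  qed
  have U: "\<Union>\<Q> = P - H"
  proof
    show "\<Union>\<Q> \<subseteq> P - H"
      using sub by (auto simp: \<Q>_def)
    show "P - H \<subseteq> \<Union>\<Q>"
    proof
      fix y assume y: "y \<in> P - H"
      then have "y \<in> cyl dg D m y"
        using PD by (intro cyl_refl) auto
      moreover have "cyl dg D m y \<in> \<Q>"
        using y by (auto simp: \<Q>_def)
      ultimately show "y \<in> \<Union>\<Q>"
        by blast
    qed
  qed
  have "countable \<Q>"
    by (rule countable_subset[OF _ countable_cylinders[of dg D "\<lambda>_ _. True"]]) (auto simp: \<Q>_def)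
  moreover have "disjoint \<Q>"
    unfolding disjoint_def \<Q>_def by (auto simp: cyl_def)
  ultimately have "emeasure M (X \<inter> \<Union>\<Q>) \<le> ennreal s * emeasure M (\<Union>\<Q>)"
    using sets X s(2) by (intro emeasure_Int_Union_le) (auto simp: \<Q>_def P_def simp del: Int_iff)
  moreover have "X \<inter> P = X \<inter> (P - H)"
    using H(3) by auto
  ultimately have "emeasure M (X \<inter> P) \<le> ennreal s * emeasure M (P - H)"
    by (simp add: U)
  also have "\<dots> \<le> ennreal s * (ennreal (1 - c) * emeasure M P)"
  proof (rule mult_left_mono)
    have PM: "P \<in> fmeasurable M" "H \<in> fmeasurable M"
      using sets[of n x] fin H emeasure_mono[OF H(2) sets]
      by (auto simp: P_def fmeasurable_def intro: le_less_trans)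
    have "ennreal (c * measure M P) \<le> ennreal (measure M H)"
      using c PM by (simp add: emeasure_eq_measure2 P_def[symmetric] ennreal_mult')
    then have "c * measure M P \<le> measure M H"
      by (simp add: ennreal_le_iff)
    then have "measure M (P - H) \<le> (1 - c) * measure M P"
      using PM H(2) measurable_measure_Diff[OF PM(1) H(1)]
      by (simp add: P_def left_diff_distrib)
    moreover have "P - H \<in> fmeasurable M"
      using PM by auto
    ultimately show "emeasure M (P - H) \<le> ennreal (1 - c) * emeasure M P"
      using c PM by (simp add: emeasure_eq_measure2 ennreal_mult'[symmetric] ennreal_leI)
  qed simp
  also have "\<dots> = ennreal (s * (1 - c)) * emeasure M P"
    using s(1) c by (simp add: ennreal_mult' mult.assoc)
  finally show ?thesis
    by (simp add: P_def)
qed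

text \<open>Starting from the trivial density \<open>1\<close> and iterating the improvement drives the density to
  \<open>0\<close>.\<close>

lemma null_of_density_contraction:
  fixes q :: real
  assumes q: "0 \<le> q" "q < 1" and fin: "\<And>P. P \<in> \<P> \<Longrightarrow> emeasure M P < \<infinity>"
    and sets: "\<And>P. P \<in> \<P> \<Longrightarrow> P \<in> sets M"
    and step: "\<And>s P. 0 \<le> s \<Longrightarrow> (\<And>R. R \<in> \<P> \<Longrightarrow> emeasure M (X \<inter> R) \<le> ennreal s * emeasure M R)
                 \<Longrightarrow> P \<in> \<P> \<Longrightarrow> emeasure M (X \<inter> P) \<le> ennreal (s * q) * emeasure M P"
    and P: "P \<in> \<P>"
  shows "emeasure M (X \<inter> P) = 0"
proof -
  have le: "R \<in> \<P> \<Longrightarrow> emeasure M (X \<inter> R) \<le> ennreal (q ^ k) * emeasure M R" for k R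
  proof (induction k arbitrary: R)
    case 0
    then show ?case
      using sets by (auto intro!: emeasure_mono)
  next
    case (Suc k)
    show ?case
      using step[of "q ^ k", OF _ Suc.IH Suc.prems] q by (simp add: mult.commute)
  qed
  obtain p where p: "emeasure M P = ennreal p" "0 \<le> p"
    using fin[OF P] by (cases "emeasure M P") auto
  have "(\<lambda>k. ennreal (q ^ k * p)) \<longlonglongrightarrow> ennreal (0 * p)"
    using q by (intro tendsto_intros LIMSEQ_realpow_zero) auto
  moreover have "emeasure M (X \<inter> P) \<le> ennreal (q ^ k * p)" for k
    using le[OF P, of k] p q by (simp add: ennreal_mult')
  ultimately have "emeasure M (X \<inter> P) \<le> ennreal (0 * p)"
    by (intro LIMSEQ_le_const) auto
  then show ?thesis by simp
qed

section \<open>The bifurcation set is a null set\<close>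

lemma small_iff_zero_digits:
  assumes \<beta>: "\<beta> > 1" and x: "0 \<le> x" "x < 1"
  shows "\<beta> ^ m * x < 1 \<longleftrightarrow> (\<forall>i<m. digit \<beta> x i = 0)"
proof
  assume small: "\<beta> ^ m * x < 1"
  show "\<forall>i<m. digit \<beta> x i = 0"
  proof (intro allI impI)
    fix i assume i: "i < m"
    have "\<beta> ^ Suc i * x \<le> \<beta> ^ m * x" "\<beta> ^ i * x \<le> \<beta> ^ m * x"
      using i \<beta> x by (intro mult_right_mono power_increasing; simp)+
    then have "orb \<beta> x i = \<beta> ^ i * x" "\<beta> ^ Suc i * x < 1"
      using orb_small[OF \<beta> x(1), of i] small by auto
    then show "digit \<beta> x i = 0"
      using \<beta> x unfolding digit_def by (intro floor_unique) (auto simp: mult.assoc)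
  qed
next
  assume zero: "\<forall>i<m. digit \<beta> x i = 0"
  have "i \<le> m \<Longrightarrow> orb \<beta> x i = \<beta> ^ i * x" for i
    by (induction i) (use zero in \<open>auto simp: orb_Suc\<close>)
  then show "\<beta> ^ m * x < 1"
    using orb_bounds(2)[of m x \<beta>] x by (metis le_refl)
qed

lemma orb_measurable [measurable]: "(\<lambda>x. orb \<beta> x n) \<in> borel_measurable borel"
  by (induction n) (auto simp: orb_Suc digit_def)

lemma param_orb_measurable [measurable]: "(\<lambda>\<beta>. orb \<beta> 1 n) \<in> borel_measurable borel"
  by (induction n) (auto simp: orb_Suc digit_def)

lemma digit_eq_iff_real: "digit \<beta> x i = k \<longleftrightarrow> real_of_int \<lfloor>\<beta> * orb \<beta> x i\<rfloor> = real_of_int k"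
  by (simp add: digit_def)

text \<open>In every cylinder the branch starts at \<open>0\<close>, so that the part of the cylinder that is mapped
  below \<open>\<beta> ^ -M\<close> occupies at least the fraction \<open>\<beta> ^ -M\<close> of it.\<close>

lemma null_survivors:
  assumes \<beta>: "\<beta> > 1"
  shows "{x \<in> {0..<1}. \<forall>n. 1 \<le> \<beta> ^ M * orb \<beta> x n} \<in> null_sets lebesgue"
proof -
  define X where "X = {x \<in> {0..<1}. \<forall>n. 1 \<le> \<beta> ^ M * orb \<beta> x n}"
  define dg where "dg i y = digit \<beta> y i" for i y
  define C where "C = cyl dg {0..<1}"
  have Xb: "X \<in> sets borel"
    unfolding X_def by measurable
  have dg_b: "{y \<in> {0..<1}. dg i y = k} \<in> sets borel" for i k
    unfolding dg_def digit_eq_iff_real by measurable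
  have Cb: "C n x \<in> sets borel" for n x
    unfolding C_def by (intro cyl_measurable dg_b) auto
  define \<P> where "\<P> = {C n x |n x. x \<in> {0..<1}}"
  have C_sub: "C n x \<subseteq> {0..<1}" for n x
    by (auto simp: C_def cyl_def)
  have fin: "emeasure lebesgue (C n x) < \<infinity>" for n x
    using emeasure_mono[OF C_sub, of lebesgue n x] by (auto intro: le_less_trans)
  have "emeasure lebesgue (X \<inter> P) = 0" if "P \<in> \<P>" for P
  proof (rule null_of_density_contraction[where \<P> = \<P> and q = "1 - 1 / \<beta> ^ M"])
    show "0 \<le> 1 - 1 / \<beta> ^ M" "1 - 1 / \<beta> ^ M < 1"
      using \<beta> by auto
    show "P \<in> \<P>" by fact
    show "emeasure lebesgue R < \<infinity>" "R \<in> sets lebesgue" if "R \<in> \<P>" for R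
      using that fin Cb by (auto simp: \<P>_def)
  next
    fix s :: real and P
    assume s: "0 \<le> s" "\<And>R. R \<in> \<P> \<Longrightarrow> emeasure lebesgue (X \<inter> R) \<le> ennreal s * emeasure lebesgue R"
      and P: "P \<in> \<P>"
    obtain n x where x: "x \<in> {0..<1}" and P_eq: "P = C n x"
      using P by (auto simp: \<P>_def)
    define H where "H = {y \<in> C n x. \<beta> ^ M * orb \<beta> y n < 1}"
    have "emeasure lebesgue (X \<inter> C n x) \<le> ennreal (s * (1 - 1 / \<beta> ^ M)) * emeasure lebesgue (C n x)"
      unfolding C_def
    proof (rule density_improves[where H = H and m = "n + M"])
      show "cyl dg {0..<1} m y \<in> sets lebesgue" for m y
        using Cb by (simp add: C_def)
      have "H \<in> sets borel"
        using Cb[of n x, measurable] unfolding H_def by measurable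
      then show "H \<in> sets lebesgue" "X \<in> sets lebesgue"
        using Xb by auto
      show "H \<subseteq> cyl dg {0..<1} n x"
        by (auto simp: H_def C_def)
      show "X \<inter> H = {}"
        by (auto simp: X_def H_def not_le[symmetric])
      show "emeasure lebesgue (cyl dg {0..<1} n x) < \<infinity>"
        using fin by (simp add: C_def)
      show "0 \<le> 1 / \<beta> ^ M" "1 / \<beta> ^ M \<le> 1" "n \<le> n + M" "0 \<le> s"
        using \<beta> s by auto
      show "emeasure lebesgue (X \<inter> cyl dg {0..<1} (n + M) y)
              \<le> ennreal s * emeasure lebesgue (cyl dg {0..<1} (n + M) y)"
        if "y \<in> cyl dg {0..<1} n x" for y
        using that by (intro s(2)) (auto simp: \<P>_def C_def cyl_def)
      show "cyl dg {0..<1} (n + M) y \<inter> H = {}" if y: "y \<in> cyl dg {0..<1} n x - H" for y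
      proof (rule ccontr)
        assume "cyl dg {0..<1} (n + M) y \<inter> H \<noteq> {}"
        then obtain w where w: "w \<in> cyl dg {0..<1} (n + M) y" "w \<in> H"
          by blast
        have yw: "0 \<le> y" "y < 1" "0 \<le> w" "w < 1"
          using y w by (auto simp: cyl_def)
        then have orbs: "0 \<le> orb \<beta> y n" "orb \<beta> y n < 1" "0 \<le> orb \<beta> w n" "orb \<beta> w n < 1"
          by (simp_all add: orb_bounds)
        have "\<forall>i<M. digit \<beta> (orb \<beta> w n) i = 0"
          using w(2) small_iff_zero_digits[OF \<beta> orbs(3,4)] by (simp add: H_def)
        then have "\<forall>i<M. digit \<beta> (orb \<beta> y n) i = 0"
          using w(1) by (auto simp: cyl_def dg_def digit_add[symmetric])
        then have "y \<in> H"
          using y small_iff_zero_digits[OF \<beta> orbs(1,2)] by (simp add: H_def C_def)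
        then show False
          using y by blast
      qed
      \<comment> \<open>The left end point of the cylinder; the contraction \<open>\<phi>\<close> towards it maps into the hole.\<close>
      define y0 where "y0 = x - orb \<beta> x n / \<beta> ^ n"
      have \<beta>n: "\<beta> ^ l > 0" for l
        using \<beta> by simp
      have C_y0: "y0 = y - orb \<beta> y n / \<beta> ^ n" if "y \<in> C n x" for y
      proof -
        have "i \<le> n \<Longrightarrow> orb \<beta> y i - orb \<beta> x i = \<beta> ^ i * (y - x)" for i
        proof (induction i)
          case (Suc i)
          then have "digit \<beta> y i = digit \<beta> x i"
            using that by (auto simp: C_def cyl_def dg_def)
          then have "orb \<beta> y (Suc i) - orb \<beta> x (Suc i) = \<beta> * (orb \<beta> y i - orb \<beta> x i)"
            by (simp add: orb_Suc right_diff_distrib)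
          then show ?case
            using Suc by simp
        qed simp
        from this[of n] have "(orb \<beta> y n - orb \<beta> x n) / \<beta> ^ n = y - x"
          using \<beta> by simp
        then show ?thesis
          by (simp add: y0_def diff_divide_distrib)
      qed
      define \<phi> where "\<phi> y = (1 / \<beta> ^ M) * y + (1 - 1 / \<beta> ^ M) * y0" for y
      have "\<phi> ` C n x \<subseteq> H"
      proof
        fix z assume "z \<in> \<phi> ` C n x"
        then obtain y where y: "y \<in> C n x" "z = \<phi> y"
          by blast
        have y01: "0 \<le> y" "y < 1"
          using y by (auto simp: C_def cyl_def)
        have zy: "y - z = (1 - 1 / \<beta> ^ M) * (orb \<beta> y n / \<beta> ^ n)"
        proof -
          have "y - z = (1 - 1 / \<beta> ^ M) * (y - y0)"
            unfolding y(2) \<phi>_def by (simp add: algebra_simps diff_divide_distrib)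
          then show ?thesis
            using C_y0[OF y(1)] by simp
        qed
        have c: "0 \<le> 1 - 1 / \<beta> ^ M" "1 - 1 / \<beta> ^ M \<le> 1"
          using \<beta> by auto
        have r: "orb \<beta> y n / \<beta> ^ n \<ge> 0"
          using orb_nonneg[OF y01(1), of \<beta> n] \<beta>n[of n] by simp
        have zy2: "0 \<le> y - z" "y - z \<le> orb \<beta> y n / \<beta> ^ n"
          unfolding zy using mult_nonneg_nonneg[OF c(1) r] mult_left_le_one_le[OF r c] by blast+
        have bd: "0 \<le> orb \<beta> y i + \<beta> ^ i * (z - y)" if "i \<le> n" for i
        proof -
          have "orb \<beta> y n \<le> \<beta> ^ (n - i) * orb \<beta> y i"
            using orb_le_power[OF \<beta> orb_nonneg[OF y01(1)], of \<beta> i "n - i"] that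
            by (simp flip: orb_add)
          then have "orb \<beta> y n / \<beta> ^ n \<le> \<beta> ^ (n - i) * orb \<beta> y i / \<beta> ^ n"
            using \<beta>n[of n] by (simp add: divide_right_mono)
          also have "\<dots> = orb \<beta> y i / \<beta> ^ i"
            using \<beta> that by (simp add: power_diff field_simps)
          finally have "y - z \<le> orb \<beta> y i / \<beta> ^ i"
            using zy2(2) by simp
          then have "\<beta> ^ i * (y - z) \<le> orb \<beta> y i"
            using \<beta>n[of i] by (simp add: pos_le_divide_eq mult.commute)
          then show ?thesis
            by (simp add: algebra_simps)
        qed
        have z01: "0 \<le> z" "z < 1"
          using bd[of 0] zy2(1) y01 by auto
        have orb_z: "orb \<beta> z i = orb \<beta> y i + \<beta> ^ i * (z - y)" if "i \<le> n" for i
        proof (rule orb_affine)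
          fix l assume l: "1 \<le> l" "l \<le> i"
          have "\<beta> ^ l * (z - y) \<le> 0"
            using zy2(1) \<beta>n[of l] by (simp add: mult_nonneg_nonpos)
          then show "0 \<le> orb \<beta> y l + \<beta> ^ l * (z - y) \<and> orb \<beta> y l + \<beta> ^ l * (z - y) < 1"
            using bd[of l] l that orb_bounds(2)[of l y \<beta>] by auto
        qed
        have "digit \<beta> z i = digit \<beta> y i" if "i < n" for i
        proof -
          have "of_int (digit \<beta> z i) = (of_int (digit \<beta> y i) :: real)"
            using orb_z[of "Suc i"] orb_z[of i] that orb_Suc[of \<beta> z i] orb_Suc[of \<beta> y i]
            by (simp add: algebra_simps)
          then show ?thesis by simp
        qed
        then have "z \<in> C n x"
          using y(1) z01 by (auto simp: C_def cyl_def dg_def)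
        moreover have "\<beta> ^ M * orb \<beta> z n < 1"
        proof -
          have "\<beta> ^ n * (y - z) = (1 - 1 / \<beta> ^ M) * orb \<beta> y n"
            unfolding zy using \<beta> by simp
          then have "orb \<beta> z n = orb \<beta> y n / \<beta> ^ M"
            using orb_z[of n] by (simp add: algebra_simps)
          then show ?thesis
            using orb_bounds(2)[of n y \<beta>] y01 \<beta>n[of M] by simp
        qed
        ultimately show "z \<in> H"
          by (simp add: H_def)
      qed
      then have "emeasure lebesgue (\<phi> ` C n x) \<le> emeasure lebesgue H"
        using \<open>H \<in> sets lebesgue\<close> by (rule emeasure_mono)
      moreover have "emeasure lebesgue (\<phi> ` C n x) = ennreal (1 / \<beta> ^ M) * emeasure lebesgue (C n x)"
        using emeasure_lebesgue_affine[of "1 / \<beta> ^ M" "(1 - 1 / \<beta> ^ M) * y0" "C n x"] \<beta>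
        by (simp add: \<phi>_def[abs_def])
      ultimately show "ennreal (1 / \<beta> ^ M) * emeasure lebesgue (cyl dg {0..<1} n x) \<le> emeasure lebesgue H"
        by (simp add: C_def)
    qed
    then show "emeasure lebesgue (X \<inter> P) \<le> ennreal (s * (1 - 1 / \<beta> ^ M)) * emeasure lebesgue P"
      by (simp add: P_eq)
  qed
  moreover have "C 0 0 \<in> \<P>"
    unfolding \<P>_def by (rule CollectI, rule exI[of _ 0], rule exI[of _ 0]) simp
  moreover have "X \<inter> C 0 0 = X"
    by (auto simp: C_def cyl_def X_def)
  ultimately have "emeasure lebesgue X = 0"
    by metis
  then show ?thesis
    using Xb unfolding X_def[symmetric] by (intro null_setsI) auto
qed

lemma bifurcation_set_null:
  assumes \<beta>: "\<beta> > 1"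
  shows "bifurcation_set \<beta> \<in> null_sets lebesgue"
proof (rule null_sets_subset)
  let ?X = "\<lambda>M. {x \<in> {0..<1}. \<forall>n. 1 \<le> \<beta> ^ M * orb \<beta> x n}"
  show "{0} \<union> (\<Union>M. ?X M) \<in> null_sets lebesgue"
    using null_survivors[OF \<beta>] by (intro null_sets.Un null_sets_UN) auto
  have E: "bifurcation_set \<beta> = {t \<in> {0..<1}. \<forall>n. t \<le> orb \<beta> t n}"
    by (auto simp: mem_bifurcation_set[OF \<beta>])
  have "{t \<in> {0..<1}. \<forall>n. t \<le> orb \<beta> t n} \<in> sets borel"
    by measurable
  then show "bifurcation_set \<beta> \<in> sets lebesgue"
    unfolding E by auto
  show "bifurcation_set \<beta> \<subseteq> {0} \<union> (\<Union>M. ?X M)"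
  proof
    fix t assume t: "t \<in> bifurcation_set \<beta>"
    show "t \<in> {0} \<union> (\<Union>M. ?X M)"
    proof (cases "t = 0")
      case False
      then have t0: "t > 0"
        using t by (simp add: E)
      obtain M where "1 / t < \<beta> ^ M"
        using real_arch_pow[OF \<beta>] by blast
      then have "1 \<le> \<beta> ^ M * t"
        using t0 by (simp add: field_simps)
      also have "\<beta> ^ M * t \<le> \<beta> ^ M * orb \<beta> t n" for n
        using t \<beta> by (simp add: E)
      finally have "t \<in> ?X M"
        using t by (simp add: E)
      then show ?thesis by blast
    qed simp
  qed
qed

section \<open>Isolated points near zero for almost every base\<close>

text \<open>The cylinders in parameter space: bases with a common beginning of the expansion of \<open>1\<close>.
  On them \<open>orb \<beta> 1 n\<close> is an increasing polynomial in \<open>\<beta>\<close>. The base \<open>1\<close> is included since it is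
  the left end point of some of the cylinders.\<close>

abbreviation param_cyl :: "nat \<Rightarrow> real \<Rightarrow> real set" where
  "param_cyl \<equiv> cyl (\<lambda>i \<beta>. digit \<beta> 1 i) {1..}"

text \<open>Both growth estimates come from the recursion \<open>D (n + 1) = y' * D n + (y' - y) * orb y 1 n\<close>
  for the difference \<open>D\<close> of the two orbits of \<open>1\<close>.\<close>

lemma param_growth_lower:
  assumes y: "1 \<le> y" "y \<le> y'" and dg: "\<And>i. i < n \<Longrightarrow> digit y' 1 i = digit y 1 i" and n: "n \<ge> 1"
  shows "y ^ (n - 1) * (y' - y) \<le> orb y' 1 n - orb y 1 n"
  using n dg
proof (induction n rule: nat_induct_at_least)
  case base
  then have "digit y' 1 0 = digit y 1 0" by auto
  then show ?case by (simp add: orb_Suc)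
next
  case (Suc n)
  have IH: "y ^ (n - 1) * (y' - y) \<le> orb y' 1 n - orb y 1 n"
    using Suc by auto
  have "y ^ n * (y' - y) = y * (y ^ (n - 1) * (y' - y))"
    using Suc.hyps by (cases n) auto
  also have "\<dots> \<le> y * (orb y' 1 n - orb y 1 n)"
    using IH y by (intro mult_left_mono) auto
  also have "\<dots> \<le> y * (orb y' 1 n - orb y 1 n) + (y' - y) * orb y' 1 n"
    using y orb_nonneg[of 1 y' n] by simp
  also have "\<dots> = orb y' 1 (Suc n) - orb y 1 (Suc n)"
    using Suc.prems[of n] by (simp add: orb_Suc algebra_simps)
  finally show ?case by simp
qed

lemma param_growth_upper:
  assumes y: "1 \<le> y" "y \<le> y'" and dg: "\<And>i. i < n \<Longrightarrow> digit y' 1 i = digit y 1 i"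
  shows "(orb y' 1 n - orb y 1 n) * (y' - 1) \<le> (y' - y) * (y' ^ n - 1)"
  using dg
proof (induction n)
  case (Suc n)
  have IH: "(orb y' 1 n - orb y 1 n) * (y' - 1) \<le> (y' - y) * (y' ^ n - 1)"
    using Suc by auto
  have "orb y' 1 (Suc n) - orb y 1 (Suc n) = y' * (orb y' 1 n - orb y 1 n) + (y' - y) * orb y 1 n"
    using Suc.prems[of n] by (simp add: orb_Suc algebra_simps)
  also have "\<dots> \<le> y' * (orb y' 1 n - orb y 1 n) + (y' - y) * 1"
    using y orb_le_1[of 1 y n] by (intro add_left_mono mult_left_mono) auto
  finally have "(orb y' 1 (Suc n) - orb y 1 (Suc n)) * (y' - 1)
      \<le> (y' * (orb y' 1 n - orb y 1 n) + (y' - y) * 1) * (y' - 1)"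
    using y by (intro mult_right_mono) auto
  also have "\<dots> = y' * ((orb y' 1 n - orb y 1 n) * (y' - 1)) + (y' - y) * (y' - 1)"
    by (simp add: algebra_simps)
  also have "\<dots> \<le> y' * ((y' - y) * (y' ^ n - 1)) + (y' - y) * (y' - 1)"
    using IH y by (intro add_right_mono mult_left_mono) auto
  also have "\<dots> = (y' - y) * (y' ^ Suc n - 1)"
    by (simp add: algebra_simps)
  finally show ?case .
qed simp

lemma param_orb_mono:
  assumes "1 \<le> y" "y \<le> y'" "\<And>i. i < n \<Longrightarrow> digit y' 1 i = digit y 1 i"
  shows "orb y 1 n \<le> orb y' 1 n"
proof (cases "n = 0")
  case False
  have "0 \<le> y ^ (n - 1) * (y' - y)"
    using assms by simp
  also have "\<dots> \<le> orb y' 1 n - orb y 1 n"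
    using assms False by (intro param_growth_lower) auto
  finally show ?thesis by simp
qed simp

text \<open>A new digit begins where \<open>y * orb y 1 n\<close> passes an integer, and there the next iterate is \<open>0\<close>;
  such a base exists to the left of \<open>x\<close> by the intermediate value theorem.\<close>

lemma param_cyl_left_end_exists:
  assumes x: "1 \<le> x" and n: "n \<ge> 1"
  shows "\<exists>b. 1 \<le> b \<and> b \<le> x \<and> orb b 1 n = 0 \<and>
           (\<forall>y. b \<le> y \<longrightarrow> y \<le> x \<longrightarrow> (\<forall>i<n. digit y 1 i = digit x 1 i))"
  using n
proof (induction n rule: nat_induct_at_least)
  case base
  show ?case
  proof (intro exI conjI allI impI)
    show "1 \<le> real_of_int \<lfloor>x\<rfloor>" "real_of_int \<lfloor>x\<rfloor> \<le> x"
      using x by auto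
    show "orb (real_of_int \<lfloor>x\<rfloor>) 1 1 = 0"
      by (simp add: orb_Suc digit_def)
    fix y and i :: nat assume "real_of_int \<lfloor>x\<rfloor> \<le> y" "y \<le> x" "i < 1"
    then show "digit y 1 i = digit x 1 i"
      by (simp add: digit_def) linarith
  qed
next
  case (Suc n)
  then obtain b where b: "1 \<le> b" "b \<le> x" "orb b 1 n = 0"
    and dg: "\<And>y i. b \<le> y \<Longrightarrow> y \<le> x \<Longrightarrow> i < n \<Longrightarrow> digit y 1 i = digit x 1 i"
    by blast
  have cont: "i \<le> n \<Longrightarrow> continuous_on {b..x} (\<lambda>y. orb y 1 i)" for i
  proof (induction i)
    case (Suc i)
    have "continuous_on {b..x} (\<lambda>y. y * orb y 1 i - of_int (digit x 1 i))"
      using Suc by (intro continuous_intros) auto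
    then show ?case
    proof (rule continuous_on_eq)
      fix y assume "y \<in> {b..x}"
      then show "y * orb y 1 i - of_int (digit x 1 i) = orb y 1 (Suc i)"
        using Suc.prems dg[of y i] by (simp add: orb_Suc)
    qed
  qed simp
  let ?k = "of_int (digit x 1 n) :: real"
  have "0 \<le> ?k"
    using x orb_nonneg[of 1 x n] by (simp add: digit_def)
  moreover have "?k \<le> x * orb x 1 n"
    by (simp add: digit_def)
  moreover have "continuous_on {b..x} (\<lambda>y. y * orb y 1 n)"
    by (intro continuous_intros cont) simp
  ultimately obtain b' where b': "b \<le> b'" "b' \<le> x" "b' * orb b' 1 n = ?k"
    using IVT'[of "\<lambda>y. y * orb y 1 n" b ?k x] b by auto
  have dn: "digit y 1 n = digit x 1 n" if y: "b' \<le> y" "y \<le> x" for y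
  proof -
    have same: "digit y 1 i = digit b' 1 i" "digit x 1 i = digit y 1 i" if "i < n" for i
      using dg[of y i] dg[of b' i] y b'(1,2) that by simp_all
    have "orb b' 1 n \<le> orb y 1 n"
      using y b(1) b'(1) same(1) by (intro param_orb_mono) simp_all
    then have "b' * orb b' 1 n \<le> y * orb y 1 n"
      using y b(1) b'(1) by (intro mult_mono orb_nonneg) simp_all
    moreover have "orb y 1 n \<le> orb x 1 n"
      using y b(1) b'(1) same(2) by (intro param_orb_mono) simp_all
    then have "y * orb y 1 n \<le> x * orb x 1 n"
      using y b(1) b'(1) by (intro mult_mono orb_nonneg) simp_all
    moreover have "x * orb x 1 n < ?k + 1"
      by (simp add: digit_def)
    ultimately show ?thesis
      unfolding digit_def[of y] using b'(3) by (intro floor_unique) auto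
  qed
  show ?case
  proof (intro exI conjI allI impI)
    show "1 \<le> b'" "b' \<le> x"
      using b b' by auto
    show "orb b' 1 (Suc n) = 0"
      using dn[of b'] b' by (simp add: orb_Suc)
    fix y i assume "b' \<le> y" "y \<le> x" "i < Suc n"
    then show "digit y 1 i = digit x 1 i"
      using dn[of y] dg[of y i] b'(1) by (cases "i = n") auto
  qed
qed

lemma param_cyl_left_end:
  assumes x: "1 \<le> x" and n: "n \<ge> 1"
  shows "\<exists>b. b \<in> param_cyl n x \<and> orb b 1 n = 0 \<and>
    (\<forall>y z. y \<in> param_cyl n x \<longrightarrow> b \<le> y \<and> (b \<le> z \<longrightarrow> z \<le> y \<longrightarrow> z \<in> param_cyl n x))"
proof -
  obtain b where b: "1 \<le> b" "b \<le> x" "orb b 1 n = 0"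
    "\<And>y i. b \<le> y \<Longrightarrow> y \<le> x \<Longrightarrow> i < n \<Longrightarrow> digit y 1 i = digit x 1 i"
    using param_cyl_left_end_exists[OF assms] by blast
  have bP: "b \<in> param_cyl n x"
    using b(1,2) b(4)[of b] by (simp add: cyl_def)
  have zero: "w = b" if w: "w \<in> param_cyl n x" "orb w 1 n = 0" for w
  proof (rule ccontr)
    assume "w \<noteq> b"
    have less: "orb u 1 n < orb v 1 n" if "u \<in> param_cyl n x" "v \<in> param_cyl n x" "u < v" for u v
    proof -
      have "0 < u ^ (n - 1) * (v - u)"
        using that by (simp add: cyl_def)
      also have "\<dots> \<le> orb v 1 n - orb u 1 n"
        using that n by (intro param_growth_lower) (simp_all add: cyl_def)
      finally show ?thesis by simp
    qed
    show False
      using less[OF w(1) bP] less[OF bP w(1)] w(2) b(3) \<open>w \<noteq> b\<close> by linarith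
  qed
  have "b \<le> y \<and> (b \<le> z \<longrightarrow> z \<le> y \<longrightarrow> z \<in> param_cyl n x)" if y: "y \<in> param_cyl n x" for y z
  proof -
    have "1 \<le> y"
      using y by (simp add: cyl_def)
    then obtain b' where b': "1 \<le> b'" "b' \<le> y" "orb b' 1 n = 0"
      "\<And>z i. b' \<le> z \<Longrightarrow> z \<le> y \<Longrightarrow> i < n \<Longrightarrow> digit z 1 i = digit y 1 i"
      using param_cyl_left_end_exists[OF _ n] by blast
    have mem: "w \<in> param_cyl n x" if "b' \<le> w" "w \<le> y" for w
      using b'(1) b'(4)[of w] that y by (simp add: cyl_def)
    have "b' \<in> param_cyl n x"
      using mem[of b'] b'(2) by simp
    then have "b' = b"
      using zero b'(3) by blast
    then show ?thesis
      using b'(2) mem by blast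
  qed
  then show ?thesis
    using bP b(3) by blast
qed

lemma param_cyl_measurable: "param_cyl n x \<in> sets borel"
  by (intro cyl_measurable) (auto simp: digit_eq_iff_real)

text \<open>In parameter space the branches are only almost affine. Their distortion is bounded as long
  as the bases stay away from \<open>1\<close>, because \<open>(1 + b ^ -n) ^ n\<close> is bounded.\<close>

lemma hole_fraction_param_cyl:
  assumes b: "b > 1"
  shows "\<exists>\<kappa>. 0 < \<kappa> \<and> \<kappa> \<le> 1 \<and> (\<forall>n x. n \<ge> 1 \<longrightarrow> x \<ge> 1 \<longrightarrow> param_cyl n x \<subseteq> {b..c} \<longrightarrow>
           ennreal \<kappa> * emeasure lebesgue (param_cyl n x)
             \<le> emeasure lebesgue {y \<in> param_cyl n x. y ^ M * orb y 1 n < 1})"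
proof -
  define C where "C = exp (1 / (b - 1))"
  define c' where "c' = max b c"
  define \<kappa> where "\<kappa> = min 1 ((b - 1) / (2 * C * c' ^ Suc M))"
  have c': "c' > 1" "c \<le> c'" and C: "C > 0"
    using b by (auto simp: c'_def C_def)
  have \<kappa>: "0 < \<kappa>" "\<kappa> \<le> 1" "\<kappa> * (C * c' ^ Suc M) < b - 1"
  proof -
    have CM: "C * c' ^ Suc M > 0"
      using C c' by simp
    show "0 < \<kappa>" "\<kappa> \<le> 1"
      using b C c' by (auto simp: \<kappa>_def)
    have "\<kappa> * (C * c' ^ Suc M) \<le> (b - 1) / (2 * C * c' ^ Suc M) * (C * c' ^ Suc M)"
      using CM by (intro mult_right_mono) (auto simp: \<kappa>_def)
    also have "\<dots> = (b - 1) / 2"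
      using C c' by simp
    finally show "\<kappa> * (C * c' ^ Suc M) < b - 1"
      using b by simp
  qed
  have "ennreal \<kappa> * emeasure lebesgue (param_cyl n x)
             \<le> emeasure lebesgue {y \<in> param_cyl n x. y ^ M * orb y 1 n < 1}"
    if n: "n \<ge> 1" and x: "x \<ge> 1" and sub: "param_cyl n x \<subseteq> {b..c}" for n x
  proof -
    define P where "P = param_cyl n x"
    define H where "H = {y \<in> P. y ^ M * orb y 1 n < 1}"
    obtain p where p: "p \<in> P" "orb p 1 n = 0"
      "\<And>y z. y \<in> P \<Longrightarrow> p \<le> y \<and> (p \<le> z \<longrightarrow> z \<le> y \<longrightarrow> z \<in> P)"
      using param_cyl_left_end[OF x n] unfolding P_def[symmetric] by blast
    have bc: "b \<le> y" "y \<le> c'" if "y \<in> P" for y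
      using sub that c' by (auto simp: P_def)
    have same: "digit y 1 i = digit z 1 i" if "y \<in> P" "z \<in> P" "i < n" for y z i
      using that by (auto simp: P_def cyl_def)
    define \<phi> where "\<phi> y = \<kappa> * y + (1 - \<kappa>) * p" for y
    have "\<phi> ` P \<subseteq> H"
    proof
      fix z assume "z \<in> \<phi> ` P"
      then obtain y where y: "y \<in> P" and z_eq: "z = \<phi> y" by blast
      have py: "p \<le> y"
        using p(3)[OF y] by blast
      have zp: "z - p = \<kappa> * (y - p)"
        by (simp add: z_eq \<phi>_def algebra_simps)
      have z: "p \<le> z" "z \<le> y"
      proof -
        have "0 \<le> \<kappa> * (y - p)" "\<kappa> * (y - p) \<le> y - p"
          using \<kappa> py by (auto intro!: mult_left_le_one_le)
        then show "p \<le> z" "z \<le> y"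
          using zp by auto
      qed
      then have zP: "z \<in> P"
        using p(3)[OF y] by blast
      have p1: "p \<ge> 1" "p \<ge> b" "p > 0"
        using bc(1)[OF p(1)] b by auto
      have "p ^ (n - 1) * (y - p) \<le> orb y 1 n - orb p 1 n"
        using p1 py same[OF y p(1)] n by (intro param_growth_lower) auto
      also have "\<dots> \<le> 1"
        using p(2) orb_le_1[of 1 y n] by simp
      finally have yp: "p ^ (n - 1) * (y - p) \<le> 1" .
      then have "p * (p ^ (n - 1) * (y - p)) \<le> p * 1"
        using p1 by (intro mult_left_mono) auto
      moreover have "p * (p ^ (n - 1) * (y - p)) = p ^ n * (y - p)"
        using n by (cases n) auto
      ultimately have yp': "p ^ n * (y - p) \<le> p"
        by (metis mult.right_neutral)
      have "real n * (b - 1) \<le> p ^ n"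
      proof -
        have "1 + real n * (p - 1) \<le> (1 + (p - 1)) ^ n"
          using p1 by (intro Bernoulli_inequality) auto
        moreover have "real n * (b - 1) \<le> real n * (p - 1)"
          using p1 by (intro mult_left_mono) auto
        ultimately show ?thesis by simp
      qed
      then have nb: "real n * (1 / p ^ n) \<le> 1 / (b - 1)"
        using b p1 by (simp add: field_simps)
      have "z ^ n \<le> p ^ n * C"
      proof -
        have "y - p \<le> p * (1 / p ^ n)"
          using yp' p1 by (simp add: field_simps)
        then have "z \<le> p * (1 + 1 / p ^ n)"
          using z by (simp add: algebra_simps)
        also have "\<dots> \<le> p * exp (1 / p ^ n)"
          using p1 exp_ge_add_one_self[of "1 / p ^ n"] by (intro mult_left_mono) auto
        finally have "z ^ n \<le> (p * exp (1 / p ^ n)) ^ n"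
          using z p1 by (intro power_mono) auto
        also have "\<dots> = p ^ n * exp (real n * (1 / p ^ n))"
          by (simp add: power_mult_distrib exp_of_nat_mult[symmetric])
        also have "\<dots> \<le> p ^ n * C"
          unfolding C_def using nb p1 by (intro mult_left_mono) auto
        finally show ?thesis .
      qed
      then have "(z - p) * z ^ n \<le> (z - p) * (p ^ n * C)"
        using z by (intro mult_left_mono) auto
      also have "\<dots> = \<kappa> * C * (p ^ n * (y - p))"
        by (simp add: zp)
      also have "\<dots> \<le> \<kappa> * C * c'"
        using yp' bc(2)[OF p(1)] \<kappa> C by (intro mult_left_mono) auto
      finally have num: "(z - p) * z ^ n \<le> \<kappa> * C * c'" .
      have "orb z 1 n * (b - 1) \<le> orb z 1 n * (z - 1)"
        using bc(1)[OF zP] orb_nonneg[of 1 z n] by (intro mult_left_mono) auto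
      also have "\<dots> \<le> (z - p) * (z ^ n - 1)"
        using param_growth_upper[of p z n] p1 z same[OF zP p(1)] p(2) by simp
      also have "\<dots> \<le> (z - p) * z ^ n"
        using z by (intro mult_left_mono) auto
      finally have small: "orb z 1 n * (b - 1) \<le> \<kappa> * C * c'"
        using num by simp
      have "z ^ M * orb z 1 n * (b - 1) \<le> c' ^ M * (orb z 1 n * (b - 1))"
        using bc[OF zP] b orb_nonneg[of 1 z n]
        by (simp only: mult.assoc, intro mult_right_mono power_mono) auto
      also have "\<dots> \<le> c' ^ M * (\<kappa> * C * c')"
        using small c' by (intro mult_left_mono) auto
      also have "\<dots> < 1 * (b - 1)"
        using \<kappa>(3) by (simp add: algebra_simps)
      finally have "z ^ M * orb z 1 n < 1"
        using b by (simp add: mult_less_cancel_right)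
      then show "z \<in> H"
        using zP by (simp add: H_def)
    qed
    moreover have "H \<in> sets borel"
      using param_cyl_measurable[of n x, measurable] unfolding H_def P_def by measurable
    ultimately have "emeasure lebesgue (\<phi> ` P) \<le> emeasure lebesgue H"
      by (intro emeasure_mono) auto
    moreover have "emeasure lebesgue (\<phi> ` P) = ennreal \<kappa> * emeasure lebesgue P"
      using emeasure_lebesgue_affine[of \<kappa> "(1 - \<kappa>) * p" P] \<kappa> by (simp add: \<phi>_def[abs_def])
    ultimately show ?thesis
      by (simp add: H_def P_def)
  qed
  then show ?thesis
    using \<kappa> by blast
qed

definition window :: "real \<Rightarrow> real \<Rightarrow> real set set" where
  "window b c = {param_cyl n x |n x. n \<ge> 1 \<and> x \<ge> 1 \<and> param_cyl n x \<subseteq> {b..c}}"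

lemma window_finite_measure:
  assumes "P \<in> window b c"
  shows "P \<in> sets lebesgue" "emeasure lebesgue P < \<infinity>"
proof -
  show P: "P \<in> sets lebesgue"
    using assms param_cyl_measurable by (auto simp: window_def)
  have "emeasure lebesgue P \<le> emeasure lebesgue {b..c}"
    using assms by (intro emeasure_mono) (auto simp: window_def)
  then show "emeasure lebesgue P < \<infinity>"
    by (rule le_less_trans) (simp add: emeasure_lborel_Icc_eq)
qed

lemma window_subcylinder:
  assumes "param_cyl n x \<in> window b c" "y \<in> param_cyl n x" "n \<le> m" "1 \<le> n"
  shows "param_cyl m y \<in> window b c"
proof -
  have "param_cyl m y \<subseteq> param_cyl n x"
    using cyl_antimono[OF assms(3)] cyl_eq[OF assms(2)] by blast
  moreover have "param_cyl n x \<subseteq> {b..c}"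
    using assms(1) by (auto simp: window_def)
  moreover have "y \<ge> 1"
    using assms(2) by (simp add: cyl_def)
  ultimately show ?thesis
    using assms(3,4) by (force simp: window_def)
qed

lemma small_window_cylinder:
  assumes "1 < b" "b < y" "y < c"
  shows "\<exists>n\<ge>1. param_cyl n y \<in> window b c"
proof -
  obtain k where k: "max (1 / (y - b)) (1 / (c - y)) < b ^ k"
    using real_arch_pow[OF assms(1)] by blast
  have "param_cyl (Suc k) y \<subseteq> {b..c}"
  proof
    fix z assume z: "z \<in> param_cyl (Suc k) y"
    have y1: "1 \<le> y" and k1: "Suc k \<ge> 1"
      using assms by simp_all
    define P where "P = param_cyl (Suc k) y"
    have yy: "y \<in> P"
      using y1 by (simp add: P_def cyl_def)
    obtain p where p: "p \<in> P" "\<And>w v. w \<in> P \<Longrightarrow> p \<le> w \<and> (p \<le> v \<longrightarrow> v \<le> w \<longrightarrow> v \<in> P)"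
      using param_cyl_left_end[OF y1 k1] unfolding P_def[symmetric] by blast
    have zP: "z \<in> P"
      using z by (simp add: P_def)
    have far: "u ^ k * (v - u) \<le> 1"
      if "u \<in> P" "v \<in> P" "u \<le> v" for u v
    proof -
      have "u ^ (Suc k - 1) * (v - u) \<le> orb v 1 (Suc k) - orb u 1 (Suc k)"
        using that by (intro param_growth_lower) (simp_all add: P_def cyl_def)
      then show ?thesis
        using orb_le_1[of 1 v "Suc k"] orb_nonneg[of 1 u "Suc k"] by simp
    qed
    have "b \<le> z"
    proof (rule ccontr)
      assume "\<not> b \<le> z"
      then have "b \<in> P"
        using p(2)[OF yy, of b] p(2)[OF zP] assms by auto
      then have "b ^ k * (y - b) \<le> 1"
        using far[OF _ yy, of b] assms by simp
      then show False
        using k assms by (auto simp: field_simps)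
    qed
    moreover have "z \<le> c"
    proof (rule ccontr)
      assume "\<not> z \<le> c"
      then have "y ^ k * (z - y) \<le> 1"
        using far[OF yy zP] assms by simp
      moreover have "b ^ k * (c - y) \<le> y ^ k * (z - y)"
        using assms \<open>\<not> z \<le> c\<close> by (intro mult_mono power_mono) auto
      ultimately show False
        using k assms by (auto simp: field_simps)
    qed
    ultimately show "z \<in> {b..c}" by simp
  qed
  then have "param_cyl (Suc k) y \<in> window b c"
    unfolding window_def using assms by (intro CollectI exI conjI refl) simp_all
  then show ?thesis
    by (intro exI[of _ "Suc k"]) simp
qed

lemma null_of_window_null:
  assumes b: "1 < b" and X: "X \<in> sets lebesgue"
    and null: "\<And>P. P \<in> window b c \<Longrightarrow> emeasure lebesgue (X \<inter> P) = 0"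
  shows "X \<inter> {b<..<c} \<in> null_sets lebesgue"
proof (rule null_sets_subset)
  have "countable (window b c)"
    unfolding window_def by (rule countable_cylinders)
  moreover have "X \<inter> P \<in> null_sets lebesgue" if "P \<in> window b c" for P
    using that null X window_finite_measure(1) by (intro null_setsI) auto
  ultimately show "(\<Union>P\<in>window b c. X \<inter> P) \<in> null_sets lebesgue"
    by (rule null_sets_UN')
  show "X \<inter> {b<..<c} \<in> sets lebesgue"
    using X by auto
  show "X \<inter> {b<..<c} \<subseteq> (\<Union>P\<in>window b c. X \<inter> P)"
  proof
    fix y assume y: "y \<in> X \<inter> {b<..<c}"
    then obtain n where "param_cyl n y \<in> window b c"
      using small_window_cylinder[OF b, of y c] by auto
    moreover have "y \<in> param_cyl n y"
      using y b by (intro cyl_refl) auto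
    ultimately show "y \<in> (\<Union>P\<in>window b c. X \<inter> P)"
      using y by blast
  qed
qed

lemma param_density_improves:
  assumes b: "1 < b" and \<kappa>: "0 < \<kappa>" "\<kappa> \<le> 1"
    "\<And>n x. n \<ge> 1 \<Longrightarrow> x \<ge> 1 \<Longrightarrow> param_cyl n x \<subseteq> {b..c} \<Longrightarrow>
       ennreal \<kappa> * emeasure lebesgue (param_cyl n x)
         \<le> emeasure lebesgue {y \<in> param_cyl n x. y ^ M * orb y 1 n < 1}"
    and P: "param_cyl n x \<in> window b c" "n \<ge> 1" "x \<ge> 1"
    and X: "X \<in> sets lebesgue" "\<And>y. y \<in> X \<Longrightarrow> y \<in> param_cyl n x \<Longrightarrow> 1 \<le> y ^ M * orb y 1 n"
    and s: "0 \<le> s" "\<And>R. R \<in> window b c \<Longrightarrow> emeasure lebesgue (X \<inter> R) \<le> ennreal s * emeasure lebesgue R"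
  shows "emeasure lebesgue (X \<inter> param_cyl n x)
           \<le> ennreal (s * (1 - \<kappa>)) * emeasure lebesgue (param_cyl n x)"
proof (rule density_improves)
  let ?H = "{y \<in> param_cyl n x. y ^ M * orb y 1 n < 1}"
  have sub: "param_cyl n x \<subseteq> {b..c}"
    using P(1) by (auto simp: window_def)
  show "param_cyl m y \<in> sets lebesgue" for m y
    using param_cyl_measurable by simp
  have "?H \<in> sets borel"
    using param_cyl_measurable[of n x, measurable] by measurable
  then show "?H \<in> sets lebesgue"
    by simp
  show "X \<inter> ?H = {}"
    using X(2) by (auto simp: not_le[symmetric])
  show "ennreal \<kappa> * emeasure lebesgue (param_cyl n x) \<le> emeasure lebesgue ?H"
    by (rule \<kappa>(3)[OF P(2,3) sub])
  show "emeasure lebesgue (param_cyl n x) < \<infinity>"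
    by (rule window_finite_measure(2)[OF P(1)])
  show "emeasure lebesgue (X \<inter> param_cyl (n + M) y) \<le> ennreal s * emeasure lebesgue (param_cyl (n + M) y)"
    if "y \<in> param_cyl n x" for y
    using window_subcylinder[OF P(1) that _ P(2)] by (intro s(2)) simp
  show "param_cyl (n + M) y \<inter> ?H = {}" if y: "y \<in> param_cyl n x - ?H" for y
  proof (rule ccontr)
    assume "param_cyl (n + M) y \<inter> ?H \<noteq> {}"
    then obtain w where w: "w \<in> param_cyl (n + M) y" "w \<in> ?H"
      by blast
    have yw: "1 < y" "1 < w"
      using y w sub b by auto
    have orbs: "0 \<le> orb y 1 n" "orb y 1 n < 1" "0 \<le> orb w 1 n" "orb w 1 n < 1"
      using P(2) by (simp_all add: orb_bounds)
    have "\<forall>i<M. digit w (orb w 1 n) i = 0"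
      using w(2) small_iff_zero_digits[OF yw(2) orbs(3,4)] by simp
    then have "\<forall>i<M. digit y (orb y 1 n) i = 0"
      using w(1) by (auto simp: cyl_def digit_add[symmetric])
    then have "y \<in> ?H"
      using y small_iff_zero_digits[OF yw(1) orbs(1,2)] by simp
    then show False
      using y by blast
  qed
qed (use \<kappa>(1,2) X(1) s(1) in auto)

lemma null_orbit_of_one_bounded_below:
  assumes b: "1 < b"
  shows "{y. \<forall>n\<ge>1. 1 \<le> y ^ M * orb y 1 n} \<inter> {b<..<c} \<in> null_sets lebesgue"
    and "P \<in> window b c \<Longrightarrow> emeasure lebesgue ({y. \<forall>n\<ge>1. 1 \<le> y ^ M * orb y 1 n} \<inter> P) = 0"
proof -
  define X where "X = {y. \<forall>n\<ge>1. 1 \<le> y ^ M * orb y 1 n}"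
  have "X \<in> sets borel"
    unfolding X_def by measurable
  then have X: "X \<in> sets lebesgue"
    by simp
  obtain \<kappa> where \<kappa>: "0 < \<kappa>" "\<kappa> \<le> 1" "\<And>n x. n \<ge> 1 \<Longrightarrow> x \<ge> 1 \<Longrightarrow> param_cyl n x \<subseteq> {b..c} \<Longrightarrow>
       ennreal \<kappa> * emeasure lebesgue (param_cyl n x)
         \<le> emeasure lebesgue {y \<in> param_cyl n x. y ^ M * orb y 1 n < 1}"
    using hole_fraction_param_cyl[OF b, of c M] by blast
  have null: "emeasure lebesgue (X \<inter> P) = 0" if "P \<in> window b c" for P
  proof (rule null_of_density_contraction[where \<P> = "window b c" and q = "1 - \<kappa>"])
    fix s P assume s: "0 \<le> s" "\<And>R. R \<in> window b c \<Longrightarrow>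
        emeasure lebesgue (X \<inter> R) \<le> ennreal s * emeasure lebesgue R"
      and P: "P \<in> window b c"
    obtain n x where nx: "n \<ge> 1" "x \<ge> 1" "P = param_cyl n x"
      using P by (auto simp: window_def)
    show "emeasure lebesgue (X \<inter> P) \<le> ennreal (s * (1 - \<kappa>)) * emeasure lebesgue P"
      unfolding nx(3)
      by (rule param_density_improves[OF b \<kappa> _ nx(1,2) X _ s]) (use P nx in \<open>auto simp: X_def\<close>)
  qed (use that \<kappa> window_finite_measure in auto)
  show "{y. \<forall>n\<ge>1. 1 \<le> y ^ M * orb y 1 n} \<inter> {b<..<c} \<in> null_sets lebesgue"
    using null_of_window_null[OF b X null] by (simp add: X_def)
  show "P \<in> window b c \<Longrightarrow> emeasure lebesgue ({y. \<forall>n\<ge>1. 1 \<le> y ^ M * orb y 1 n} \<inter> P) = 0"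
    by (rule null[unfolded X_def])
qed

text \<open>Since \<open>y ^ L * orb y 1 n < 1\<close> means that \<open>L\<close> zeros follow the first \<open>n\<close> digits of \<open>1\<close>, this
  is the event that the first run of \<open>L\<close> zeros continues for \<open>M\<close> more places.\<close>

definition long_first_run :: "nat \<Rightarrow> nat \<Rightarrow> real \<Rightarrow> bool" where
  "long_first_run M L y \<longleftrightarrow>
     (\<exists>n\<ge>1. y ^ (L + M) * orb y 1 n < 1 \<and> (\<forall>i. 1 \<le> i \<longrightarrow> i < n \<longrightarrow> 1 \<le> y ^ L * orb y 1 i))"

text \<open>Fix a cylinder of order \<open>N\<close> and a large \<open>L\<close>. Almost every base in it has a first run of \<open>L\<close>
  zeros. Unless the run begins before time \<open>N\<close>, which is unlikely, the base lies in the cylinder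
  that ends with this run, and there the run continues for \<open>M\<close> more places with a probability
  bounded from below.\<close>

lemma null_no_long_first_run:
  assumes b: "1 < b"
  shows "{y. \<forall>L\<ge>L0. \<not> long_first_run M L y} \<inter> {b<..<c} \<in> null_sets lebesgue"
proof -
  define X where "X = {y. \<forall>L\<ge>L0. \<not> long_first_run M L y}"
  have "X \<in> sets borel"
    unfolding X_def long_first_run_def by measurable
  then have X: "X \<in> sets lebesgue"
    by simp
  obtain \<kappa> where \<kappa>: "0 < \<kappa>" "\<kappa> \<le> 1" "\<And>n x. n \<ge> 1 \<Longrightarrow> x \<ge> 1 \<Longrightarrow> param_cyl n x \<subseteq> {b..c} \<Longrightarrow>
       ennreal \<kappa> * emeasure lebesgue (param_cyl n x)
         \<le> emeasure lebesgue {y \<in> param_cyl n x. y ^ M * orb y 1 n < 1}"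
    using hole_fraction_param_cyl[OF b, of c M] by blast
  have "emeasure lebesgue (X \<inter> P) = 0" if "P \<in> window b c" for P
  proof (rule null_of_density_contraction[where \<P> = "window b c" and q = "1 - \<kappa>"])
    fix s P assume s: "0 \<le> s" "\<And>R. R \<in> window b c \<Longrightarrow>
        emeasure lebesgue (X \<inter> R) \<le> ennreal s * emeasure lebesgue R"
      and P: "P \<in> window b c"
    obtain N x where N: "N \<ge> 1" "x \<ge> 1" "P = param_cyl N x"
      using P by (auto simp: window_def)
    have PM: "P \<in> sets lebesgue"
      using window_finite_measure(1)[OF P] .
    have P_bc: "P \<subseteq> {b..c}"
      using P by (auto simp: window_def)
    have y1: "1 < y" if "y \<in> P" for y
      using that P_bc b by auto
    obtain p where p: "p \<in> P" "orb p 1 N = 0" "\<And>y. y \<in> P \<Longrightarrow> p \<le> y"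
      using param_cyl_left_end[OF N(2,1)] unfolding N(3)[symmetric] by blast
    have bound: "emeasure lebesgue (X \<inter> P) \<le> ennreal ((1 / b) ^ k) + ennreal (s * (1 - \<kappa>)) * emeasure lebesgue P"
      if k: "L0 \<le> k" for k
    proof -
      \<comment> \<open>\<open>Z\<close>: there is no run of \<open>L\<close> zeros. \<open>A\<close>: it starts before time \<open>N\<close>. \<open>\<Q>\<close>: the cylinders that
        end with the first run.\<close>
      define L where "L = N + k"
      define Z where "Z = {y. \<forall>n\<ge>1. 1 \<le> y ^ L * orb y 1 n}"
      define A where "A = {y \<in> P. y ^ k * orb y 1 N < 1}"
      define first where "first n y \<longleftrightarrow> n \<ge> 1 \<and> y ^ L * orb y 1 n < 1 \<and>
        (\<forall>i. 1 \<le> i \<longrightarrow> i < n \<longrightarrow> 1 \<le> y ^ L * orb y 1 i)" for n y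
      define \<Q> where "\<Q> = {param_cyl m y |m y. \<exists>n. m = n + L \<and> y \<in> P \<and> N \<le> n \<and> first n y}"
      have sub: "param_cyl (n + L) y \<subseteq> P" if "y \<in> P" for n y
        using cyl_antimono[of N "n + L" "\<lambda>i \<beta>. digit \<beta> 1 i" "{1..}" y] that cyl_eq[of y _ _ N x]
        by (auto simp: N(3) L_def)
      have same: "first n w \<and> w ^ L * orb w 1 n = orb w 1 (n + L)"
        if y: "y \<in> P" "first n y" and w: "w \<in> param_cyl (n + L) y" for n y w
      proof -
        have yw: "1 < y" "1 < w"
          using y1 y w sub by auto
        have iff: "y ^ L * orb y 1 i < 1 \<longleftrightarrow> w ^ L * orb w 1 i < 1" if i: "1 \<le> i" "i \<le> n" for i
        proof -
          have "y ^ L * orb y 1 i < 1 \<longleftrightarrow> (\<forall>l<L. digit y 1 (i + l) = 0)"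
            using i yw(1) by (subst small_iff_zero_digits) (auto simp: orb_bounds digit_add)
          also have "\<dots> \<longleftrightarrow> (\<forall>l<L. digit w 1 (i + l) = 0)"
            using w i by (auto simp: cyl_def)
          also have "\<dots> \<longleftrightarrow> w ^ L * orb w 1 i < 1"
            using i yw(2) by (subst small_iff_zero_digits) (auto simp: orb_bounds digit_add)
          finally show ?thesis .
        qed
        have "first n w"
          using y(2) iff unfolding first_def by (meson less_imp_le not_le order_refl)
        moreover from this have "orb w (orb w 1 n) L = w ^ L * orb w 1 n"
          using yw(2) by (intro orb_small) (auto simp: first_def orb_nonneg)
        ultimately show ?thesis
          by (simp add: orb_add)
      qed
      have cover: "X \<inter> P \<subseteq> (Z \<inter> P) \<union> A \<union> (X \<inter> \<Union>\<Q>)"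
      proof
        fix y assume y: "y \<in> X \<inter> P"
        show "y \<in> (Z \<inter> P) \<union> A \<union> (X \<inter> \<Union>\<Q>)"
        proof (cases "y \<in> Z")
          case False
          then have ex: "\<exists>n. n \<ge> 1 \<and> y ^ L * orb y 1 n < 1"
            by (auto simp: Z_def not_le)
          define n where "n = (LEAST n. n \<ge> 1 \<and> y ^ L * orb y 1 n < 1)"
          have n: "n \<ge> 1" "y ^ L * orb y 1 n < 1"
            using LeastI_ex[OF ex] by (auto simp: n_def)
          have "1 \<le> y ^ L * orb y 1 i" if "1 \<le> i" "i < n" for i
            using not_less_Least[of i "\<lambda>n. n \<ge> 1 \<and> y ^ L * orb y 1 n < 1"] that
            by (auto simp: n_def not_less)
          then have fst: "first n y"
            using n by (simp add: first_def)
          show ?thesis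
          proof (cases "N \<le> n")
            case True
            then have "param_cyl (n + L) y \<in> \<Q>"
              using fst y by (auto simp: \<Q>_def)
            moreover have "y \<in> param_cyl (n + L) y"
              using y1[of y] y by (intro cyl_refl) auto
            ultimately show ?thesis
              using y by blast
          next
            case False
            have yy: "1 < y" "0 \<le> orb y 1 n"
              using y1 y by (auto simp: orb_nonneg)
            have pw: "y ^ l * orb y 1 n < 1" if "l \<le> L" for l
            proof -
              have "y ^ l * orb y 1 n \<le> y ^ L * orb y 1 n"
                using that yy by (intro mult_right_mono power_increasing) auto
              then show ?thesis
                using n(2) by simp
            qed
            have "orb y 1 N = orb y (orb y 1 n) (N - n)"
              using False by (simp flip: orb_add)
            also have "\<dots> = y ^ (N - n) * orb y 1 n"
              using pw[of "N - n"] yy by (intro orb_small) (auto simp: L_def)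
            finally have "y ^ k * orb y 1 N = y ^ (k + (N - n)) * orb y 1 n"
              by (simp add: power_add)
            also have "\<dots> < 1"
              by (rule pw) (simp add: L_def)
            finally show ?thesis
              using y by (auto simp: A_def)
          qed
        qed (use y in blast)
      qed
      have A_small: "emeasure lebesgue A \<le> ennreal ((1 / b) ^ k)"
      proof -
        have "A \<subseteq> {p..p + (1 / b) ^ k}"
        proof
          fix y assume y: "y \<in> A"
          then have yP: "y \<in> P" "y ^ k * orb y 1 N < 1"
            by (auto simp: A_def)
          have "p ^ (N - 1) * (y - p) \<le> orb y 1 N - orb p 1 N"
            using yP(1) p(1) p(3)[OF yP(1)] y1[OF p(1)] N(1)
            by (intro param_growth_lower) (auto simp: N(3) cyl_def)
          moreover have "1 * (y - p) \<le> p ^ (N - 1) * (y - p)"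
            using p(3)[OF yP(1)] y1[OF p(1)] by (intro mult_right_mono) auto
          ultimately have "y - p \<le> orb y 1 N"
            using p(2) by simp
          moreover have "b ^ k * orb y 1 N \<le> y ^ k * orb y 1 N"
            using P_bc yP(1) b by (intro mult_right_mono power_mono orb_nonneg) auto
          then have "orb y 1 N \<le> (1 / b) ^ k"
            using yP(2) b by (simp add: field_simps power_one_over)
          ultimately show "y \<in> {p..p + (1 / b) ^ k}"
            using p(3)[OF yP(1)] by simp
        qed
        then have "emeasure lebesgue A \<le> emeasure lebesgue {p..p + (1 / b) ^ k}"
          by (rule emeasure_mono) simp
        also have "\<dots> = ennreal ((1 / b) ^ k)"
          using b by simp
        finally show ?thesis .
      qed
      have Q_le: "emeasure lebesgue (X \<inter> \<Union>\<Q>) \<le> ennreal (s * (1 - \<kappa>)) * emeasure lebesgue (\<Union>\<Q>)"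
      proof (rule emeasure_Int_Union_le)
        show "countable \<Q>"
          unfolding \<Q>_def by (rule countable_cylinders)
        show "Q \<in> sets lebesgue" if "Q \<in> \<Q>" for Q
          using that param_cyl_measurable by (auto simp: \<Q>_def)
        show "X \<in> sets lebesgue" by fact
        show "disjoint \<Q>"
          unfolding disjoint_def
        proof (intro ballI impI)
          fix Q Q' assume Q: "Q \<in> \<Q>" "Q' \<in> \<Q>" "Q \<noteq> Q'"
          obtain n y where Qn: "Q = param_cyl (n + L) y" "y \<in> P" "first n y"
            using Q(1) by (auto simp: \<Q>_def)
          obtain n' y' where Qn': "Q' = param_cyl (n' + L) y'" "y' \<in> P" "first n' y'"
            using Q(2) by (auto simp: \<Q>_def)
          show "Q \<inter> Q' = {}"
          proof (rule ccontr)
            assume "Q \<inter> Q' \<noteq> {}"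
            then obtain w where w: "w \<in> Q" "w \<in> Q'" by blast
            have "first n w" "first n' w"
              using same[OF Qn(2,3)] same[OF Qn'(2,3)] w Qn(1) Qn'(1) by auto
            then have "n = n'"
              unfolding first_def by (meson linorder_neqE_nat not_le)
            then show False
              using w Qn(1) Qn'(1) Q(3) cyl_eq by metis
          qed
        qed
        show "emeasure lebesgue (X \<inter> Q) \<le> ennreal (s * (1 - \<kappa>)) * emeasure lebesgue Q" if Q: "Q \<in> \<Q>" for Q
        proof -
          obtain n y where Qn: "Q = param_cyl (n + L) y" "y \<in> P" "N \<le> n" "first n y"
            using Q by (auto simp: \<Q>_def)
          have "1 \<le> w ^ M * orb w 1 (n + L)" if w: "w \<in> X" "w \<in> param_cyl (n + L) y" for w
          proof (rule ccontr)
            assume "\<not> ?thesis"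
            moreover have "w ^ (L + M) * orb w 1 n = w ^ M * (w ^ L * orb w 1 n)"
              by (simp add: power_add)
            ultimately have "w ^ (L + M) * orb w 1 n < 1"
              using same[OF Qn(2,4) w(2)] by simp
            then have "long_first_run M L w"
              using same[OF Qn(2,4) w(2)] unfolding long_first_run_def first_def by blast
            then show False
              using w(1) k by (auto simp: X_def L_def)
          qed
          moreover have "param_cyl (n + L) y \<in> window b c"
            using window_subcylinder[of N x b c y "n + L"] P N Qn by simp
          ultimately show ?thesis
            unfolding Qn(1) using N(1) y1[OF Qn(2)]
            by (intro param_density_improves[OF b \<kappa> _ _ _ X _ s]) (auto simp: L_def)
        qed
      qed
      have \<Q>_P: "\<Union>\<Q> \<subseteq> P"
        using sub by (auto simp: \<Q>_def)
      have \<Q>_M: "\<Union>\<Q> \<in> sets lebesgue"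
        using countable_cylinders[of "\<lambda>i \<beta>. digit \<beta> 1 i" "{1..}"
            "\<lambda>m y. \<exists>n. m = n + L \<and> y \<in> P \<and> N \<le> n \<and> first n y"] param_cyl_measurable
        unfolding \<Q>_def[symmetric] by (intro sets.countable_Union) (auto simp: \<Q>_def)
      have "Z \<in> sets borel"
        unfolding Z_def by measurable
      then have ZM: "Z \<inter> P \<in> sets lebesgue"
        using PM by auto
      have "{y. y ^ k * orb y 1 N < 1} \<in> sets borel"
        by measurable
      then have AM: "A \<in> sets lebesgue"
        using PM unfolding A_def Collect_conj_eq by auto
      have "emeasure lebesgue (X \<inter> P) \<le> emeasure lebesgue ((Z \<inter> P) \<union> A \<union> (X \<inter> \<Union>\<Q>))"
        using ZM AM X \<Q>_M by (intro emeasure_mono[OF cover]) auto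
      also have "\<dots> \<le> emeasure lebesgue ((Z \<inter> P) \<union> A) + emeasure lebesgue (X \<inter> \<Union>\<Q>)"
        using ZM AM X \<Q>_M by (intro emeasure_subadditive) auto
      also have "\<dots> \<le> (emeasure lebesgue (Z \<inter> P) + emeasure lebesgue A) + emeasure lebesgue (X \<inter> \<Union>\<Q>)"
        using ZM AM by (intro add_right_mono emeasure_subadditive) auto
      also have "emeasure lebesgue (Z \<inter> P) = 0"
        unfolding Z_def by (rule null_orbit_of_one_bounded_below(2)[OF b P])
      also have "0 + emeasure lebesgue A + emeasure lebesgue (X \<inter> \<Union>\<Q>)
          \<le> ennreal ((1 / b) ^ k) + ennreal (s * (1 - \<kappa>)) * emeasure lebesgue P"
        using A_small order_trans[OF Q_le mult_left_mono[OF emeasure_mono[OF \<Q>_P PM]]]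
        by (simp add: add_mono)
      finally show ?thesis .
    qed
    show "emeasure lebesgue (X \<inter> P) \<le> ennreal (s * (1 - \<kappa>)) * emeasure lebesgue P"
    proof (rule ennreal_le_epsilon)
      fix e :: real assume e: "e > 0"
      have "\<forall>\<^sub>F k in sequentially. (1 / b) ^ k < e"
        using b e by (intro order_tendstoD(2)[OF LIMSEQ_realpow_zero]) auto
      then have "\<forall>\<^sub>F k in sequentially. (1 / b) ^ k < e \<and> L0 \<le> k"
        by (intro eventually_conj eventually_ge_at_top)
      then obtain k where "(1 / b) ^ k < e" "L0 \<le> k"
        by (auto dest: eventually_happens)
      then have "emeasure lebesgue (X \<inter> P) \<le> ennreal ((1 / b) ^ k) + ennreal (s * (1 - \<kappa>)) * emeasure lebesgue P"
        using bound by blast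
      also have "\<dots> \<le> ennreal e + ennreal (s * (1 - \<kappa>)) * emeasure lebesgue P"
        using \<open>(1 / b) ^ k < e\<close> by (intro add_right_mono ennreal_leI) simp
      finally show "emeasure lebesgue (X \<inter> P) \<le> ennreal (s * (1 - \<kappa>)) * emeasure lebesgue P + ennreal e"
        by (simp add: add.commute)
    qed
  qed (use that \<kappa> window_finite_measure in auto)
  from null_of_window_null[OF b X this] show ?thesis
    by (simp add: X_def)
qed

lemma countable_orbit_of_one_hits_zero: "countable {\<beta>. \<beta> > 1 \<and> (\<exists>n. orb \<beta> 1 n = 0)}"
proof -
  have "countable {\<beta>. \<beta> > 1 \<and> orb \<beta> 1 n = 0}" for n
  proof (cases "n = 0")
    case False
    let ?f = "\<lambda>\<beta>. map (\<lambda>i. digit \<beta> 1 i) [0..<n]"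
    have "inj_on ?f {\<beta>. \<beta> > 1 \<and> orb \<beta> 1 n = 0}"
    proof (rule linorder_inj_onI)
      fix y y' :: real
      assume y: "y < y'" "y \<in> {\<beta>. \<beta> > 1 \<and> orb \<beta> 1 n = 0}" "y' \<in> {\<beta>. \<beta> > 1 \<and> orb \<beta> 1 n = 0}"
      show "?f y \<noteq> ?f y'"
      proof
        assume eq: "?f y = ?f y'"
        have "digit y' 1 i = digit y 1 i" if "i < n" for i
          using arg_cong[OF eq, of "\<lambda>l. l ! i"] that by simp
        then have "y ^ (n - 1) * (y' - y) \<le> orb y' 1 n - orb y 1 n"
          using y False by (intro param_growth_lower) auto
        moreover have "0 < y ^ (n - 1) * (y' - y)"
          using y by simp
        ultimately show False
          using y by simp
      qed
    qed auto
    then show ?thesis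
      by (rule countable_image_inj_on[rotated]) simp
  qed simp
  then have "countable (\<Union>n. {\<beta>. \<beta> > 1 \<and> orb \<beta> 1 n = 0})"
    by blast
  moreover have "{\<beta>. \<beta> > 1 \<and> (\<exists>n. orb \<beta> 1 n = 0)} = (\<Union>n. {\<beta>. \<beta> > 1 \<and> orb \<beta> 1 n = 0})"
    by auto
  ultimately show ?thesis by simp
qed

text \<open>A first run of \<open>L\<close> zeros of length at least \<open>L + M\<close>, with \<open>\<beta> ^ M \<ge> \<beta> / (\<beta> - 1)\<close>,
  begins at a record low of the orbit of \<open>1\<close> as required for an isolated point.\<close>

lemma isolated_point_of_long_first_run:
  assumes \<beta>: "\<beta> > 1" and nz: "\<And>n. orb \<beta> 1 n \<noteq> 0"
    and bounded: "\<And>M. \<exists>n\<ge>1. \<beta> ^ M * orb \<beta> 1 n < 1"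
    and runs: "\<And>M L0. \<exists>L\<ge>L0. long_first_run M L \<beta>"
    and \<eta>: "\<eta> > 0"
  shows "\<exists>t. t isolated_in bifurcation_set \<beta> \<and> 0 < t \<and> t < \<eta>"
proof -
  have pos: "orb \<beta> 1 n > 0" for n
    using nz[of n] orb_nonneg[of 1 \<beta> n] by simp
  obtain M' where M': "1 / \<eta> < \<beta> ^ M'"
    using real_arch_pow[OF \<beta>] by blast
  obtain j where j: "j \<ge> 1" "\<beta> ^ M' * orb \<beta> 1 j < 1"
    using bounded by blast
  have j\<eta>: "orb \<beta> 1 j < \<eta>"
  proof -
    have "1 < \<beta> ^ M' * \<eta>"
      using M' \<eta> by (simp add: field_simps)
    then have "\<beta> ^ M' * orb \<beta> 1 j < \<beta> ^ M' * \<eta>"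
      using j(2) by simp
    then show ?thesis
      using \<beta> by simp
  qed
  obtain i where i: "i < Suc j" "\<And>l. l < Suc j \<Longrightarrow> orb \<beta> 1 i \<le> orb \<beta> 1 l"
    using exists_minimum_below[of "Suc j" "orb \<beta> 1"] by blast
  obtain L0 where L0: "1 / orb \<beta> 1 i < \<beta> ^ L0"
    using real_arch_pow[OF \<beta>] by blast
  obtain M where M: "\<beta> / (\<beta> - 1) < \<beta> ^ M"
    using real_arch_pow[OF \<beta>] by blast
  obtain L n where L: "L \<ge> L0" and n: "n \<ge> 1" "\<beta> ^ (L + M) * orb \<beta> 1 n < 1"
    and before: "\<And>l. 1 \<le> l \<Longrightarrow> l < n \<Longrightarrow> 1 \<le> \<beta> ^ L * orb \<beta> 1 l"
    using runs[of L0 M] unfolding long_first_run_def by blast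
  have "j < n"
  proof (rule ccontr)
    assume "\<not> j < n"
    then have "orb \<beta> 1 i \<le> orb \<beta> 1 n"
      using i(2)[of n] by simp
    have "1 < \<beta> ^ L0 * orb \<beta> 1 i"
      using L0 pos[of i] by (simp add: field_simps)
    also have "\<dots> \<le> \<beta> ^ (L + M) * orb \<beta> 1 n"
      using \<beta> L \<open>orb \<beta> 1 i \<le> orb \<beta> 1 n\<close> pos[of i]
      by (intro mult_mono power_increasing) auto
    finally show False
      using n(2) by simp
  qed
  have "\<exists>t. t isolated_in bifurcation_set \<beta> \<and> orb \<beta> 1 n \<le> t \<and> (\<forall>l<n. t \<le> orb \<beta> 1 l)"
  proof (rule isolated_point_of_record[OF \<beta> _ pos])
    show "n > 0"
      using n by simp
    fix l assume l: "l < n"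
    have "1 \<le> \<beta> ^ L * orb \<beta> 1 l"
      using before[of l] l \<beta> by (cases "l = 0") auto
    have "\<beta> ^ L * (\<beta> ^ M * orb \<beta> 1 n) < 1"
      using n(2) by (simp add: power_add mult.assoc)
    also have "\<dots> \<le> \<beta> ^ L * orb \<beta> 1 l"
      by fact
    finally have "\<beta> ^ M * orb \<beta> 1 n \<le> orb \<beta> 1 l"
      using \<beta> by simp
    moreover have "\<beta> / (\<beta> - 1) * orb \<beta> 1 n \<le> \<beta> ^ M * orb \<beta> 1 n"
      using M pos[of n] by (intro mult_right_mono) auto
    ultimately have "\<beta> / (\<beta> - 1) * orb \<beta> 1 n \<le> orb \<beta> 1 l"
      by simp
    then show "orb \<beta> 1 n \<le> (1 - 1 / \<beta>) * orb \<beta> 1 l"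
      using \<beta> by (simp add: field_simps)
  qed
  then obtain t where t: "t isolated_in bifurcation_set \<beta>" "orb \<beta> 1 n \<le> t" "t \<le> orb \<beta> 1 j"
    using \<open>j < n\<close> by blast
  then show ?thesis
    using pos[of n] j\<eta> by (intro exI[of _ t]) auto
qed

lemma AE_isolated_points_near_0:
  "AE \<beta> in lebesgue. \<beta> > 1 \<longrightarrow> (\<forall>\<eta>>0. \<exists>t. t isolated_in bifurcation_set \<beta> \<and> 0 < t \<and> t < \<eta>)"
proof (rule AE_I')
  define Z where "Z = {\<beta>. \<beta> > 1 \<and> (\<exists>n. orb \<beta> 1 n = 0)}"
  define A where "A M = {y. \<forall>n\<ge>1. 1 \<le> y ^ M * orb y 1 n}" for M
  define B where "B M L0 = {y. \<forall>L\<ge>L0. \<not> long_first_run M L y}" for M L0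
  define I where "I k = {1 + 1 / real (Suc k)<..<real k}" for k
  have I1: "1 < 1 + 1 / real (Suc k)" for k
    by simp
  have "A M \<inter> I k \<in> null_sets lebesgue" for M k
    unfolding A_def I_def by (rule null_orbit_of_one_bounded_below(1)[OF I1])
  moreover have "B M L0 \<inter> I k \<in> null_sets lebesgue" for M L0 k
    unfolding B_def I_def by (rule null_no_long_first_run[OF I1])
  moreover have "Z \<in> null_sets lebesgue"
    using countable_orbit_of_one_hits_zero countable_imp_null_set_lborel[of Z]
    by (auto simp: Z_def null_sets_completionI)
  ultimately show "Z \<union> (\<Union>M k. A M \<inter> I k) \<union> (\<Union>M L0 k. B M L0 \<inter> I k) \<in> null_sets lebesgue"
    by (intro null_sets.Un null_sets_UN)
  show "{\<beta> \<in> space lebesgue. \<not> (\<beta> > 1 \<longrightarrow> (\<forall>\<eta>>0. \<exists>t. t isolated_in bifurcation_set \<beta> \<and> 0 < t \<and> t < \<eta>))}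
      \<subseteq> Z \<union> (\<Union>M k. A M \<inter> I k) \<union> (\<Union>M L0 k. B M L0 \<inter> I k)"
  proof (rule subsetI, rule ccontr)
    fix \<beta>
    assume bad: "\<beta> \<in> {\<beta> \<in> space lebesgue. \<not> (\<beta> > 1 \<longrightarrow> (\<forall>\<eta>>0. \<exists>t. t isolated_in bifurcation_set \<beta> \<and> 0 < t \<and> t < \<eta>))}"
      and good: "\<beta> \<notin> Z \<union> (\<Union>M k. A M \<inter> I k) \<union> (\<Union>M L0 k. B M L0 \<inter> I k)"
    have \<beta>: "\<beta> > 1" and none: "\<not> (\<forall>\<eta>>0. \<exists>t. t isolated_in bifurcation_set \<beta> \<and> 0 < t \<and> t < \<eta>)"
      using bad by simp_all
    have "\<exists>k. \<beta> \<in> I k"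
    proof -
      obtain k1 where k1: "1 / (\<beta> - 1) < real k1"
        using reals_Archimedean2[of "1 / (\<beta> - 1)"] by auto
      obtain k2 where k2: "\<beta> < real k2"
        using reals_Archimedean2[of \<beta>] by auto
      have "1 / (\<beta> - 1) < real (Suc (max k1 k2))"
        using k1 by simp
      then have "1 / real (Suc (max k1 k2)) < \<beta> - 1"
        using \<beta> by (simp add: field_simps)
      moreover have "\<beta> < real (max k1 k2)"
        using k2 by simp
      ultimately have "\<beta> \<in> I (max k1 k2)"
        unfolding I_def by simp
      then show ?thesis ..
    qed
    then obtain k where k: "\<beta> \<in> I k" ..
    have goodZ: "\<beta> \<notin> Z" and goodA: "\<And>M. \<beta> \<notin> A M" and goodB: "\<And>M L0. \<beta> \<notin> B M L0"
      using good k by auto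
    have small: "\<exists>n\<ge>1. \<beta> ^ M * orb \<beta> 1 n < 1" for M
    proof (rule ccontr)
      assume "\<not> ?thesis"
      then have "\<beta> \<in> A M"
        by (auto simp: A_def not_less)
      then show False
        using goodA by blast
    qed
    have long: "\<exists>L\<ge>L0. long_first_run M L \<beta>" for M L0
    proof (rule ccontr)
      assume "\<not> ?thesis"
      then have "\<beta> \<in> B M L0"
        by (auto simp: B_def)
      then show False
        using goodB by blast
    qed
    have nz: "orb \<beta> 1 n \<noteq> 0" for n
      using goodZ \<beta> by (simp add: Z_def)
    have "\<exists>t. t isolated_in bifurcation_set \<beta> \<and> 0 < t \<and> t < \<eta>" if "\<eta> > 0" for \<eta>
      by (rule isolated_point_of_long_first_run[OF \<beta> nz small long that])
    then show False
      using none by blast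
  qed
qed

lemma infinite_of_arbitrarily_small:
  fixes A :: "real set"
  assumes small: "\<And>\<eta>. \<eta> > 0 \<Longrightarrow> \<exists>t\<in>A. 0 < t \<and> t < \<eta>"
  shows "infinite A"
proof
  assume fin: "finite A"
  then have fin': "finite {t \<in> A. 0 < t}"
    by simp
  obtain t where "t \<in> A" "0 < t"
    using small[of 1] by auto
  then have ne: "{t \<in> A. 0 < t} \<noteq> {}"
    by blast
  obtain u where "u \<in> A" "0 < u" "u < Min {t \<in> A. 0 < t}"
    using small[of "Min {t \<in> A. 0 < t}"] Min_in[OF fin' ne] by auto
  then show False
    using Min_le[OF fin', of u] by simp
qed

lemma countable_isolated_points:
  fixes S :: "real set"
  shows "countable {t. t isolated_in S}"
proof -
  have "{t. t isolated_in S} \<subseteq> S - {t. t islimpt S}"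
    by (auto simp: isolated_in_islimpt_iff)
  have "\<exists>a b. a \<in> \<rat> \<and> b \<in> \<rat> \<and> {a<..<b} \<inter> S = {t}" if "t isolated_in S" for t
  proof -
    obtain e where e: "e > 0" "t \<in> S" "\<And>y. y \<in> S \<Longrightarrow> dist t y < e \<Longrightarrow> y = t"
      using \<open>t isolated_in S\<close> by (auto simp: isolated_in_dist_Ex_iff)
    obtain a where a: "a \<in> \<rat>" "t - e < a" "a < t"
      using Rats_dense_in_real[of "t - e" t] e by auto
    obtain b where b: "b \<in> \<rat>" "t < b" "b < t + e"
      using Rats_dense_in_real[of t "t + e"] e by auto
    have "{a<..<b} \<inter> S = {t}"
    proof (rule set_eqI)
      fix x
      show "x \<in> {a<..<b} \<inter> S \<longleftrightarrow> x \<in> {t}"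
        using e(2) e(3)[of x] a b by (auto simp: dist_real_def abs_less_iff)
    qed
    then show ?thesis
      using a b by blast
  qed
  then have "{{t} |t. t isolated_in S} \<subseteq> (\<lambda>(a, b). {a<..<b} \<inter> S) ` (\<rat> \<times> \<rat>)"
    by (fastforce simp: image_iff)
  then have "countable {{t} |t. t isolated_in S}"
    by (rule countable_subset) (intro countable_image countable_SIGMA countable_rat)
  moreover have "{{t} |t. t isolated_in S} = (\<lambda>t. {t}) ` {t. t isolated_in S}"
    by auto
  moreover have "inj_on (\<lambda>t. {t}) {t. t isolated_in S}"
    by simp
  ultimately show ?thesis
    by (metis countable_image_inj_on)
qed

lemma infinite_accumulation_points_near_0:
  assumes \<beta>: "\<beta> > 1" and \<epsilon>: "\<epsilon> > 0"
  shows "infinite {t \<in> bifurcation_set \<beta>. t < \<epsilon> \<and> t islimpt bifurcation_set \<beta>}"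
proof
  assume "finite {t \<in> bifurcation_set \<beta>. t < \<epsilon> \<and> t islimpt bifurcation_set \<beta>}"
  then have "countable ({t \<in> bifurcation_set \<beta>. t < \<epsilon> \<and> t islimpt bifurcation_set \<beta>}
                \<union> {t. t isolated_in bifurcation_set \<beta>})"
    using countable_isolated_points by (simp add: countable_finite)
  then have "countable (bifurcation_set \<beta> \<inter> {0<..<\<epsilon>})"
    by (rule countable_subset[rotated]) (auto simp: isolated_in_islimpt_iff)
  then show False
    using uncountable_bifurcation_set_near_0[OF \<beta> \<epsilon>] by simp
qed

lemma zero_islimpt_bifurcation_set:
  assumes \<beta>: "\<beta> > 1"
  shows "0 islimpt bifurcation_set \<beta>"
  unfolding islimpt_approachable
proof (intro allI impI)
  fix e :: real assume "e > 0"
  then have "bifurcation_set \<beta> \<inter> {0<..<e} \<noteq> {}"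
    using uncountable_bifurcation_set_near_0[OF \<beta>] by (metis countable_empty)
  then obtain x where "x \<in> bifurcation_set \<beta>" "0 < x" "x < e"
    by auto
  then show "\<exists>x\<in>bifurcation_set \<beta>. x \<noteq> 0 \<and> dist x 0 < e"
    by (intro bexI[of _ x]) (auto simp: dist_real_def)
qed

section \<open>Rotation numbers of confined orbits\<close>

text \<open>An orbit is confined if it stays in \<open>[1 - 1 / \<beta>, 1]\<close>. The branch of the beta-transformation
  with digit \<open>\<lfloor>\<beta>\<rfloor> - 1 + i\<close> is lifted to the affine map \<open>x \<mapsto> \<beta> * x - (\<lfloor>\<beta>\<rfloor> - 1)\<close>, which maps this
  interval onto an interval of length \<open>1\<close> and thus extends to a monotone map of degree one. The
  number of turns after \<open>n\<close> steps is \<open>turns \<beta> x n\<close>.\<close>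

definition turns :: "real \<Rightarrow> real \<Rightarrow> nat \<Rightarrow> int" where
  "turns \<beta> x n = (\<Sum>i<n. digit \<beta> x i - (\<lfloor>\<beta>\<rfloor> - 1))"

definition confined :: "real \<Rightarrow> real \<Rightarrow> bool" where
  "confined \<beta> x \<longleftrightarrow> x \<le> 1 \<and> (\<forall>n. 1 - 1 / \<beta> \<le> orb \<beta> x n)"

lemma turns_0 [simp]: "turns \<beta> x 0 = 0"
  by (simp add: turns_def)

lemma turns_Suc: "turns \<beta> x (Suc n) = turns \<beta> x n + (digit \<beta> x n - (\<lfloor>\<beta>\<rfloor> - 1))"
  by (simp add: turns_def)

lemma turns_add: "turns \<beta> x (m + n) = turns \<beta> x m + turns \<beta> (orb \<beta> x m) n"
  by (induction n) (auto simp: turns_Suc digit_add)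

lemma confined_bounds:
  assumes "\<beta> > 1" "confined \<beta> x"
  shows "1 - 1 / \<beta> \<le> orb \<beta> x n" "orb \<beta> x n \<le> 1" "0 < orb \<beta> x n"
proof -
  show 1: "1 - 1 / \<beta> \<le> orb \<beta> x n" for n
    using assms by (simp add: confined_def)
  have "0 < 1 - 1 / \<beta>"
    using assms(1) by simp
  then show "0 < orb \<beta> x n"
    using 1[of n] by linarith
  have "0 \<le> x"
    using 1[of 0] \<open>0 < 1 - 1 / \<beta>\<close> by simp
  then show "orb \<beta> x n \<le> 1"
    using assms(2) by (simp add: orb_le_1 confined_def)
qed

lemma confined_orb: "\<beta> > 1 \<Longrightarrow> confined \<beta> x \<Longrightarrow> confined \<beta> (orb \<beta> x m)"
  using confined_bounds(1)[of \<beta> x] confined_bounds(2)[of \<beta> x m]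
  by (simp add: confined_def orb_add[symmetric])

text \<open>Points in the same period are ordered because the lift is increasing, and points in different
  periods because the image of one period has length exactly \<open>1\<close>.\<close>

lemma lifted_orbits_ordered:
  fixes p q :: int
  assumes \<beta>: "\<beta> > 1" and x: "confined \<beta> x" and y: "confined \<beta> y" and le: "x + p \<le> y + q"
  shows "orb \<beta> x n + turns \<beta> x n + p \<le> orb \<beta> y n + turns \<beta> y n + q"
proof (induction n)
  case (Suc n)
  define u where "u = orb \<beta> x n"
  define v where "v = orb \<beta> y n"
  define p' where "p' = turns \<beta> x n + p"
  define q' where "q' = turns \<beta> y n + q"
  have bounds: "1 - 1 / \<beta> \<le> u" "u \<le> 1" "1 - 1 / \<beta> \<le> v" "v \<le> 1"
    using confined_bounds[OF \<beta> x, of n] confined_bounds[OF \<beta> y, of n] by (auto simp: u_def v_def)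
  have "u + p' \<le> v + q'"
    using Suc by (simp add: u_def v_def p'_def q'_def add.assoc)
  have "\<beta> * u + p' \<le> \<beta> * v + q'"
  proof (cases "p' < q'")
    case True
    have "\<beta> * (u - v) \<le> \<beta> * (1 / \<beta>)"
      using bounds \<beta> by (intro mult_left_mono) auto
    then have "\<beta> * u - \<beta> * v \<le> 1"
      using \<beta> by (simp add: right_diff_distrib)
    moreover have "real_of_int p' + 1 \<le> q'"
      using True by linarith
    ultimately show ?thesis by linarith
  next
    case False
    have "v - u < 1"
      using bounds \<beta> by (smt (verit) divide_less_eq_1_pos)
    then have "real_of_int (p' - q') < 1"
      using \<open>u + p' \<le> v + q'\<close> by simp
    then have "p' = q'"
      using False by linarith
    then show ?thesis
      using \<open>u + p' \<le> v + q'\<close> \<beta> by simp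
  qed
  then show ?case
    by (simp add: orb_Suc turns_Suc u_def v_def p'_def q'_def algebra_simps)
qed (use le in simp)

context
  fixes \<beta> :: real
  assumes \<beta>: "\<beta> > 1" and conf: "confined \<beta> 1"
begin

text \<open>The lifted orbit of \<open>\<tau> m\<close> is squeezed between those of \<open>1\<close> and of \<open>1 - 1\<close>.\<close>

lemma turns_one_bounds:
  "turns \<beta> 1 n - 1 \<le> turns \<beta> 1 (m + n) - turns \<beta> 1 m"
  "turns \<beta> 1 (m + n) - turns \<beta> 1 m \<le> turns \<beta> 1 n"
proof -
  define t where "t = turns \<beta> (orb \<beta> 1 m) n"
  have t: "turns \<beta> 1 (m + n) - turns \<beta> 1 m = t"
    by (simp add: turns_add t_def)
  have m: "confined \<beta> (orb \<beta> 1 m)"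
    by (rule confined_orb[OF \<beta> conf])
  have "orb \<beta> 1 m + of_int 0 \<le> 1 + of_int 0"
    using confined_bounds[OF \<beta> conf, of m] by simp
  from lifted_orbits_ordered[OF \<beta> m conf this, of n]
  have 1: "orb \<beta> 1 (m + n) + t \<le> orb \<beta> 1 n + turns \<beta> 1 n"
    by (simp add: t_def orb_add)
  have "1 + of_int 0 \<le> orb \<beta> 1 m + of_int 1"
    using confined_bounds[OF \<beta> conf, of m] by simp
  from lifted_orbits_ordered[OF \<beta> conf m this, of n]
  have 2: "orb \<beta> 1 n + turns \<beta> 1 n \<le> orb \<beta> 1 (m + n) + t + 1"
    by (simp add: t_def orb_add)
  have "t \<le> turns \<beta> 1 n \<and> turns \<beta> 1 n - 1 \<le> t"
  proof (cases "n = 0")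
    case True
    then show ?thesis by (simp add: t_def)
  next
    case False
    then have "orb \<beta> 1 n < 1" "orb \<beta> 1 (m + n) < 1"
      by (auto intro: orb_bounds)
    moreover have "0 < orb \<beta> 1 n" "0 < orb \<beta> 1 (m + n)"
      by (rule confined_bounds[OF \<beta> conf])+
    ultimately have "real_of_int t < turns \<beta> 1 n + 1" "real_of_int (turns \<beta> 1 n) < t + 2"
      using 1 2 by linarith+
    then show ?thesis by linarith
  qed
  then show "turns \<beta> 1 n - 1 \<le> turns \<beta> 1 (m + n) - turns \<beta> 1 m"
    "turns \<beta> 1 (m + n) - turns \<beta> 1 m \<le> turns \<beta> 1 n"
    unfolding t by auto
qed

lemma turns_one_mult:
  "turns \<beta> 1 (i * q) \<le> int i * turns \<beta> 1 q"
  "i \<ge> 1 \<Longrightarrow> int i * (turns \<beta> 1 q - 1) + 1 \<le> turns \<beta> 1 (i * q)"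
proof -
  show "turns \<beta> 1 (i * q) \<le> int i * turns \<beta> 1 q"
  proof (induction i)
    case (Suc i)
    then show ?case
      using turns_one_bounds(2)[of "i * q" q] by (simp add: algebra_simps)
  qed simp
  show "i \<ge> 1 \<Longrightarrow> int i * (turns \<beta> 1 q - 1) + 1 \<le> turns \<beta> 1 (i * q)"
  proof (induction i rule: nat_induct_at_least)
    case (Suc i)
    then show ?case
      using turns_one_bounds(1)[of q "i * q"] by (simp add: algebra_simps)
  qed simp
qed

lemma turns_one_range: "0 \<le> turns \<beta> 1 n" "turns \<beta> 1 n \<le> int n"
proof -
  have step: "0 \<le> digit \<beta> 1 i - (\<lfloor>\<beta>\<rfloor> - 1) \<and> digit \<beta> 1 i - (\<lfloor>\<beta>\<rfloor> - 1) \<le> 1" for i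
  proof -
    have "\<beta> * (1 - 1 / \<beta>) \<le> \<beta> * orb \<beta> 1 i" "\<beta> * orb \<beta> 1 i \<le> \<beta> * 1"
      using confined_bounds[OF \<beta> conf, of i] \<beta> by (intro mult_left_mono; simp)+
    then have "\<lfloor>\<beta> - 1\<rfloor> \<le> digit \<beta> 1 i" "digit \<beta> 1 i \<le> \<lfloor>\<beta>\<rfloor>"
      using \<beta> unfolding digit_def by (intro floor_mono; simp add: right_diff_distrib)+
    then show ?thesis by simp
  qed
  have "0 \<le> turns \<beta> 1 n \<and> turns \<beta> 1 n \<le> int n"
  proof (induction n)
    case (Suc n)
    then show ?case
      using step[of n] by (simp add: turns_Suc)
  qed simp
  then show "0 \<le> turns \<beta> 1 n" "turns \<beta> 1 n \<le> int n"
    by auto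
qed

text \<open>The numbers of turns of a confined orbit of \<open>1\<close> up to time \<open>n\<close> are those of a rational
  rotation, namely of the smallest quotient \<open>turns \<beta> 1 q / q\<close>; hence only quadratically many
  beginnings of length \<open>n\<close> are possible.\<close>

lemma turns_one_eq_ceiling:
  assumes n: "n \<ge> 1"
  shows "\<exists>p q. 1 \<le> q \<and> q \<le> n \<and> p \<le> n \<and> (\<forall>i\<le>n. turns \<beta> 1 i = \<lceil>real i * real p / real q\<rceil>)"
proof -
  let ?N = "turns \<beta> 1"
  obtain q' where q': "q' < n" "\<And>i. i < n \<Longrightarrow> real_of_int (?N (Suc q')) / real (Suc q') \<le> real_of_int (?N (Suc i)) / real (Suc i)"
    using exists_minimum_below[of n "\<lambda>i. real_of_int (?N (Suc i)) / real (Suc i)"] n by auto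
  define q where "q = Suc q'"
  define p where "p = nat (?N q)"
  have q: "1 \<le> q" "q \<le> n"
    using q' by (auto simp: q_def)
  have p: "?N q = int p" "p \<le> n"
    using turns_one_range[of q] q by (auto simp: p_def)
  have "?N i = \<lceil>real i * real p / real q\<rceil>" if i: "i \<le> n" for i
  proof (cases "i = 0")
    case False
    have "real p / real q \<le> real_of_int (?N i) / real i"
      using q'(2)[of "i - 1"] False i p(1) by (simp add: q_def)
    then have low: "real i * real p / real q \<le> real_of_int (?N i)"
      using False by (simp add: field_simps)
    have "int q * (?N i - 1) + 1 \<le> ?N (q * i)"
      using turns_one_mult(2)[OF q(1)] .
    also have "\<dots> \<le> int i * int p"
      using turns_one_mult(1)[of i q] p by (simp add: mult.commute)
    finally have "real_of_int (int q * (?N i - 1) + 1) \<le> real_of_int (int i * int p)"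
      by (rule of_int_le_iff[THEN iffD2])
    then have "real q * (real_of_int (?N i) - 1) < real i * real p"
      by simp
    then have "real_of_int (?N i) - 1 < real i * real p / real q"
      using q by (simp add: pos_less_divide_eq mult.commute)
    then show ?thesis
      using low by (intro ceiling_unique[symmetric]) auto
  qed simp
  then show ?thesis
    using q p(2) by blast
qed

end

section \<open>The bases without isolated points form a set of dimension zero\<close>

lemma tendsto_poly_times_power:
  fixes r :: real
  assumes "0 < r" "r < 1"
  shows "(\<lambda>m. (real m + 2)\<^sup>2 * r ^ m) \<longlonglongrightarrow> 0"
proof -
  define u where "u = sqrt r"
  have u: "0 < u" "u < 1" "u\<^sup>2 = r"
    using assms by (auto simp: u_def)
  have "(\<lambda>m. (real m * u ^ m + 2 * u ^ m)\<^sup>2) \<longlonglongrightarrow> (0 + 2 * 0)\<^sup>2"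
    using u by (intro tendsto_intros powser_times_n_limit_0 LIMSEQ_realpow_zero) auto
  moreover have "(real m * u ^ m + 2 * u ^ m)\<^sup>2 = (real m + 2)\<^sup>2 * r ^ m" for m
  proof -
    have "real m * u ^ m + 2 * u ^ m = (real m + 2) * u ^ m"
      by (simp add: distrib_right)
    moreover have "(u ^ m)\<^sup>2 = r ^ m"
      unfolding u(3)[symmetric] by (simp add: power_mult[symmetric] mult.commute)
    ultimately show ?thesis
      by (simp add: power_mult_distrib)
  qed
  ultimately show ?thesis by simp
qed

lemma hausdorff_null_confined_bases:
  assumes b: "b > 1" and s: "s > 0"
  shows "hausdorff_measure s {\<beta>. b \<le> \<beta> \<and> \<lfloor>\<beta>\<rfloor> = k \<and> confined \<beta> 1} = 0"
proof (rule hausdorff_null_finite_cover[OF s])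
  fix e :: real assume e: "e > 0"
  define B where "B = {\<beta>. b \<le> \<beta> \<and> \<lfloor>\<beta>\<rfloor> = k \<and> confined \<beta> 1}"
  define r where "r = (1 / b) powr s"
  have r: "0 < r" "r < 1"
    using b gr_one_powr[OF b s] by (simp_all add: r_def powr_divide)
  have "(\<lambda>m. (1 / b) ^ m) \<longlonglongrightarrow> 0"
    using b by (intro LIMSEQ_realpow_zero) auto
  then have "\<forall>\<^sub>F m in sequentially. (1 / b) ^ m < e \<and> (real m + 2)\<^sup>2 * r ^ m < e"
    using e tendsto_poly_times_power[OF r] by (intro eventually_conj order_tendstoD(2))
  then obtain m where m: "(1 / b) ^ m < e" "(real m + 2)\<^sup>2 * r ^ m < e"
    by (auto dest: eventually_happens)
  define d where "d = (1 / b) ^ m"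
  define U where "U pq = {\<beta> \<in> B. \<forall>i\<le>Suc m. turns \<beta> 1 i = \<lceil>real i * real (fst pq) / real (snd pq)\<rceil>}"
    for pq :: "nat \<times> nat"
  define \<U> where "\<U> = U ` ({..Suc m} \<times> {..Suc m})"
  have close: "\<bar>y - y'\<bar> \<le> d" if y: "y \<in> U pq" "y' \<in> U pq" for y y' pq
  proof -
    have half: "y' - y \<le> d" if y: "y \<in> U pq" "y' \<in> U pq" "y \<le> y'" for y y'
    proof -
      have b1: "b \<le> y" "\<lfloor>y\<rfloor> = \<lfloor>y'\<rfloor>"
        using y by (auto simp: U_def B_def)
      have "digit y' 1 i = digit y 1 i" if "i < Suc m" for i
      proof -
        have "turns y 1 (Suc i) = turns y' 1 (Suc i)" "turns y 1 i = turns y' 1 i"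
          using y that by (auto simp: U_def)
        then show ?thesis
          using b1(2) by (simp add: turns_Suc)
      qed
      then have "y ^ (Suc m - 1) * (y' - y) \<le> orb y' 1 (Suc m) - orb y 1 (Suc m)"
        using b1 b y by (intro param_growth_lower) auto
      also have "\<dots> \<le> 1"
        using orb_le_1[of 1 y' "Suc m"] orb_nonneg[of 1 y "Suc m"] by simp
      finally have "y ^ m * (y' - y) \<le> 1"
        by simp
      moreover have "b ^ m * (y' - y) \<le> y ^ m * (y' - y)"
        using b b1 y by (intro mult_right_mono power_mono) auto
      ultimately show ?thesis
        using b by (simp add: d_def field_simps power_one_over)
    qed
    show ?thesis
      using half[OF y] half[OF y(2,1)] by (cases "y \<le> y'") auto
  qed
  have d: "d > 0"
    using b by (simp add: d_def)
  have "B \<subseteq> \<Union>\<U>"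
  proof
    fix \<beta> assume \<beta>: "\<beta> \<in> B"
    then have "\<beta> > 1" "confined \<beta> 1"
      using b by (auto simp: B_def)
    from turns_one_eq_ceiling[OF this, of "Suc m"] obtain p q where pq: "q \<le> Suc m" "p \<le> Suc m"
      "\<forall>i\<le>Suc m. turns \<beta> 1 i = \<lceil>real i * real p / real q\<rceil>"
      by auto
    then have "\<beta> \<in> U (p, q)"
      using \<beta> by (simp add: U_def)
    moreover have "U (p, q) \<in> \<U>"
      using pq by (auto simp: \<U>_def)
    ultimately show "\<beta> \<in> \<Union>\<U>"
      by blast
  qed
  moreover have "\<forall>u\<in>\<U>. bounded u \<and> diameter u \<le> d"
  proof
    fix u assume "u \<in> \<U>"
    then obtain pq where u: "u = U pq"
      by (auto simp: \<U>_def)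
    have "u \<subseteq> {of_int k..of_int k + 1}"
      by (auto simp: u U_def B_def)
    then have "bounded u"
      by (rule bounded_subset[rotated]) simp
    moreover have "diameter u \<le> d"
      using close d unfolding u by (intro diameter_le) auto
    ultimately show "bounded u \<and> diameter u \<le> d" ..
  qed
  moreover have "real (card \<U>) * d powr s \<le> e"
  proof -
    have "card \<U> \<le> card ({..Suc m} \<times> {..Suc m})"
      unfolding \<U>_def by (rule card_image_le) simp
    then have "card \<U> \<le> (m + 2)\<^sup>2"
      by (simp add: power2_eq_square)
    then have "real (card \<U>) \<le> (real m + 2)\<^sup>2"
      using of_nat_mono[of "card \<U>" "(m + 2)\<^sup>2", where 'a = real] by (simp add: add.commute)
    moreover have "d powr s = r ^ m"
      using b by (simp add: d_def r_def powr_powr mult.commute flip: powr_realpow)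
    ultimately have "real (card \<U>) * d powr s \<le> (real m + 2)\<^sup>2 * r ^ m"
      using r by (simp add: mult_right_mono)
    then show ?thesis
      using m(2) by simp
  qed
  ultimately show "\<exists>d \<U>. 0 < d \<and> d \<le> e \<and> finite \<U> \<and> {\<beta>. b \<le> \<beta> \<and> \<lfloor>\<beta>\<rfloor> = k \<and> confined \<beta> 1} \<subseteq> \<Union>\<U> \<and>
      (\<forall>u\<in>\<U>. bounded u \<and> diameter u \<le> d) \<and> real (card \<U>) * d powr s \<le> e"
    using d m(1) unfolding B_def[symmetric]
    by (intro exI[of _ d] exI[of _ \<U>]) (auto simp: \<U>_def d_def)
qed

section \<open>Irrational rotation numbers\<close>

text \<open>For irrational \<open>\<gamma>\<close> the digits \<open>\<lceil>(n + 1) * \<gamma>\<rceil> - \<lceil>n * \<gamma>\<rceil>\<close> form the expansion of \<open>1\<close> in a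
  suitable base \<open>\<beta> = 1 / x\<close>. By summation by parts, \<open>1 - \<tau> n\<close> is \<open>1 - x\<close> times the sum of
  \<open>(\<lceil>i * \<gamma>\<rceil> - (\<lceil>(n + i) * \<gamma>\<rceil> - \<lceil>n * \<gamma>\<rceil>)) * x ^ i\<close> over \<open>i\<close>, whose coefficients are \<open>0\<close> or
  \<open>1\<close> and vanish for \<open>i = 0\<close>. This puts \<open>\<tau> n\<close> into \<open>[1 - x, 1]\<close>, and even below \<open>1\<close> for
  positive \<open>n\<close>, because by Kronecker's theorem some coefficient is \<open>1\<close>.\<close>

lemma rotation_base_exists:
  assumes \<gamma>: "\<gamma> \<notin> \<rat>" "0 < \<gamma>" "\<gamma> < 1"
  shows "\<exists>\<beta>>1. \<lfloor>\<beta>\<rfloor> = 1 \<and> confined \<beta> 1 \<and> (\<forall>n. turns \<beta> 1 n = \<lceil>real n * \<gamma>\<rceil>)"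
proof -
  define N where "N n = \<lceil>real n * \<gamma>\<rceil>" for n
  define a where "a n = real_of_int (N (Suc n) - N n)" for n
  have a01: "0 \<le> a n" "a n \<le> 1" for n
  proof -
    have "real n * \<gamma> \<le> real (Suc n) * \<gamma>" "real (Suc n) * \<gamma> \<le> real n * \<gamma> + 1"
      using \<gamma> by (auto simp: distrib_right)
    then have "N n \<le> N (Suc n)" "N (Suc n) \<le> N n + 1"
      using ceiling_mono[of "real (Suc n) * \<gamma>" "real n * \<gamma> + 1"]
      by (auto simp: N_def ceiling_mono)
    then show "0 \<le> a n" "a n \<le> 1"
      by (auto simp: a_def)
  qed
  have N0: "N 0 = 0" and N1: "N 1 = 1"
    using \<gamma> by (auto simp: N_def intro!: ceiling_unique)
  have summable_a: "summable (\<lambda>i. a (n + i) * x ^ i)" if x: "0 \<le> x" "x < 1" for x n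
  proof (rule summable_comparison_test')
    show "summable (\<lambda>i. x ^ i)"
      using x by simp
    show "norm (a (n + i) * x ^ i) \<le> x ^ i" if "i \<ge> 0" for i
      using a01[of "n + i"] x by (simp add: abs_mult mult_left_le_one_le)
  qed
  define f where "f x = x * (\<Sum>i. a i * x ^ i)" for x
  obtain x where x: "0 < x" "x < 1" "f x = 1"
  proof -
    obtain m where m: "1 < real m * \<gamma>"
      using reals_Archimedean3[OF \<gamma>(2)] by blast
    then have m0: "m \<ge> 1"
      by (cases m) auto
    have Nm: "N m \<ge> 2"
      using m by (simp add: N_def)
    define r where "r = 1 - 1 / (2 * real m)"
    have r: "0 < r" "r < 1"
      using m0 by (auto simp: r_def field_simps)
    have "1 / 2 = 1 + real m * (r - 1)"
      using m0 by (simp add: r_def)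
    also have "\<dots> \<le> (1 + (r - 1)) ^ m"
      using r by (intro Bernoulli_inequality) auto
    finally have rm: "1 / 2 \<le> r ^ m"
      by simp
    have "1 \<le> r ^ m * real_of_int (N m)"
      using mult_mono[OF rm, of 2 "real_of_int (N m)"] Nm r by simp
    also have "real_of_int (N m) = (\<Sum>i<m. a i)"
      unfolding a_def by (induction m) (auto simp: N0)
    also have "r ^ m * (\<Sum>i<m. a i) \<le> r * (\<Sum>i<m. a i * r ^ i)"
      unfolding sum_distrib_left
    proof (rule sum_mono)
      fix i assume "i \<in> {..<m}"
      then have "r ^ m \<le> r ^ Suc i"
        using r by (intro power_decreasing) auto
      then have "r ^ m * a i \<le> r ^ Suc i * a i"
        using a01(1)[of i] by (rule mult_right_mono)
      then show "r ^ m * a i \<le> r * (a i * r ^ i)"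
        by (simp add: algebra_simps)
    qed
    also have "\<dots> \<le> f r"
      unfolding f_def using r a01 summable_a[of r 0]
      by (intro mult_left_mono sum_le_suminf) auto
    finally have "1 \<le> f r" .
    moreover have "\<forall>x. 0 \<le> x \<and> x \<le> r \<longrightarrow> isCont f x"
    proof (intro allI impI)
      fix x assume xr: "0 \<le> x \<and> x \<le> r"
      define K where "K = (1 + r) / 2"
      have K: "r < K" "0 \<le> K" "K < 1"
        using r by (auto simp: K_def)
      have "isCont (\<lambda>x. \<Sum>i. a i * x ^ i) x"
        using summable_a[OF K(2,3), of 0] xr K by (intro isCont_powser) auto
      then show "isCont f x"
        unfolding f_def by (intro continuous_intros)
    qed
    ultimately obtain x where x: "0 \<le> x" "x \<le> r" "f x = 1"
      using IVT[of f 0 1 r] r by (auto simp: f_def)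
    then have "x \<noteq> 0"
      by (auto simp: f_def)
    then show ?thesis
      using that[of x] x r by auto
  qed
  define \<rho> where "\<rho> n = (\<Sum>i. a (n + i) * x ^ i) * x" for n
  define S where "S n i = real_of_int (N (n + i) - N n)" for n i
  have \<rho>0: "\<rho> 0 = 1"
    using x(3) by (simp add: \<rho>_def f_def mult.commute)
  have \<rho>_split: "\<rho> n = x * (a n + \<rho> (Suc n))" for n
  proof -
    have "(\<Sum>i. a (n + Suc i) * x ^ Suc i) = (\<Sum>i. a (n + i) * x ^ i) - a n"
      using suminf_split_head[OF summable_a[of x n]] x by simp
    moreover have "(\<Sum>i. a (n + Suc i) * x ^ Suc i) = \<rho> (Suc n)"
      unfolding \<rho>_def using suminf_mult2[OF summable_a[of x "Suc n"], of x] x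
      by (simp add: algebra_simps)
    ultimately show ?thesis
      by (simp add: \<rho>_def algebra_simps)
  qed
  have S_bound: "\<bar>S n i\<bar> \<le> real (Suc i)" for n i
  proof -
    have "S n i = (\<Sum>j<i. a (n + j))"
      by (induction i) (auto simp: S_def a_def)
    moreover have "0 \<le> (\<Sum>j<i. a (n + j))" "(\<Sum>j<i. a (n + j)) \<le> real i * 1"
      using a01 sum_bounded_above[of "{..<i}" "\<lambda>j. a (n + j)" 1] by (auto intro!: sum_nonneg)
    ultimately show ?thesis by simp
  qed
  have summable_S: "summable (\<lambda>i. S n i * x ^ i)" for n
  proof (rule summable_comparison_test')
    show "summable (\<lambda>i. real (Suc i) * x ^ i)"
      using geometric_deriv_sums[of x] x by (auto simp: sums_iff)
    show "norm (S n i * x ^ i) \<le> real (Suc i) * x ^ i" if "i \<ge> 0" for i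
      using S_bound[of n i] x by (simp add: abs_mult mult_right_mono)
  qed
  define W where "W n = (\<Sum>i. S n i * x ^ i)" for n
  have \<rho>_W: "\<rho> n = (1 - x) * W n" for n
  proof -
    have "(\<lambda>i. S n (Suc i) * x ^ Suc i) sums W n"
      using summable_S[of n] sums_Suc_iff[of "\<lambda>i. S n i * x ^ i" "W n"]
      by (simp add: W_def S_def summable_sums)
    moreover have "(\<lambda>i. x * (S n i * x ^ i)) sums (x * W n)"
      unfolding W_def by (intro sums_mult summable_sums summable_S)
    ultimately have "(\<lambda>i. S n (Suc i) * x ^ Suc i - x * (S n i * x ^ i)) sums (W n - x * W n)"
      by (rule sums_diff)
    moreover have "S n (Suc i) * x ^ Suc i - x * (S n i * x ^ i) = a (n + i) * x ^ i * x" for i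
      by (simp add: S_def a_def algebra_simps)
    ultimately have "(\<lambda>i. a (n + i) * x ^ i * x) sums (W n - x * W n)"
      by simp
    moreover have "(\<lambda>i. a (n + i) * x ^ i * x) sums \<rho> n"
      unfolding \<rho>_def using x by (intro sums_mult2 summable_sums summable_a) auto
    ultimately have "\<rho> n = W n - x * W n"
      by (rule sums_unique2[symmetric])
    then show ?thesis
      by (simp add: algebra_simps)
  qed
  have S_le: "S n i \<le> S 0 i" for n i
    using ceiling_add_le[of "real n * \<gamma>" "real i * \<gamma>"]
    by (simp add: S_def N_def distrib_right)
  have S_ge: "S 0 i - (if i = 0 then 0 else 1) \<le> S n i" for n i
  proof (cases "i = 0")
    case False
    have "\<lceil>real n * \<gamma>\<rceil> + \<lceil>real i * \<gamma>\<rceil> \<le> \<lceil>real n * \<gamma> + real i * \<gamma>\<rceil> + 1"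
      by linarith
    then show ?thesis
      using False by (simp add: S_def N_def distrib_right)
  qed (simp add: S_def)
  have \<rho>_ge: "1 - x \<le> \<rho> n" for n
  proof -
    have "(\<lambda>i. x ^ Suc i) sums (x * (1 / (1 - x)))"
      unfolding power_Suc using x by (intro sums_mult geometric_sums) auto
    then have "(\<lambda>i. (if i = 0 then 0 else 1) * x ^ i) sums (x / (1 - x))"
      using sums_Suc_iff[of "\<lambda>i. (if i = 0 then 0 else 1) * x ^ i" "x / (1 - x)"] by simp
    then have "(\<lambda>i. S 0 i * x ^ i - (if i = 0 then 0 else 1) * x ^ i) sums (W 0 - x / (1 - x))"
      unfolding W_def by (intro sums_diff summable_sums summable_S)
    then have "W 0 - x / (1 - x) \<le> W n"
    proof (rule sums_le[rotated])
      show "(\<lambda>i. S n i * x ^ i) sums W n"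
        unfolding W_def by (intro summable_sums summable_S)
      show "S 0 i * x ^ i - (if i = 0 then 0 else 1) * x ^ i \<le> S n i * x ^ i" for i
        using mult_right_mono[OF S_ge[of i n], of "x ^ i"] x by (simp add: left_diff_distrib)
    qed
    then have "(1 - x) * (W 0 - x / (1 - x)) \<le> (1 - x) * W n"
      using x by (intro mult_left_mono) auto
    then show ?thesis
      using \<rho>_W[of 0] \<rho>_W[of n] \<rho>0 x by (simp add: right_diff_distrib)
  qed
  have \<rho>_less: "\<rho> n < 1" if n: "n \<ge> 1" for n
  proof -
    define \<theta> where "\<theta> = real_of_int \<lceil>real n * \<gamma>\<rceil> - real n * \<gamma>"
    have irr: "real i * \<gamma> \<notin> \<int>" if "i \<ge> 1" for i
    proof
      assume "real i * \<gamma> \<in> \<int>"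
      then have "real i * \<gamma> / real i \<in> \<rat>"
        by (intro Rats_divide) (auto elim: Ints_cases)
      then show False
        using \<gamma> that by simp
    qed
    have \<theta>: "0 < \<theta>" "\<theta> < 1"
    proof -
      have "real n * \<gamma> \<noteq> real_of_int \<lceil>real n * \<gamma>\<rceil>"
        using irr[OF n] by (metis Ints_of_int)
      then show "0 < \<theta>"
        unfolding \<theta>_def using le_of_int_ceiling[of "real n * \<gamma>"] by linarith
      show "\<theta> < 1"
        unfolding \<theta>_def by linarith
    qed
    obtain i where i: "i > 0" "\<bar>frac (real i * \<gamma>) - \<theta> / 2\<bar> < \<theta> / 2"
      using Kronecker_approx_1_explicit[OF \<gamma>(1), of "\<theta> / 2" "\<theta> / 2"] \<theta> by auto
    have fr: "0 < frac (real i * \<gamma>)" "frac (real i * \<gamma>) < \<theta>"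
      using i(2) unfolding abs_less_iff
      by linarith+
    have "S n i < S 0 i"
    proof -
      have "real n * \<gamma> + real i * \<gamma> < real_of_int (\<lceil>real n * \<gamma>\<rceil> + \<lfloor>real i * \<gamma>\<rfloor>)"
        using fr(2) by (simp add: \<theta>_def frac_def)
      then have "\<lceil>real n * \<gamma> + real i * \<gamma>\<rceil> \<le> \<lceil>real n * \<gamma>\<rceil> + \<lfloor>real i * \<gamma>\<rfloor>"
        by linarith
      moreover have "\<lfloor>real i * \<gamma>\<rfloor> < \<lceil>real i * \<gamma>\<rceil>"
        using fr(1) by (simp add: frac_def) linarith
      ultimately show ?thesis
        by (simp add: S_def N_def distrib_right)
    qed
    have sm: "summable (\<lambda>i. S 0 i * x ^ i - S n i * x ^ i)"
      by (intro summable_diff summable_S)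
    have "0 < (\<Sum>i. S 0 i * x ^ i - S n i * x ^ i)"
    proof (rule suminf_pos2[OF sm])
      show "0 \<le> S 0 i * x ^ i - S n i * x ^ i" for i
        using S_le[of n i] x by (simp add: mult_right_mono)
      show "0 < S 0 i * x ^ i - S n i * x ^ i"
        using \<open>S n i < S 0 i\<close> x by simp
    qed
    also have "\<dots> = W 0 - W n"
      unfolding W_def by (intro suminf_diff[symmetric] summable_S)
    finally have "(1 - x) * W n < (1 - x) * W 0"
      using x by simp
    then show ?thesis
      using \<rho>_W[of 0] \<rho>_W[of n] \<rho>0 by simp
  qed
  define \<beta> where "\<beta> = 1 / x"
  have \<beta>: "\<beta> > 1"
    using x by (simp add: \<beta>_def)
  have \<beta>\<rho>: "\<beta> * \<rho> n = of_int (N (Suc n) - N n) + \<rho> (Suc n)" for n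
    using \<rho>_split[of n] x by (simp add: \<beta>_def a_def)
  have \<rho>_pos: "0 \<le> \<rho> n" for n
    using \<rho>_ge[of n] x by simp
  have orb: "orb \<beta> 1 n = \<rho> n" for n
  proof (induction n)
    case (Suc n)
    show ?case
      by (rule digit_unique(2)[of _ _ _ "N (Suc n) - N n"])
         (use Suc \<beta>\<rho>[of n] \<rho>_pos \<rho>_less[of "Suc n"] in auto)
  qed (simp add: \<rho>0)
  have dg: "digit \<beta> 1 n = N (Suc n) - N n" for n
    by (rule digit_unique(1)[of _ _ _ _ "\<rho> (Suc n)"])
       (use orb[of n] \<beta>\<rho>[of n] \<rho>_pos \<rho>_less[of "Suc n"] in auto)
  have fl: "\<lfloor>\<beta>\<rfloor> = 1"
    using dg[of 0] N0 N1 by (simp add: digit_def)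
  have "confined \<beta> 1"
    using \<rho>_ge by (simp add: confined_def orb) (simp add: \<beta>_def)
  moreover have "turns \<beta> 1 n = N n" for n
    by (induction n) (auto simp: turns_Suc dg fl N0)
  ultimately show ?thesis
    using \<beta> fl by (auto simp: N_def)
qed

text \<open>When \<open>n * \<gamma>\<close> is just below an integer, which happens by Kronecker's theorem, the digits from
  time \<open>n\<close> on repeat the first \<open>L\<close> digits of \<open>1\<close>.\<close>

lemma orbit_of_one_returns_to_one:
  assumes \<beta>: "\<beta> > 1" and \<gamma>: "\<gamma> \<notin> \<rat>" "0 < \<gamma>"
    and turns: "\<And>n. turns \<beta> 1 n = \<lceil>real n * \<gamma>\<rceil>" and v: "v < 1"
  shows "\<exists>n\<ge>1. v < orb \<beta> 1 n"
proof -
  obtain L where L: "1 / (1 - v) < \<beta> ^ L"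
    using real_arch_pow[OF \<beta>] by blast
  have irr: "frac (real i * \<gamma>) > 0" if "i \<ge> 1" for i
  proof -
    have "real i * \<gamma> \<notin> \<int>"
    proof
      assume "real i * \<gamma> \<in> \<int>"
      then have "real i * \<gamma> / real i \<in> \<rat>"
        by (intro Rats_divide) (auto elim: Ints_cases)
      then show False
        using \<gamma> that by simp
    qed
    then show ?thesis
      by (simp add: frac_gt_0_iff)
  qed
  obtain i0 where i0: "i0 < Suc L" "\<And>i. i < Suc L \<Longrightarrow> frac (real (Suc i0) * \<gamma>) \<le> frac (real (Suc i) * \<gamma>)"
    using exists_minimum_below[of "Suc L" "\<lambda>i. frac (real (Suc i) * \<gamma>)"] by blast
  define \<delta> where "\<delta> = frac (real (Suc i0) * \<gamma>)"
  have \<delta>: "\<delta> > 0" "\<And>i. 1 \<le> i \<Longrightarrow> i \<le> L \<Longrightarrow> \<delta> \<le> frac (real i * \<gamma>)"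
  proof -
    show "\<delta> > 0"
      using irr[of "Suc i0"] by (simp add: \<delta>_def)
    show "\<delta> \<le> frac (real i * \<gamma>)" if "1 \<le> i" "i \<le> L" for i
      using i0(2)[of "i - 1"] that by (simp add: \<delta>_def)
  qed
  obtain n where n: "n > 0" "\<bar>frac (real n * \<gamma>) - 1\<bar> < \<delta>"
    using Kronecker_approx_1_explicit[OF \<gamma>(1), of 1 \<delta>] \<delta>(1) by auto
  have agree: "\<lceil>real (n + i) * \<gamma>\<rceil> - \<lceil>real n * \<gamma>\<rceil> = \<lceil>real i * \<gamma>\<rceil>" if "i \<le> L" for i
  proof (cases "i = 0")
    case False
    have fn: "0 < frac (real n * \<gamma>)" "frac (real n * \<gamma>) < 1" "1 - frac (real n * \<gamma>) < \<delta>"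
      using irr[of n] n frac_lt_1[of "real n * \<gamma>"] by auto
    have fi: "\<delta> \<le> frac (real i * \<gamma>)" "frac (real i * \<gamma>) < 1"
      using \<delta>(2)[of i] False that frac_lt_1[of "real i * \<gamma>"] by auto
    have "\<lceil>real n * \<gamma>\<rceil> = \<lfloor>real n * \<gamma>\<rfloor> + 1" "\<lceil>real i * \<gamma>\<rceil> = \<lfloor>real i * \<gamma>\<rfloor> + 1"
      using fn fi \<delta>(1) unfolding frac_def by linarith+
    moreover have "\<lceil>real n * \<gamma> + real i * \<gamma>\<rceil> = \<lfloor>real n * \<gamma>\<rfloor> + \<lfloor>real i * \<gamma>\<rfloor> + 2"
      using fn fi unfolding frac_def by (intro ceiling_unique) auto
    ultimately show ?thesis
      by (simp add: distrib_right)
  qed simp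
  have dg: "digit \<beta> 1 (n + i) = digit \<beta> 1 i" if "i < L" for i
  proof -
    have "turns \<beta> 1 (n + Suc i) - turns \<beta> 1 n = turns \<beta> 1 (Suc i)"
      "turns \<beta> 1 (n + i) - turns \<beta> 1 n = turns \<beta> 1 i"
      unfolding turns using agree[of "Suc i"] agree[of i] that by auto
    then show ?thesis
      by (simp add: turns_Suc)
  qed
  have "orb \<beta> 1 (n + i) - orb \<beta> 1 i = \<beta> ^ i * (orb \<beta> 1 n - 1)" if "i \<le> L" for i
    using that
  proof (induction i)
    case (Suc i)
    have "orb \<beta> 1 (n + Suc i) - orb \<beta> 1 (Suc i) = \<beta> * (orb \<beta> 1 (n + i) - orb \<beta> 1 i)"
      using dg[of i] Suc.prems by (simp add: orb_Suc right_diff_distrib)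
    then show ?case
      using Suc by simp
  qed simp
  from this[of L] have "- 1 \<le> \<beta> ^ L * (orb \<beta> 1 n - 1)"
    using orb_le_1[of 1 \<beta> L] orb_nonneg[of 1 \<beta> "n + L"] by simp
  then have "\<beta> ^ L * (1 - orb \<beta> 1 n) \<le> 1"
    by (simp add: algebra_simps)
  moreover have "1 < \<beta> ^ L * (1 - v)"
    using L v by (simp add: field_simps)
  ultimately have "\<beta> ^ L * (1 - orb \<beta> 1 n) < \<beta> ^ L * (1 - v)"
    by simp
  then have "v < orb \<beta> 1 n"
    using \<beta> by simp
  then show ?thesis
    using n(1) by (intro exI[of _ n]) auto
qed

text \<open>A periodic orbit above \<open>1 - 1 / \<beta>\<close> would have the same rotation number as the orbit of \<open>1\<close>,
  but its rotation number is rational. Hence every periodic minimal point \<open>t\<close> lies below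
  \<open>1 - 1 / \<beta>\<close>, and the orbit of \<open>1\<close>, which returns arbitrarily close to \<open>1\<close>, provides the points
  that are needed to approach \<open>t\<close>.\<close>

lemma no_isolated_points_of_irrational_rotation:
  assumes \<beta>: "\<beta> > 1" and conf: "confined \<beta> 1" and \<gamma>: "\<gamma> \<notin> \<rat>" "0 < \<gamma>"
    and turns: "\<And>n. turns \<beta> 1 n = \<lceil>real n * \<gamma>\<rceil>"
  shows "\<not> t isolated_in bifurcation_set \<beta>"
proof -
  have "t islimpt bifurcation_set \<beta>" if t: "t \<in> bifurcation_set \<beta>"
  proof -
    have t_le: "t \<le> orb \<beta> t n" and t01: "0 \<le> t" "t < 1" for n
      using t by (auto simp: mem_bifurcation_set[OF \<beta>])
    consider "t = 0" | "t > 0" "\<And>m. m > 0 \<Longrightarrow> orb \<beta> t m \<noteq> t" | m where "m > 0" "orb \<beta> t m = t"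
      using t01 by fastforce
    then show ?thesis
    proof cases
      case 1
      then show ?thesis
        using zero_islimpt_bifurcation_set[OF \<beta>] by simp
    next
      case 2
      then show ?thesis
        using islimpt_of_nonperiodic[OF \<beta> t] by blast
    next
      case (3 m)
      have t_low: "t \<le> 1 - 1 / \<beta>"
      proof (rule ccontr)
        assume "\<not> ?thesis"
        then have t_conf: "confined \<beta> t"
          using t_le t01 unfolding confined_def by (meson less_imp_le not_le order_trans)
        define c where "c = turns \<beta> t m"
        have c: "turns \<beta> t (m * r) = int r * c" for r
        proof (induction r)
          case (Suc r)
          have "turns \<beta> t (m * r + m) = turns \<beta> t (m * r) + turns \<beta> (orb \<beta> t (m * r)) m"
            by (rule turns_add)
          then show ?case
            using Suc orb_periodic(1)[OF 3(2), of r] by (simp add: c_def algebra_simps)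
        qed simp
        have bound: "real r * \<bar>real_of_int c - real m * \<gamma>\<bar> \<le> 3" for r
        proof -
          define n where "n = m * r"
          have "t + of_int 0 \<le> 1 + of_int 0"
            using t01 by simp
          from lifted_orbits_ordered[OF \<beta> t_conf conf this, of n]
          have 1: "orb \<beta> t n + turns \<beta> t n \<le> orb \<beta> 1 n + turns \<beta> 1 n"
            by simp
          have "1 + of_int 0 \<le> t + of_int 1"
            using t01 by simp
          from lifted_orbits_ordered[OF \<beta> conf t_conf this, of n]
          have 2: "orb \<beta> 1 n + turns \<beta> 1 n \<le> orb \<beta> t n + turns \<beta> t n + 1"
            by simp
          have "\<bar>real_of_int (turns \<beta> t n) - real_of_int (turns \<beta> 1 n)\<bar> \<le> 2"
            using 1 2 confined_bounds[OF \<beta> conf, of n] confined_bounds[OF \<beta> t_conf, of n]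
            by linarith
          moreover have "\<bar>real_of_int (turns \<beta> 1 n) - real n * \<gamma>\<bar> \<le> 1"
            unfolding turns by linarith
          ultimately have "\<bar>real_of_int (turns \<beta> t n) - real n * \<gamma>\<bar> \<le> 3"
            by linarith
          moreover have "real_of_int (turns \<beta> t n) - real n * \<gamma> = real r * (real_of_int c - real m * \<gamma>)"
            by (simp add: n_def c algebra_simps)
          ultimately show ?thesis
            by (simp add: abs_mult)
        qed
        have "\<bar>real_of_int c - real m * \<gamma>\<bar> = 0"
        proof (rule ccontr)
          assume "\<bar>real_of_int c - real m * \<gamma>\<bar> \<noteq> 0"
          then have "0 < \<bar>real_of_int c - real m * \<gamma>\<bar>"
            by simp
          from reals_Archimedean3[OF this] show False
            using bound by (meson not_le)
        qed
        then have "\<gamma> = real_of_int c / real m"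
          using 3(1) by (simp add: field_simps)
        then show False
          using \<gamma>(1) by (metis Rats_divide Rats_of_int Rats_of_nat)
      qed
      obtain i where i: "i < m" "\<And>j. j < m \<Longrightarrow> orb \<beta> t j \<le> orb \<beta> t i"
        using exists_minimum_below[OF 3(1), of "\<lambda>j. - orb \<beta> t j"] by auto
      have max: "orb \<beta> t j \<le> orb \<beta> t i" for j
        using i(2)[of "j mod m"] 3(1) orb_periodic(2)[OF 3(2), of "j div m" "j mod m"] by simp
      have "orb \<beta> t i < 1"
        using t01 by (simp add: orb_bounds)
      then obtain n where n: "n \<ge> 1" "orb \<beta> t i < orb \<beta> 1 n"
        using orbit_of_one_returns_to_one[OF \<beta> \<gamma> turns] by blast
      show ?thesis
      proof (rule islimpt_of_periodic[OF \<beta> t 3 max n(2)])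
        show "orb \<beta> 1 n < 1"
          using n(1) by (simp add: orb_bounds)
        show "t \<le> orb \<beta> (orb \<beta> 1 n) j" for j
          using t_low confined_bounds(1)[OF \<beta> conf, of "n + j"] by (simp add: orb_add)
      qed
    qed
  qed
  then show ?thesis
    unfolding isolated_in_islimpt_iff by blast
qed

lemma uncountable_irrationals: "uncountable {\<gamma>::real. \<gamma> \<notin> \<rat> \<and> 0 < \<gamma> \<and> \<gamma> < 1}"
proof
  assume "countable {\<gamma>::real. \<gamma> \<notin> \<rat> \<and> 0 < \<gamma> \<and> \<gamma> < 1}"
  then have "countable ({\<gamma>::real. \<gamma> \<notin> \<rat> \<and> 0 < \<gamma> \<and> \<gamma> < 1} \<union> \<rat>)"
    using countable_rat by blast
  then have "countable {0<..<1::real}"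
    by (rule countable_subset[rotated]) auto
  then show False
    using uncountable_open_interval[of 0 "1::real"] by simp
qed

text \<open>Bases with different rotation numbers are different.\<close>

lemma uncountable_bases_without_isolated_points:
  "uncountable {\<beta>. \<beta> > 1 \<and> \<not> (\<exists>t. t isolated_in bifurcation_set \<beta>)}"
proof
  define G where "G = {\<gamma>::real. \<gamma> \<notin> \<rat> \<and> 0 < \<gamma> \<and> \<gamma> < 1}"
  define E where "E = {\<beta>. \<beta> > 1 \<and> \<not> (\<exists>t. t isolated_in bifurcation_set \<beta>)}"
  have "\<forall>\<gamma>\<in>G. \<exists>\<beta>. \<beta> \<in> E \<and> (\<forall>n. turns \<beta> 1 n = \<lceil>real n * \<gamma>\<rceil>)"
  proof
    fix \<gamma> assume "\<gamma> \<in> G"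
    then have \<gamma>: "\<gamma> \<notin> \<rat>" "0 < \<gamma>" "\<gamma> < 1"
      by (auto simp: G_def)
    obtain \<beta> where \<beta>: "\<beta> > 1" "confined \<beta> 1" "\<And>n. turns \<beta> 1 n = \<lceil>real n * \<gamma>\<rceil>"
      using rotation_base_exists[OF \<gamma>] by blast
    then have "\<beta> \<in> E"
      using no_isolated_points_of_irrational_rotation[OF \<beta>(1,2) \<gamma>(1,2) \<beta>(3)] by (simp add: E_def)
    then show "\<exists>\<beta>. \<beta> \<in> E \<and> (\<forall>n. turns \<beta> 1 n = \<lceil>real n * \<gamma>\<rceil>)"
      using \<beta>(3) by blast
  qed
  from bchoice[OF this] obtain b where
    b: "\<And>\<gamma>. \<gamma> \<in> G \<Longrightarrow> b \<gamma> \<in> E" "\<And>\<gamma> n. \<gamma> \<in> G \<Longrightarrow> turns (b \<gamma>) 1 n = \<lceil>real n * \<gamma>\<rceil>"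
    by blast
  have "inj_on b G"
  proof (rule linorder_inj_onI)
    fix \<gamma> \<gamma>' assume \<gamma>: "\<gamma> < \<gamma>'" "\<gamma> \<in> G" "\<gamma>' \<in> G"
    show "b \<gamma> \<noteq> b \<gamma>'"
    proof
      assume eq: "b \<gamma> = b \<gamma>'"
      obtain n where n: "1 < real n * (\<gamma>' - \<gamma>)"
        using reals_Archimedean3[of "\<gamma>' - \<gamma>"] \<gamma>(1) by auto
      have "\<lceil>real n * \<gamma>\<rceil> = \<lceil>real n * \<gamma>'\<rceil>"
        using b(2)[OF \<gamma>(2), of n] b(2)[OF \<gamma>(3), of n] eq by simp
      then show False
        using n unfolding right_diff_distrib by linarith
    qed
  qed auto
  moreover assume "countable {\<beta>. \<beta> > 1 \<and> \<not> (\<exists>t. t isolated_in bifurcation_set \<beta>)}"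
  then have "countable (b ` G)"
    unfolding E_def[symmetric] by (rule countable_subset[rotated]) (use b(1) in auto)
  ultimately have "countable G"
    by (rule countable_image_inj_on[rotated])
  then show False
    using uncountable_irrationals by (simp add: G_def)
qed

lemma hausdorff_dim_bases_without_isolated_points:
  "hausdorff_dim {\<beta>. \<beta> > 1 \<and> \<not> (\<exists>t. t isolated_in bifurcation_set \<beta>)} = 0"
proof -
  define E where "E = {\<beta>. \<beta> > 1 \<and> \<not> (\<exists>t. t isolated_in bifurcation_set \<beta>)}"
  define Z where "Z = {\<beta>. \<beta> > 1 \<and> (\<exists>n. orb \<beta> 1 n = 0)}"
  define B where "B k j = {\<beta>. 1 + 1 / real (Suc j) \<le> \<beta> \<and> \<lfloor>\<beta>\<rfloor> = int k \<and> confined \<beta> 1}" for k j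
  have null: "hausdorff_measure s E = 0" if s: "s > 0" for s
  proof -
    have B: "hausdorff_measure s (B k j) = 0" for k j
      unfolding B_def by (intro hausdorff_null_confined_bases s) simp
    define V where "V n = (case n of 0 \<Rightarrow> Z | Suc k \<Rightarrow> (\<Union>j. B k j))" for n
    have "hausdorff_measure s (V n) = 0" for n
      using hausdorff_null_countable[OF countable_orbit_of_one_hits_zero s] hausdorff_null_UN[OF B]
      by (simp add: V_def Z_def split: nat.split)
    then have "hausdorff_measure s (\<Union>n. V n) = 0"
      by (rule hausdorff_null_UN)
    moreover have "E \<subseteq> (\<Union>n. V n)"
    proof
      fix \<beta> assume "\<beta> \<in> E"
      then have \<beta>: "\<beta> > 1" "\<And>t. \<not> t isolated_in bifurcation_set \<beta>"
        by (auto simp: E_def)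
      show "\<beta> \<in> (\<Union>n. V n)"
      proof (cases "\<beta> \<in> Z")
        case True
        then have "\<beta> \<in> V 0"
          by (simp add: V_def)
        then show ?thesis by blast
      next
        case False
        then have "confined \<beta> 1"
          using orbit_of_one_confined[OF \<beta>(1) _ \<beta>(2)] \<beta>(1) by (simp add: confined_def Z_def)
        moreover obtain j where "1 / (\<beta> - 1) < real j"
          using reals_Archimedean2[of "1 / (\<beta> - 1)"] by auto
        then have "1 / (\<beta> - 1) < real (Suc j)"
          by simp
        then have "1 + 1 / real (Suc j) \<le> \<beta>"
          using \<beta>(1) by (simp add: field_simps)
        moreover have "\<lfloor>\<beta>\<rfloor> = int (nat \<lfloor>\<beta>\<rfloor>)"
          using \<beta>(1) by simp
        ultimately have "\<beta> \<in> B (nat \<lfloor>\<beta>\<rfloor>) j"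
          by (simp add: B_def)
        then have "\<beta> \<in> V (Suc (nat \<lfloor>\<beta>\<rfloor>))"
          by (auto simp: V_def)
        then show ?thesis by blast
      qed
    qed
    ultimately show ?thesis
      by (rule hausdorff_null_subset[rotated])
  qed
  have "hausdorff_dim E \<le> 0"
  proof (rule ennreal_le_epsilon)
    fix e :: real assume e: "e > 0"
    have "hausdorff_dim E \<le> ennreal e"
      unfolding hausdorff_dim_def using null[OF e] e
      by (intro Inf_lower CollectI exI[of _ e]) auto
    then show "hausdorff_dim E \<le> 0 + ennreal e"
      by simp
  qed
  then show ?thesis
    by (simp add: E_def)
qed

section \<open>Size and isolated points of the bifurcation set\<close>

theorem theorem1p3:
  shows "(\<forall>\<beta>>1. bifurcation_set \<beta> =
             {t \<in> {0..<1}. \<forall>n::nat. (beta_map \<beta> ^^ n) t \<ge> t}) \<and>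
         (\<forall>\<beta>>1. bifurcation_set \<beta> \<in> null_sets lebesgue \<and>
             hausdorff_dim (bifurcation_set \<beta>) = 1) \<and>
         (AE \<beta> in lebesgue. \<beta> > 1 \<longrightarrow>
             (\<forall>\<epsilon>>0.
                infinite {t \<in> bifurcation_set \<beta>. t < \<epsilon> \<and> t isolated_in bifurcation_set \<beta>} \<and>
                infinite {t \<in> bifurcation_set \<beta>. t < \<epsilon> \<and> t islimpt bifurcation_set \<beta>})) \<and>
         (\<exists>E\<^sub>L. E\<^sub>L \<subseteq> {1<..} \<and> uncountable E\<^sub>L \<and> hausdorff_dim E\<^sub>L = 0 \<and>
             (\<forall>\<beta>>1. (\<not> (\<exists>t. t isolated_in bifurcation_set \<beta>)) \<longleftrightarrow> \<beta> \<in> E\<^sub>L))"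
proof (intro conjI)
  show "\<forall>\<beta>>1. bifurcation_set \<beta> = {t \<in> {0..<1}. \<forall>n::nat. (beta_map \<beta> ^^ n) t \<ge> t}"
    by (auto simp: mem_bifurcation_set orb_def)
  show "\<forall>\<beta>>1. bifurcation_set \<beta> \<in> null_sets lebesgue \<and> hausdorff_dim (bifurcation_set \<beta>) = 1"
    by (simp add: bifurcation_set_null hausdorff_dim_bifurcation_set)
  show "AE \<beta> in lebesgue. \<beta> > 1 \<longrightarrow>
             (\<forall>\<epsilon>>0.
                infinite {t \<in> bifurcation_set \<beta>. t < \<epsilon> \<and> t isolated_in bifurcation_set \<beta>} \<and>
                infinite {t \<in> bifurcation_set \<beta>. t < \<epsilon> \<and> t islimpt bifurcation_set \<beta>})"
    using AE_isolated_points_near_0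
  proof eventually_elim
    case (elim \<beta>)
    show ?case
    proof (intro impI allI conjI)
      fix \<epsilon> :: real assume \<beta>: "\<beta> > 1" and \<epsilon>: "\<epsilon> > 0"
      show "infinite {t \<in> bifurcation_set \<beta>. t < \<epsilon> \<and> t isolated_in bifurcation_set \<beta>}"
      proof (rule infinite_of_arbitrarily_small)
        fix \<eta> :: real assume "\<eta> > 0"
        then obtain t where "t isolated_in bifurcation_set \<beta>" "0 < t" "t < min \<eta> \<epsilon>"
          using elim \<beta> \<epsilon> by (metis min_less_iff_conj)
        then show "\<exists>t\<in>{t \<in> bifurcation_set \<beta>. t < \<epsilon> \<and> t isolated_in bifurcation_set \<beta>}. 0 < t \<and> t < \<eta>"
          by (intro bexI[of _ t]) (auto simp: isolated_in_def)
      qed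
      show "infinite {t \<in> bifurcation_set \<beta>. t < \<epsilon> \<and> t islimpt bifurcation_set \<beta>}"
        by (rule infinite_accumulation_points_near_0[OF \<beta> \<epsilon>])
    qed
  qed
  show "\<exists>E\<^sub>L. E\<^sub>L \<subseteq> {1<..} \<and> uncountable E\<^sub>L \<and> hausdorff_dim E\<^sub>L = 0 \<and>
             (\<forall>\<beta>>1. (\<not> (\<exists>t. t isolated_in bifurcation_set \<beta>)) \<longleftrightarrow> \<beta> \<in> E\<^sub>L)"
    by (intro exI[of _ "{\<beta>. \<beta> > 1 \<and> \<not> (\<exists>t. t isolated_in bifurcation_set \<beta>)}"] conjI
          uncountable_bases_without_isolated_points hausdorff_dim_bases_without_isolated_points)
       auto
qed

end
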